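(* Let $G$ be a group without elements of finite order (other than the identity). Then there exists a complete Hilbert manifold with positive constant sectional curvature whose fundamental group is (isomorphic to) $G$.
   Context: A Hilbert manifold is a manifold modeled on a (not necessarily separable) real Hilbert space $\mathbb{H}$ equipped with an inner product on each tangent space $T_pM\cong\mathbb{H}$, depending smoothly on $p$ and inducing a norm equivalent to that of $\mathbb{H}$ (a Riemannian metric). It is complete if it is a complete metric space for the distance induced by the Riemannian metric. *)

theory Defs
  imports "HOL-Analysis.Analysis" "HOL-Algebra.Group"
begin

section \<open>Real Hilbert spaces of arbitrary dimension\<close>

text \<open>
  A real Hilbert space is a type of sort \<open>{real_inner, complete_space}\<close>. The library has no
  non-separable instance, so the square-summable real families indexed by a type are provided here.
\<close>

typedef 'i ell2 = "{f :: 'i \<Rightarrow> real. (\<lambda>i. (f i)\<^sup>2) summable_on UNIV}"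
  morphisms ell2_coord Abs_ell2
  by (rule exI[of _ "\<lambda>_. 0"]) simp

lemma ell2_coord_summable: "(\<lambda>i. (ell2_coord f i)\<^sup>2) summable_on UNIV"
  using ell2_coord[of f] by simp

lemma ell2_eqI: "(\<And>i. ell2_coord f i = ell2_coord g i) \<Longrightarrow> f = g"
  by (simp add: ell2_coord_inject[symmetric] ext)

lemma square_summable_mult:
  fixes f g :: "'i \<Rightarrow> real"
  assumes "(\<lambda>i. (f i)\<^sup>2) summable_on UNIV" "(\<lambda>i. (g i)\<^sup>2) summable_on UNIV"
  shows "(\<lambda>i. f i * g i) summable_on UNIV"
proof -
  have "(\<lambda>i. norm (f i * g i)) summable_on UNIV"
  proof (rule Infinite_Sum.abs_summable_on_comparison_test')
    show "(\<lambda>i. (f i)\<^sup>2 + (g i)\<^sup>2) summable_on UNIV"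
      by (intro summable_on_add assms)
    fix i
    have "0 \<le> (\<bar>f i\<bar> - \<bar>g i\<bar>)\<^sup>2" by simp
    then have "2 * (\<bar>f i\<bar> * \<bar>g i\<bar>) \<le> (f i)\<^sup>2 + (g i)\<^sup>2"
      by (simp add: power2_diff)
    moreover have "0 \<le> \<bar>f i\<bar> * \<bar>g i\<bar>" by simp
    ultimately show "norm (f i * g i) \<le> (f i)\<^sup>2 + (g i)\<^sup>2"
      unfolding real_norm_def abs_mult by linarith
  qed
  then show ?thesis by (rule abs_summable_summable)
qed

lemma square_summable_add:
  fixes f g :: "'i \<Rightarrow> real"
  assumes "(\<lambda>i. (f i)\<^sup>2) summable_on UNIV" "(\<lambda>i. (g i)\<^sup>2) summable_on UNIV"
  shows "(\<lambda>i. (f i + g i)\<^sup>2) summable_on UNIV"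
proof -
  have "(\<lambda>i. (f i)\<^sup>2 + (g i)\<^sup>2 + 2 * (f i * g i)) summable_on UNIV"
    by (intro summable_on_add summable_on_cmult_right assms square_summable_mult)
  then show ?thesis by (simp add: power2_sum mult.assoc)
qed

lemma square_summable_scale:
  fixes f :: "'i \<Rightarrow> real"
  assumes "(\<lambda>i. (f i)\<^sup>2) summable_on UNIV"
  shows "(\<lambda>i. (r * f i)\<^sup>2) summable_on UNIV"
  using summable_on_cmult_right[OF assms, of "r\<^sup>2"] by (simp add: power_mult_distrib)

instantiation ell2 :: (type) real_inner
begin

definition "0 = Abs_ell2 (\<lambda>_. 0)"
definition "f + g = Abs_ell2 (\<lambda>i. ell2_coord f i + ell2_coord g i)"
definition "- f = Abs_ell2 (\<lambda>i. - ell2_coord f i)"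
definition "f - g = Abs_ell2 (\<lambda>i. ell2_coord f i - ell2_coord g i)"
definition "r *\<^sub>R (f :: 'a ell2) = Abs_ell2 (\<lambda>i. r * ell2_coord f i)"
definition "inner (f :: 'a ell2) g = (\<Sum>\<^sub>\<infinity>i. ell2_coord f i * ell2_coord g i)"
definition "norm (f :: 'a ell2) = sqrt (inner f f)"
definition "dist (f :: 'a ell2) g = norm (f - g)"
definition "sgn (f :: 'a ell2) = inverse (norm f) *\<^sub>R f"
definition "(uniformity :: ('a ell2 \<times> 'a ell2) filter) =
  (INF e\<in>{0<..}. principal {(x, y). dist x y < e})"
definition "open (S :: 'a ell2 set) \<longleftrightarrow>
  (\<forall>x\<in>S. \<forall>\<^sub>F (x', y) in uniformity. x' = x \<longrightarrow> y \<in> S)"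

lemma coord_zero: "ell2_coord 0 i = 0"
  by (simp add: zero_ell2_def Abs_ell2_inverse)

lemma coord_add: "ell2_coord (f + g) i = ell2_coord f i + ell2_coord g i"
  by (simp add: plus_ell2_def Abs_ell2_inverse square_summable_add ell2_coord_summable)

lemma coord_scaleR: "ell2_coord (r *\<^sub>R f) i = r * ell2_coord f i"
  by (simp add: scaleR_ell2_def Abs_ell2_inverse square_summable_scale ell2_coord_summable)

lemma coord_uminus: "ell2_coord (- f) i = - ell2_coord f i"
  by (simp add: uminus_ell2_def Abs_ell2_inverse ell2_coord_summable)

lemma coord_minus: "ell2_coord (f - g) i = ell2_coord f i - ell2_coord g i"
  using square_summable_add[OF ell2_coord_summable[of f] ell2_coord_summable[of "- g"]]
  by (simp add: minus_ell2_def Abs_ell2_inverse coord_uminus)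

lemmas coord_simps = coord_zero coord_add coord_scaleR coord_uminus coord_minus

lemma coord_mult_summable: "(\<lambda>i. ell2_coord f i * ell2_coord g i) summable_on UNIV"
  using square_summable_mult[of "ell2_coord f" "ell2_coord g"] ell2_coord_summable by blast

instance
proof
  fix f g h :: "'a ell2" and r s :: real
  show "f + g + h = f + (g + h)"
    by (rule ell2_eqI) (simp add: coord_simps algebra_simps)
  show "f + g = g + f"
    by (rule ell2_eqI) (simp add: coord_simps algebra_simps)
  show "0 + f = f"
    by (rule ell2_eqI) (simp add: coord_simps algebra_simps)
  show "- f + f = 0"
    by (rule ell2_eqI) (simp add: coord_simps algebra_simps)
  show "f - g = f + - g"
    by (rule ell2_eqI) (simp add: coord_simps algebra_simps)
  show "r *\<^sub>R (f + g) = r *\<^sub>R f + r *\<^sub>R g"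
    by (rule ell2_eqI) (simp add: coord_simps algebra_simps)
  show "(r + s) *\<^sub>R f = r *\<^sub>R f + s *\<^sub>R f"
    by (rule ell2_eqI) (simp add: coord_simps algebra_simps)
  show "r *\<^sub>R s *\<^sub>R f = (r * s) *\<^sub>R f"
    by (rule ell2_eqI) (simp add: coord_simps algebra_simps)
  show "1 *\<^sub>R f = f"
    by (rule ell2_eqI) (simp add: coord_simps algebra_simps)
  show "dist f g = norm (f - g)" "sgn f = inverse (norm f) *\<^sub>R f"
    by (simp_all add: dist_ell2_def sgn_ell2_def)
  show "(uniformity :: ('a ell2 \<times> 'a ell2) filter) =
      (INF e\<in>{0<..}. principal {(x, y). dist x y < e})"
    by (fact uniformity_ell2_def)
  show "open S \<longleftrightarrow> (\<forall>x\<in>S. \<forall>\<^sub>F (x', y) in uniformity. x' = x \<longrightarrow> y \<in> S)" for S :: "'a ell2 set"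
    by (fact open_ell2_def)
  show "inner f g = inner g f"
    by (simp add: inner_ell2_def mult.commute)
  show "inner (f + g) h = inner f h + inner g h"
    by (simp add: inner_ell2_def coord_add distrib_right infsum_add coord_mult_summable)
  show "inner (r *\<^sub>R f) g = r * inner f g"
    by (simp add: inner_ell2_def coord_scaleR mult.assoc infsum_cmult_right')
  show "0 \<le> inner f f"
    by (simp add: inner_ell2_def infsum_nonneg)
  show "inner f f = 0 \<longleftrightarrow> f = 0"
  proof
    assume "inner f f = 0"
    then have "(\<Sum>\<^sub>\<infinity>i. ell2_coord f i * ell2_coord f i) = 0"
      by (simp only: inner_ell2_def)
    moreover have "(\<Sum>i\<in>{i}. ell2_coord f i * ell2_coord f i)
        \<le> (\<Sum>\<^sub>\<infinity>i. ell2_coord f i * ell2_coord f i)" for i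
      by (rule finite_sum_le_infsum[OF coord_mult_summable]) auto
    ultimately have "(ell2_coord f i)\<^sup>2 \<le> 0" for i
      by (simp add: power2_eq_square)
    then show "f = 0" by (intro ell2_eqI) (simp add: coord_zero)
  qed (simp add: inner_ell2_def coord_zero)
  show "norm f = sqrt (inner f f)"
    by (fact norm_ell2_def)
qed

end

lemma norm_ell2_sq: "(norm f)\<^sup>2 = (\<Sum>\<^sub>\<infinity>i. (ell2_coord f i)\<^sup>2)"
  unfolding power2_norm_eq_inner inner_ell2_def by (simp add: power2_eq_square)

lemma sum_coord_le_norm:
  assumes "finite F"
  shows "(\<Sum>i\<in>F. (ell2_coord f i)\<^sup>2) \<le> (norm f)\<^sup>2"
  unfolding norm_ell2_sq by (rule finite_sum_le_infsum[OF ell2_coord_summable assms]) auto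

lemma coord_le_norm: "\<bar>ell2_coord f i\<bar> \<le> norm f"
  using sum_coord_le_norm[of "{i}" f] by (simp add: abs_le_square_iff[symmetric])

instance ell2 :: (type) complete_space
proof
  fix X :: "nat \<Rightarrow> 'a ell2"
  assume X: "Cauchy X"
  have "Cauchy (\<lambda>n. ell2_coord (X n) i)" for i
  proof (rule metric_CauchyI)
    fix e :: real assume "e > 0"
    then obtain M where M: "\<And>m n. m \<ge> M \<Longrightarrow> n \<ge> M \<Longrightarrow> dist (X m) (X n) < e"
      using metric_CauchyD[OF X] by blast
    have "dist (ell2_coord (X m) i) (ell2_coord (X n) i) < e" if "m \<ge> M" "n \<ge> M" for m n
      using coord_le_norm[of "X m - X n" i] M[OF that] by (simp add: dist_norm coord_minus)
    then show "\<exists>M. \<forall>m\<ge>M. \<forall>n\<ge>M. dist (ell2_coord (X m) i) (ell2_coord (X n) i) < e"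
      by blast
  qed
  then have "convergent (\<lambda>n. ell2_coord (X n) i)" for i
    by (rule Cauchy_convergent)
  define L where "L i = lim (\<lambda>n. ell2_coord (X n) i)" for i
  have L: "(\<lambda>n. ell2_coord (X n) i) \<longlonglongrightarrow> L i" for i
    unfolding L_def using \<open>convergent (\<lambda>n. ell2_coord (X n) i)\<close> by (simp add: convergent_LIMSEQ_iff)
  have tail: "\<exists>N. \<forall>m\<ge>N. \<forall>F. finite F \<longrightarrow> (\<Sum>i\<in>F. (ell2_coord (X m) i - L i)\<^sup>2) \<le> e\<^sup>2"
    if e: "e > 0" for e :: real
  proof -
    obtain N where N: "\<And>m n. m \<ge> N \<Longrightarrow> n \<ge> N \<Longrightarrow> dist (X m) (X n) < e"
      using metric_CauchyD[OF X e] by blast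
    have "(\<Sum>i\<in>F. (ell2_coord (X m) i - L i)\<^sup>2) \<le> e\<^sup>2" if m: "m \<ge> N" and F: "finite F" for m F
    proof (rule LIMSEQ_le_const2)
      show "(\<lambda>n. \<Sum>i\<in>F. (ell2_coord (X m) i - ell2_coord (X n) i)\<^sup>2)
          \<longlonglongrightarrow> (\<Sum>i\<in>F. (ell2_coord (X m) i - L i)\<^sup>2)"
        by (intro tendsto_intros L)
      have "(\<Sum>i\<in>F. (ell2_coord (X m) i - ell2_coord (X n) i)\<^sup>2) \<le> e\<^sup>2" if "n \<ge> N" for n
      proof -
        have "(\<Sum>i\<in>F. (ell2_coord (X m) i - ell2_coord (X n) i)\<^sup>2) \<le> (norm (X m - X n))\<^sup>2"
          using sum_coord_le_norm[OF F, of "X m - X n"] by (simp add: coord_minus)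
        also have "\<dots> \<le> e\<^sup>2"
          using N[OF m that] by (intro power_mono) (auto simp: dist_norm)
        finally show ?thesis .
      qed
      then show "\<exists>N. \<forall>n\<ge>N. (\<Sum>i\<in>F. (ell2_coord (X m) i - ell2_coord (X n) i)\<^sup>2) \<le> e\<^sup>2"
        by blast
    qed
    then show ?thesis by blast
  qed
  have diff: "(\<lambda>i. (ell2_coord (X m) i - L i)\<^sup>2) summable_on UNIV"
    if "\<And>F. finite F \<Longrightarrow> (\<Sum>i\<in>F. (ell2_coord (X m) i - L i)\<^sup>2) \<le> c" for m c
    using that by (intro nonneg_bdd_above_summable_on bdd_aboveI2[where M = c]) auto
  obtain N1 where N1: "\<And>F. finite F \<Longrightarrow> (\<Sum>i\<in>F. (ell2_coord (X N1) i - L i)\<^sup>2) \<le> 1\<^sup>2"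
    using tail[of 1] by auto
  have "(\<lambda>i. (ell2_coord (X N1) i + (-1) * (ell2_coord (X N1) i - L i))\<^sup>2) summable_on UNIV"
    by (rule square_summable_add[of "ell2_coord (X N1)", OF ell2_coord_summable])
       (rule square_summable_scale[OF diff[OF N1]])
  then have LS: "(\<lambda>i. (L i)\<^sup>2) summable_on UNIV" by simp
  define l where "l = Abs_ell2 L"
  have l: "ell2_coord l = L" unfolding l_def using LS by (simp add: Abs_ell2_inverse)
  have "X \<longlonglongrightarrow> l"
  proof (rule metric_LIMSEQ_I)
    fix r :: real assume r: "r > 0"
    obtain N where N: "\<And>m F. m \<ge> N \<Longrightarrow> finite F \<Longrightarrow>
        (\<Sum>i\<in>F. (ell2_coord (X m) i - L i)\<^sup>2) \<le> (r / 2)\<^sup>2"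
      using tail[of "r / 2"] r by auto
    have "dist (X m) l < r" if "m \<ge> N" for m
    proof -
      have "(norm (X m - l))\<^sup>2 \<le> (r / 2)\<^sup>2"
        unfolding norm_ell2_sq
        by (rule infsum_le_finite_sums[OF ell2_coord_summable])
           (use N[OF that] in \<open>simp add: coord_minus l\<close>)
      then have "norm (X m - l) \<le> r / 2"
        by (rule power2_le_imp_le) (use r in simp)
      then show ?thesis using r by (simp add: dist_norm)
    qed
    then show "\<exists>N. \<forall>n\<ge>N. dist (X n) l < r" by blast
  qed
  then show "convergent X" by (auto simp: convergent_def)
qed


section \<open>Smooth maps between normed spaces\<close>

text \<open>
  Higher Frechet derivatives live in spaces of bounded multilinear maps whose types depend on the
  order. To keep one type, a \<open>k\<close>-linear map is a function on lists, considered only on lists of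
  length \<open>k\<close>; the remainder estimate below is Frechet differentiability with respect to the operator
  norm on \<open>k\<close>-linear maps, the new direction being the first argument of the derivative.
\<close>

definition bounded_multilinear ::
    "nat \<Rightarrow> ('a::real_normed_vector list \<Rightarrow> 'b::real_normed_vector) \<Rightarrow> bool" where
  "bounded_multilinear k F \<longleftrightarrow>
    (\<forall>vs i. length vs = k \<longrightarrow> i < k \<longrightarrow> linear (\<lambda>v. F (vs[i := v]))) \<and>
    (\<exists>C. \<forall>vs. length vs = k \<longrightarrow> norm (F vs) \<le> C * prod_list (map norm vs))"

definition has_multilinear_derivative ::
    "nat \<Rightarrow> ('a::real_normed_vector \<Rightarrow> 'a list \<Rightarrow> 'b::real_normed_vector) \<Rightarrow> ('a list \<Rightarrow> 'b) \<Rightarrow> 'a \<Rightarrow> bool"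
  where
  "has_multilinear_derivative k F F' x \<longleftrightarrow>
    (\<forall>e>0. \<exists>d>0. \<forall>y. norm (y - x) < d \<longrightarrow>
      (\<forall>vs. length vs = k \<longrightarrow>
        norm (F y vs - F x vs - F' ((y - x) # vs)) \<le> e * norm (y - x) * prod_list (map norm vs)))"

text \<open>\<open>D k x\<close> is the \<open>k\<close>-th derivative of \<open>f\<close> at \<open>x\<close>. Only meant for open \<open>S\<close>.\<close>

definition smooth_on :: "'a::real_normed_vector set \<Rightarrow> ('a \<Rightarrow> 'b::real_normed_vector) \<Rightarrow> bool" where
  "smooth_on S f \<longleftrightarrow>
    (\<exists>D. (\<forall>x\<in>S. D 0 x [] = f x) \<and>
      (\<forall>k. \<forall>x\<in>S. bounded_multilinear k (D k x) \<and>
        has_multilinear_derivative k (D k) (D (Suc k) x) x))"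


section \<open>Hilbert manifolds\<close>

text \<open>A chart is an open domain together with a coordinate map, meaningful on the domain only.\<close>

type_synonym ('p, 'h) chart = "'p set \<times> ('p \<Rightarrow> 'h)"

definition chart_inv :: "('p, 'h) chart \<Rightarrow> 'h \<Rightarrow> 'p" where
  "chart_inv c = inv_into (fst c) (snd c)"

definition transition :: "('p, 'h) chart \<Rightarrow> ('p, 'h) chart \<Rightarrow> 'h \<Rightarrow> 'h" where
  "transition c c' = snd c' \<circ> chart_inv c"

definition charts_at :: "('p, 'h) chart set \<Rightarrow> 'p \<Rightarrow> ('p, 'h) chart set" where
  "charts_at A p = {c \<in> A. p \<in> fst c}"

definition hilbert_manifold ::
    "'p topology \<Rightarrow> ('p, 'h::{real_inner, complete_space}) chart set \<Rightarrow> bool" where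
  "hilbert_manifold X A \<longleftrightarrow>
    Hausdorff_space X \<and>
    (\<Union>c\<in>A. fst c) = topspace X \<and>
    (\<forall>c\<in>A. openin X (fst c) \<and> open (snd c ` fst c) \<and>
      homeomorphic_map (subtopology X (fst c)) (top_of_set (snd c ` fst c)) (snd c)) \<and>
    (\<forall>c\<in>A. \<forall>c'\<in>A. smooth_on (snd c ` (fst c \<inter> fst c')) (transition c c'))"

text \<open>
  A tangent vector at \<open>p\<close> is the family of its coordinate representations in the charts around \<open>p\<close>,
  related by the derivatives of the transition maps (and 0 at all other charts, so that the vector
  space operations are pointwise).
\<close>

definition tangent_space ::
    "('p, 'h::{real_inner, complete_space}) chart set \<Rightarrow> 'p \<Rightarrow> (('p, 'h) chart \<Rightarrow> 'h) set" where
  "tangent_space A p =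
    {\<xi>. (\<forall>c. c \<notin> charts_at A p \<longrightarrow> \<xi> c = 0) \<and>
      (\<forall>c\<in>charts_at A p. \<forall>c'\<in>charts_at A p.
        \<xi> c' = frechet_derivative (transition c c') (at (snd c p)) (\<xi> c))}"

definition tangent_vector ::
    "('p, 'h::{real_inner, complete_space}) chart set \<Rightarrow> 'p \<Rightarrow> ('p, 'h) chart \<Rightarrow> 'h
      \<Rightarrow> (('p, 'h) chart \<Rightarrow> 'h)" where
  "tangent_vector A p c v =
    (\<lambda>c'. if c' \<in> charts_at A p then frechet_derivative (transition c c') (at (snd c p)) v else 0)"


section \<open>Riemannian metrics\<close>

type_synonym ('p, 'h) metric_tensor =
  "'p \<Rightarrow> (('p, 'h) chart \<Rightarrow> 'h) \<Rightarrow> (('p, 'h) chart \<Rightarrow> 'h) \<Rightarrow> real"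

definition inner_product_on ::
    "('c \<Rightarrow> 'h::real_vector) set \<Rightarrow> (('c \<Rightarrow> 'h) \<Rightarrow> ('c \<Rightarrow> 'h) \<Rightarrow> real) \<Rightarrow> bool" where
  "inner_product_on T b \<longleftrightarrow>
    (\<forall>\<xi>\<in>T. \<forall>\<eta>\<in>T. b \<xi> \<eta> = b \<eta> \<xi>) \<and>
    (\<forall>\<xi>\<in>T. \<forall>\<eta>\<in>T. \<forall>\<zeta>\<in>T. b (\<lambda>c. \<xi> c + \<eta> c) \<zeta> = b \<xi> \<zeta> + b \<eta> \<zeta>) \<and>
    (\<forall>r. \<forall>\<xi>\<in>T. \<forall>\<eta>\<in>T. b (\<lambda>c. r *\<^sub>R \<xi> c) \<eta> = r * b \<xi> \<eta>) \<and>
    (\<forall>\<xi>\<in>T. \<xi> \<noteq> (\<lambda>_. 0) \<longrightarrow> 0 < b \<xi> \<xi>)"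

definition local_metric ::
    "('p, 'h::{real_inner, complete_space}) chart set \<Rightarrow> ('p, 'h) metric_tensor \<Rightarrow> ('p, 'h) chart
      \<Rightarrow> 'h \<Rightarrow> 'h \<Rightarrow> 'h \<Rightarrow> real" where
  "local_metric A g c x v w =
    (let p = chart_inv c x in g p (tangent_vector A p c v) (tangent_vector A p c w))"

definition riemannian_metric ::
    "'p topology \<Rightarrow> ('p, 'h::{real_inner, complete_space}) chart set \<Rightarrow> ('p, 'h) metric_tensor \<Rightarrow> bool"
  where
  "riemannian_metric X A g \<longleftrightarrow>
    (\<forall>p\<in>topspace X. inner_product_on (tangent_space A p) (g p)) \<and>
    (\<forall>p\<in>topspace X. \<forall>c\<in>charts_at A p. \<exists>a>0. \<exists>b>0. \<forall>\<xi>\<in>tangent_space A p.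
      a * norm (\<xi> c) \<le> sqrt (g p \<xi> \<xi>) \<and> sqrt (g p \<xi> \<xi>) \<le> b * norm (\<xi> c)) \<and>
    (\<forall>c\<in>A. \<exists>B :: 'h \<Rightarrow> 'h \<Rightarrow>\<^sub>L 'h \<Rightarrow>\<^sub>L real.
      smooth_on (snd c ` fst c) B \<and>
      (\<forall>x \<in> snd c ` fst c. \<forall>v w. blinfun_apply (blinfun_apply (B x) v) w = local_metric A g c x v w))"


section \<open>Riemannian distance and completeness\<close>

text \<open>
  Piecewise continuously differentiable curves: after subdivision each piece lies in one chart
  domain and is continuously differentiable up to its endpoints. (The library's
  \<open>piecewise_C1_differentiable_on\<close> puts no condition on the derivative near the break points.)
\<close>

definition piecewise_C1_curve ::
    "'p topology \<Rightarrow> ('p, 'h::{real_inner, complete_space}) chart set \<Rightarrow> (real \<Rightarrow> 'p) \<Rightarrow> bool" where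
  "piecewise_C1_curve X A \<gamma> \<longleftrightarrow>
    pathin X \<gamma> \<and>
    (\<exists>(n::nat) s. s 0 = 0 \<and> s n = 1 \<and>
      (\<forall>i<n. s i < s (Suc i) \<and>
        (\<exists>c\<in>A. \<gamma> ` {s i..s (Suc i)} \<subseteq> fst c \<and>
          (\<exists>D. continuous_on {s i..s (Suc i)} D \<and>
            (\<forall>t\<in>{s i..s (Suc i)}.
              ((snd c \<circ> \<gamma>) has_vector_derivative D t) (at t within {s i..s (Suc i)}))))))"

definition velocity ::
    "('p, 'h::{real_inner, complete_space}) chart set \<Rightarrow> (real \<Rightarrow> 'p) \<Rightarrow> real \<Rightarrow> (('p, 'h) chart \<Rightarrow> 'h)"
  where
  "velocity A \<gamma> t =
    (\<lambda>c. if c \<in> charts_at A (\<gamma> t) then vector_derivative (snd c \<circ> \<gamma>) (at t) else 0)"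

definition curve_length ::
    "('p, 'h::{real_inner, complete_space}) chart set \<Rightarrow> ('p, 'h) metric_tensor \<Rightarrow> (real \<Rightarrow> 'p) \<Rightarrow> real"
  where
  "curve_length A g \<gamma> = integral {0..1} (\<lambda>t. sqrt (g (\<gamma> t) (velocity A \<gamma> t) (velocity A \<gamma> t)))"

text \<open>
  Intended for connected manifolds, where the set of lengths is nonempty. The value 0 off the
  manifold is forced by the nonnegativity condition in \<^locale>\<open>Metric_space\<close>.
\<close>

definition riemannian_dist ::
    "'p topology \<Rightarrow> ('p, 'h::{real_inner, complete_space}) chart set \<Rightarrow> ('p, 'h) metric_tensor
      \<Rightarrow> 'p \<Rightarrow> 'p \<Rightarrow> real" where
  "riemannian_dist X A g p q =
    (if p \<in> topspace X \<and> q \<in> topspace X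
     then Inf {curve_length A g \<gamma> | \<gamma>. piecewise_C1_curve X A \<gamma> \<and> \<gamma> 0 = p \<and> \<gamma> 1 = q}
     else 0)"

definition complete_riemannian ::
    "'p topology \<Rightarrow> ('p, 'h::{real_inner, complete_space}) chart set \<Rightarrow> ('p, 'h) metric_tensor \<Rightarrow> bool"
  where
  "complete_riemannian X A g \<longleftrightarrow>
    Metric_space (topspace X) (riemannian_dist X A g) \<and>
    Metric_space.mcomplete (topspace X) (riemannian_dist X A g)"


section \<open>Sectional curvature\<close>

text \<open>
  In a chart with local metric \<open>m\<close>, the Levi-Civita connection is
  \<open>\<nabla>\<^sub>V W = DW V + \<Gamma>(V, W)\<close> where \<open>\<Gamma>\<close> is given by the Koszul formula for constant vector fields.
\<close>

definition christoffel ::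
    "('h \<Rightarrow> 'h \<Rightarrow> 'h \<Rightarrow> real) \<Rightarrow> 'h::{real_inner, complete_space} \<Rightarrow> 'h \<Rightarrow> 'h \<Rightarrow> 'h" where
  "christoffel m x v w =
    (THE z. \<forall>u. 2 * m x z u =
      frechet_derivative (\<lambda>y. m y w u) (at x) v +
      frechet_derivative (\<lambda>y. m y v u) (at x) w -
      frechet_derivative (\<lambda>y. m y v w) (at x) u)"

definition covariant_deriv ::
    "('h \<Rightarrow> 'h \<Rightarrow> 'h \<Rightarrow> real) \<Rightarrow> ('h \<Rightarrow> 'h) \<Rightarrow> ('h \<Rightarrow> 'h) \<Rightarrow> 'h::{real_inner, complete_space} \<Rightarrow> 'h" where
  "covariant_deriv m V W x = frechet_derivative W (at x) (V x) + christoffel m x (V x) (W x)"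

text \<open>
  The curvature tensor is evaluated on the constant extensions of \<open>u\<close>, \<open>v\<close>, \<open>w\<close>, which commute, so
  that the term \<open>\<nabla>\<^bsub>[u,v]\<^esub> w\<close> vanishes.
\<close>

definition curvature_tensor ::
    "('h \<Rightarrow> 'h \<Rightarrow> 'h \<Rightarrow> real) \<Rightarrow> 'h::{real_inner, complete_space} \<Rightarrow> 'h \<Rightarrow> 'h \<Rightarrow> 'h \<Rightarrow> 'h" where
  "curvature_tensor m x u v w =
    covariant_deriv m (\<lambda>_. u) (covariant_deriv m (\<lambda>_. v) (\<lambda>_. w)) x -
    covariant_deriv m (\<lambda>_. v) (covariant_deriv m (\<lambda>_. u) (\<lambda>_. w)) x"

definition sectional_curvature ::
    "('h \<Rightarrow> 'h \<Rightarrow> 'h \<Rightarrow> real) \<Rightarrow> 'h::{real_inner, complete_space} \<Rightarrow> 'h \<Rightarrow> 'h \<Rightarrow> real" where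
  "sectional_curvature m x u v =
    m x (curvature_tensor m x u v v) u / (m x u u * m x v v - (m x u v)\<^sup>2)"

definition constant_sectional_curvature ::
    "('p, 'h::{real_inner, complete_space}) chart set \<Rightarrow> ('p, 'h) metric_tensor \<Rightarrow> real \<Rightarrow> bool" where
  "constant_sectional_curvature A g \<kappa> \<longleftrightarrow>
    (\<forall>c\<in>A. \<forall>x \<in> snd c ` fst c. \<forall>u v. u \<noteq> v \<and> independent {u, v} \<longrightarrow>
      sectional_curvature (local_metric A g c) x u v = \<kappa>)"


section \<open>The fundamental group\<close>

definition loops_at :: "'p topology \<Rightarrow> 'p \<Rightarrow> (real \<Rightarrow> 'p) set" where
  "loops_at X a = {\<gamma>. pathin X \<gamma> \<and> \<gamma> 0 = a \<and> \<gamma> 1 = a}"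

definition loop_class :: "'p topology \<Rightarrow> 'p \<Rightarrow> (real \<Rightarrow> 'p) \<Rightarrow> (real \<Rightarrow> 'p) set" where
  "loop_class X a \<gamma> =
    {\<delta>. homotopic_with (\<lambda>h. h 0 = a \<and> h 1 = a) (top_of_set {0..1}) X \<gamma> \<delta>}"

text \<open>The library's \<open>joinpaths\<close> is restricted to the class of topological spaces.\<close>

definition loop_join :: "(real \<Rightarrow> 'p) \<Rightarrow> (real \<Rightarrow> 'p) \<Rightarrow> real \<Rightarrow> 'p" where
  "loop_join \<gamma> \<delta> = (\<lambda>t. if t \<le> 1/2 then \<gamma> (2 * t) else \<delta> (2 * t - 1))"

definition fundamental_group :: "'p topology \<Rightarrow> 'p \<Rightarrow> (real \<Rightarrow> 'p) set monoid" where
  "fundamental_group X a =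
    \<lparr> carrier = loop_class X a ` loops_at X a,
      mult = (\<lambda>P Q. \<Union>\<gamma>\<in>P. \<Union>\<delta>\<in>Q. loop_class X a (loop_join \<gamma> \<delta>)),
      one = loop_class X a (\<lambda>_. a) \<rparr>"

end

theory Submission
  imports Defs
begin

text \<open>
  The manifold is a quotient \<open>S / G\<close> of the unit sphere \<open>S\<close> of the Hilbert space \<open>\<ell>\<^sup>2(J)\<close>, where
  \<open>J = 'g \<times> nat\<close>. The sphere of an infinite-dimensional Hilbert space is complete, has constant
  curvature 1 and is contractible. Hence if \<open>G\<close> acts on it by isometries, freely and with uniformly
  discrete orbits, then the quotient inherits the metric, is complete, and has fundamental group \<open>G\<close>.

  The action comes from permutations of coordinates. Since \<open>J\<close> is in bijection with \<open>carrier G \<times> J\<close>, the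
  group acts freely on \<open>J\<close>, and therefore by isometries \<open>\<rho> g\<close> on \<open>\<ell>\<^sup>2(J)\<close>. A unit vector is
  concentrated, up to a small part of its mass, on a finite set of indices, and all but finitely many
  group elements move this set off itself and so move the vector by a definite amount. A fixed
  vector of \<open>\<rho> g\<close> is constant along the orbits of \<open>g\<close> in \<open>J\<close>. If \<open>g\<close> has infinite order,
  these orbits are infinite and the vector is zero; this is the only place where torsion-freeness
  enters (\<open>uniform_displacement\<close>).

  The model space of the manifold is \<open>\<ell>\<^sup>2(J)\<close> itself, which a shift \<open>T\<close> identifies with the
  hyperplane orthogonal to a basis vector \<open>N\<close>. Stereographic projection from \<open>N\<close>, composed with linear
  isometries \<open>W\<close>, provides the charts. Two charts around the same point of \<open>S / G\<close> differ, locally,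
  by an isometry \<open>W'\<^sup>-\<^sup>1 \<circ> \<rho> g \<circ> W\<close> of the sphere (\<open>transition_locally\<close>). In stereographic coordinates this
  is a rational expression, which gives smoothness, and stereographic projection is conformal, so the
  transition maps preserve the metric \<open>s\<^sup>2 \<langle>v, w\<rangle>\<close> with \<open>s = 2 / (1 + \<bar>x\<bar>\<^sup>2)\<close>. That
  this metric has curvature 1 is a computation with its Christoffel map
  (\<open>sectional_curvature_spherical\<close>).

  The Riemannian distance of two orbits is the infimum of the angles between their elements
  (\<open>riemannian_dist_eq_orbit_angle\<close>): a curve is cut into pieces that lie in charts, each piece is lifted to
  the sphere and compared there with the angle between its ends (\<open>angle_le_length\<close>), and conversely
  great circle arcs are projected. Cauchy sequences of orbits are lifted to Cauchy sequences of points
  (\<open>orbit_angle_complete\<close>).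

  For the fundamental group, the projection \<open>S \<rightarrow> S / G\<close> is a covering map (\<open>covering_sphere\<close>) and \<open>S\<close> is
  simply connected, since it is contractible: the identity, \<open>T\<close> and the constant map \<open>N\<close> are homotopic
  (\<open>contractible_sphere\<close>). A group element \<open>g\<close> corresponds to the class of projections of paths
  from a base point \<open>x\<close> to \<open>\<rho> g x\<close> (\<open>fundamental_group_quotient\<close>).
\<close>

section \<open>Smooth maps\<close>

subsection \<open>Products of multilinear maps\<close>

text \<open>
  A term of the Leibniz rule distributes the arguments of a \<open>k\<close>-linear map among two factors: those
  at the positions in \<open>I\<close> go to the first factor, the others to the second. Differentiating such
  a term puts a new argument in front of the list, which turns \<open>I\<close> into \<open>insert 0 (Suc ` I)\<close> or
  \<open>Suc ` I\<close>.
\<close>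

definition split_order :: "nat \<Rightarrow> nat set \<Rightarrow> nat" where
  "split_order k I = card {i. i < k \<and> i \<in> I}"

definition split_product ::
    "('b \<Rightarrow> 'c \<Rightarrow> 'd) \<Rightarrow> nat set \<Rightarrow> ('a list \<Rightarrow> 'b) \<Rightarrow> ('a list \<Rightarrow> 'c) \<Rightarrow> 'a list \<Rightarrow> 'd" where
  "split_product B I F G vs = B (F (nths vs I)) (G (nths vs (- I)))"

lemma split_order_length: "length (nths vs I) = split_order (length vs) I"
  by (simp add: length_nths split_order_def)

lemma split_order_conv: "split_order k I = length (nths (replicate k ()) I)"
  by (simp add: split_order_length)

lemma Suc_mem_complement: "{j. Suc j \<in> - I} = - {j. Suc j \<in> I}"
  by auto

lemma split_order_Suc:
  "split_order (Suc k) (insert 0 (Suc ` I)) = Suc (split_order k I)"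
  "split_order (Suc k) (Suc ` I) = split_order k I"
  "split_order (Suc k) (- insert 0 (Suc ` I)) = split_order k (- I)"
  "split_order (Suc k) (- Suc ` I) = Suc (split_order k (- I))"
proof -
  have e: "{j. Suc j \<in> insert 0 (Suc ` I)} = I" "{j. Suc j \<in> Suc ` I} = I"
    by auto
  have n: "0 \<notin> Suc ` I" by auto
  show "split_order (Suc k) (insert 0 (Suc ` I)) = Suc (split_order k I)"
    unfolding split_order_conv replicate_Suc nths_Cons e by simp
  show "split_order (Suc k) (Suc ` I) = split_order k I"
    unfolding split_order_conv replicate_Suc nths_Cons e using n by simp
  show "split_order (Suc k) (- insert 0 (Suc ` I)) = split_order k (- I)"
    unfolding split_order_conv replicate_Suc nths_Cons Suc_mem_complement e by simp
  show "split_order (Suc k) (- Suc ` I) = Suc (split_order k (- I))"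
    unfolding split_order_conv replicate_Suc nths_Cons Suc_mem_complement e using n by simp
qed

lemma split_product_Cons:
  "split_product B (insert 0 (Suc ` I)) F G (w # vs) = B (F (w # nths vs I)) (G (nths vs (- I)))"
  "split_product B (Suc ` I) F G (w # vs) = B (F (nths vs I)) (G (w # nths vs (- I)))"
proof -
  have e: "{j. Suc j \<in> insert 0 (Suc ` I)} = I" "{j. Suc j \<in> Suc ` I} = I"
    by auto
  have n: "0 \<notin> Suc ` I" by auto
  show "split_product B (insert 0 (Suc ` I)) F G (w # vs) = B (F (w # nths vs I)) (G (nths vs (- I)))"
    unfolding split_product_def nths_Cons Suc_mem_complement e by simp
  show "split_product B (Suc ` I) F G (w # vs) = B (F (nths vs I)) (G (w # nths vs (- I)))"
    unfolding split_product_def nths_Cons Suc_mem_complement e using n by simp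
qed

lemma prod_norm_nths:
  fixes vs :: "'a::real_normed_vector list"
  shows "prod_list (map norm (nths vs I)) * prod_list (map norm (nths vs (- I)))
    = prod_list (map norm vs)"
proof (induction vs arbitrary: I)
  case (Cons v vs)
  show ?case
    using Cons.IH[of "{j. Suc j \<in> I}"]
    by (auto simp: nths_Cons Suc_mem_complement mult_ac simp del: Compl_iff)
qed simp

lemma nths_update_in:
  assumes "i < length vs" "i \<in> I"
  shows "\<exists>m < length (nths vs I). \<forall>v. nths (vs[i := v]) I = (nths vs I)[m := v]"
  using assms
proof (induction vs arbitrary: i I)
  case (Cons a vs)
  show ?case
  proof (cases i)
    case 0
    then show ?thesis using Cons.prems by (intro exI[of _ 0]) (simp add: nths_Cons)
  next
    case (Suc i')
    then obtain m where "m < length (nths vs {j. Suc j \<in> I})"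
      "\<forall>v. nths (vs[i' := v]) {j. Suc j \<in> I} = (nths vs {j. Suc j \<in> I})[m := v]"
      using Cons.IH[of i' "{j. Suc j \<in> I}"] Cons.prems by auto
    then show ?thesis using Suc
      by (intro exI[of _ "if 0 \<in> I then Suc m else m"]) (simp add: nths_Cons)
  qed
qed simp

lemma nths_update_notin: "i \<notin> I \<Longrightarrow> nths (vs[i := v]) I = nths vs I"
proof (induction vs arbitrary: i I)
  case (Cons a vs)
  then show ?case by (cases i) (auto simp: nths_Cons)
qed simp

lemma bounded_multilinearE:
  assumes "bounded_multilinear k F"
  obtains C where "C \<ge> 0" "\<And>vs. length vs = k \<Longrightarrow> norm (F vs) \<le> C * prod_list (map norm vs)"
proof -
  obtain C where C: "\<And>vs. length vs = k \<Longrightarrow> norm (F vs) \<le> C * prod_list (map norm vs)"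
    using assms unfolding bounded_multilinear_def by blast
  have p: "0 \<le> prod_list (map norm vs)" for vs :: "'a list"
    by (induction vs) auto
  have "norm (F vs) \<le> \<bar>C\<bar> * prod_list (map norm vs)" if "length vs = k" for vs
    using C[OF that] mult_right_mono[OF abs_ge_self p, of C vs] by linarith
  then show ?thesis using that[of "\<bar>C\<bar>"] by simp
qed

lemma bounded_multilinear_linear:
  "bounded_multilinear k F \<Longrightarrow> length vs = k \<Longrightarrow> i < k \<Longrightarrow> linear (\<lambda>v. F (vs[i := v]))"
  unfolding bounded_multilinear_def by blast

lemma prod_norm_nonneg: "0 \<le> prod_list (map norm vs)"
  by (induction vs) auto

lemma bounded_multilinear_add:
  assumes "bounded_multilinear k F" "bounded_multilinear k G"
  shows "bounded_multilinear k (\<lambda>vs. F vs + G vs)"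
proof -
  obtain C where C: "\<And>vs. length vs = k \<Longrightarrow> norm (F vs) \<le> C * prod_list (map norm vs)"
    using bounded_multilinearE[OF assms(1)] by metis
  obtain D where D: "\<And>vs. length vs = k \<Longrightarrow> norm (G vs) \<le> D * prod_list (map norm vs)"
    using bounded_multilinearE[OF assms(2)] by metis
  have "norm (F vs + G vs) \<le> (C + D) * prod_list (map norm vs)" if "length vs = k" for vs
    using C[OF that] D[OF that] norm_triangle_ineq[of "F vs" "G vs"] by (simp add: distrib_right)
  moreover have "linear (\<lambda>v. F (vs[i := v]) + G (vs[i := v]))" if "length vs = k" "i < k" for vs i
    by (intro linear_compose_add bounded_multilinear_linear[OF assms(1)]
        bounded_multilinear_linear[OF assms(2)] that)
  ultimately show ?thesis unfolding bounded_multilinear_def by blast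
qed

lemma bounded_multilinear_uminus:
  assumes "bounded_multilinear k F"
  shows "bounded_multilinear k (\<lambda>vs. - F vs)"
  using assms unfolding bounded_multilinear_def by (auto intro: linear_compose_neg)

lemma bounded_multilinear_split_product:
  fixes F :: "'a::real_normed_vector list \<Rightarrow> 'b::real_normed_vector"
    and G :: "'a list \<Rightarrow> 'c::real_normed_vector"
    and B :: "'b \<Rightarrow> 'c \<Rightarrow> 'd::real_normed_vector"
  assumes B: "bounded_bilinear B"
    and F: "bounded_multilinear (split_order k I) F"
    and G: "bounded_multilinear (split_order k (- I)) G"
  shows "bounded_multilinear k (split_product B I F G)"
proof -
  interpret bounded_bilinear B by (rule B)
  obtain C where C: "C \<ge> 0" "\<And>vs. length vs = split_order k I \<Longrightarrow> norm (F vs) \<le> C * prod_list (map norm vs)"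
    using bounded_multilinearE[OF F] by metis
  obtain D where D: "D \<ge> 0" "\<And>vs. length vs = split_order k (- I) \<Longrightarrow> norm (G vs) \<le> D * prod_list (map norm vs)"
    using bounded_multilinearE[OF G] by metis
  obtain K where K: "K \<ge> 0" "\<And>a b. norm (B a b) \<le> norm a * norm b * K"
    using nonneg_bounded by blast
  have "norm (split_product B I F G vs) \<le> (C * D * K) * prod_list (map norm vs)" if l: "length vs = k" for vs
  proof -
    have "norm (F (nths vs I)) * norm (G (nths vs (- I)))
        \<le> (C * prod_list (map norm (nths vs I))) * (D * prod_list (map norm (nths vs (- I))))"
      by (intro mult_mono C D)
         (auto simp: split_order_length l C(1) intro!: mult_nonneg_nonneg prod_norm_nonneg)
    also have "\<dots> = C * D * prod_list (map norm vs)"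
      by (simp add: prod_norm_nths[symmetric, of vs I])
    finally have "norm (F (nths vs I)) * norm (G (nths vs (- I))) * K \<le> C * D * prod_list (map norm vs) * K"
      using K(1) by (rule mult_right_mono)
    then show ?thesis
      using K(2)[of "F (nths vs I)" "G (nths vs (- I))"] by (simp add: split_product_def mult_ac)
  qed
  moreover have "linear (\<lambda>v. split_product B I F G (vs[i := v]))" if l: "length vs = k" "i < k" for vs i
  proof (cases "i \<in> I")
    case True
    then obtain m where m: "m < length (nths vs I)" "\<And>v. nths (vs[i := v]) I = (nths vs I)[m := v]"
      using nths_update_in[of i vs I] l by auto
    have "linear (\<lambda>v. F ((nths vs I)[m := v]))"
      using m(1) l by (intro bounded_multilinear_linear[OF F]) (auto simp: split_order_length)
    then show ?thesis
      using linear_compose[of _ "\<lambda>a. B a (G (nths vs (- I)))"]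
      by (simp add: split_product_def m(2) nths_update_notin True o_def
          bounded_linear.linear[OF bounded_linear_left])
  next
    case False
    then obtain m where m: "m < length (nths vs (- I))" "\<And>v. nths (vs[i := v]) (- I) = (nths vs (- I))[m := v]"
      using nths_update_in[of i vs "- I"] l by auto
    have "linear (\<lambda>v. G ((nths vs (- I))[m := v]))"
      using m(1) l by (intro bounded_multilinear_linear[OF G]) (auto simp: split_order_length)
    then show ?thesis
      using linear_compose[of _ "\<lambda>a. B (F (nths vs I)) a"]
      by (simp add: split_product_def m(2) nths_update_notin False o_def
          bounded_linear.linear[OF bounded_linear_right])
  qed
  ultimately show ?thesis unfolding bounded_multilinear_def by blast
qed

subsection \<open>Derivatives of multilinear families\<close>

lemma has_multilinear_derivative_add:
  assumes "has_multilinear_derivative k F F' x" "has_multilinear_derivative k G G' x"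
  shows "has_multilinear_derivative k (\<lambda>y vs. F y vs + G y vs) (\<lambda>vs. F' vs + G' vs) x"
  unfolding has_multilinear_derivative_def
proof (intro allI impI)
  fix e :: real assume e: "e > 0"
  obtain d where d: "d > 0" "\<And>y vs. norm (y - x) < d \<Longrightarrow> length vs = k \<Longrightarrow>
      norm (F y vs - F x vs - F' ((y - x) # vs)) \<le> e / 2 * norm (y - x) * prod_list (map norm vs)"
    using assms(1) e unfolding has_multilinear_derivative_def by (meson half_gt_zero)
  obtain d' where d': "d' > 0" "\<And>y vs. norm (y - x) < d' \<Longrightarrow> length vs = k \<Longrightarrow>
      norm (G y vs - G x vs - G' ((y - x) # vs)) \<le> e / 2 * norm (y - x) * prod_list (map norm vs)"
    using assms(2) e unfolding has_multilinear_derivative_def by (meson half_gt_zero)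
  have "norm (F y vs + G y vs - (F x vs + G x vs) - (F' ((y - x) # vs) + G' ((y - x) # vs)))
      \<le> e * norm (y - x) * prod_list (map norm vs)"
    if "norm (y - x) < min d d'" "length vs = k" for y vs
  proof -
    have "norm ((F y vs - F x vs - F' ((y - x) # vs)) + (G y vs - G x vs - G' ((y - x) # vs)))
        \<le> e / 2 * norm (y - x) * prod_list (map norm vs) + e / 2 * norm (y - x) * prod_list (map norm vs)"
      using that by (intro norm_triangle_mono d d') auto
    then show ?thesis by (simp add: algebra_simps)
  qed
  then show "\<exists>d>0. \<forall>y. norm (y - x) < d \<longrightarrow> (\<forall>vs. length vs = k \<longrightarrow>
      norm (F y vs + G y vs - (F x vs + G x vs) - (F' ((y - x) # vs) + G' ((y - x) # vs)))
      \<le> e * norm (y - x) * prod_list (map norm vs))"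
    using d(1) d'(1) by (intro exI[of _ "min d d'"]) auto
qed

lemma has_multilinear_derivative_uminus:
  assumes "has_multilinear_derivative k F F' x"
  shows "has_multilinear_derivative k (\<lambda>y vs. - F y vs) (\<lambda>vs. - F' vs) x"
proof -
  have "- F y vs - - F x vs - - F' w = - (F y vs - F x vs - F' w)" for y vs w
    by simp
  then have "norm (- F y vs - - F x vs - - F' w) = norm (F y vs - F x vs - F' w)" for y vs w
    using norm_minus_cancel[of "F y vs - F x vs - F' w"] by (simp only:)
  then show ?thesis using assms unfolding has_multilinear_derivative_def by simp
qed

text \<open>The Leibniz rule. The new direction becomes argument 0 and goes to one of the two factors.\<close>

lemma has_multilinear_derivative_split_product:
  fixes F :: "'a::real_normed_vector \<Rightarrow> 'a list \<Rightarrow> 'b::real_normed_vector"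
    and G :: "'a \<Rightarrow> 'a list \<Rightarrow> 'c::real_normed_vector"
    and B :: "'b \<Rightarrow> 'c \<Rightarrow> 'd::real_normed_vector"
  assumes B: "bounded_bilinear B"
    and bF: "bounded_multilinear (split_order k I) (F x)"
    and bG: "bounded_multilinear (split_order k (- I)) (G x)"
    and bF': "bounded_multilinear (Suc (split_order k I)) F'"
    and bG': "bounded_multilinear (Suc (split_order k (- I))) G'"
    and dF: "has_multilinear_derivative (split_order k I) F F' x"
    and dG: "has_multilinear_derivative (split_order k (- I)) G G' x"
  shows "has_multilinear_derivative k (\<lambda>y. split_product B I (F y) (G y))
    (\<lambda>vs. split_product B (insert 0 (Suc ` I)) F' (G x) vs + split_product B (Suc ` I) (F x) G' vs) x"
  unfolding has_multilinear_derivative_def split_product_Cons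
proof (intro allI impI)
  interpret bounded_bilinear B by (rule B)
  fix e :: real assume e: "e > 0"
  let ?p = "\<lambda>vs :: 'a list. prod_list (map norm vs)"
  obtain CF where CF: "CF \<ge> 0" "\<And>vs. length vs = split_order k I \<Longrightarrow> norm (F x vs) \<le> CF * ?p vs"
    using bounded_multilinearE[OF bF] by metis
  obtain CG where CG: "CG \<ge> 0" "\<And>vs. length vs = split_order k (- I) \<Longrightarrow> norm (G x vs) \<le> CG * ?p vs"
    using bounded_multilinearE[OF bG] by metis
  obtain DF where DF: "DF \<ge> 0" "\<And>vs. length vs = Suc (split_order k I) \<Longrightarrow> norm (F' vs) \<le> DF * ?p vs"
    using bounded_multilinearE[OF bF'] by metis
  obtain DG where DG: "DG \<ge> 0" "\<And>vs. length vs = Suc (split_order k (- I)) \<Longrightarrow> norm (G' vs) \<le> DG * ?p vs"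
    using bounded_multilinearE[OF bG'] by metis
  obtain K where K: "K > 0" "\<And>a b. norm (B a b) \<le> norm a * norm b * K"
    using pos_bounded by blast
  \<comment> \<open>\<open>M\<close> collects the constants in the bounds \<open>t1\<close>, \<open>t2'\<close>, \<open>t3\<close> of the three error terms below\<close>
  define M where "M = K * (CG + DG + 1 + CF) + K * (DF * (DG + 1)) + 1"
  have M: "M > 0" unfolding M_def using K(1) CF(1) CG(1) DG(1) DF(1)
    by (intro add_nonneg_pos add_nonneg_nonneg mult_nonneg_nonneg) auto
  define e' where "e' = min 1 (e / M)"
  have e': "e' > 0" "e' \<le> 1" "e' * M \<le> e"
    using e M by (auto simp: e'_def min_def field_simps)
  obtain d1 where d1: "d1 > 0" "\<And>y vs. norm (y - x) < d1 \<Longrightarrow> length vs = split_order k I \<Longrightarrow>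
      norm (F y vs - F x vs - F' ((y - x) # vs)) \<le> e' * norm (y - x) * ?p vs"
    using dF e'(1) unfolding has_multilinear_derivative_def by metis
  obtain d2 where d2: "d2 > 0" "\<And>y vs. norm (y - x) < d2 \<Longrightarrow> length vs = split_order k (- I) \<Longrightarrow>
      norm (G y vs - G x vs - G' ((y - x) # vs)) \<le> e' * norm (y - x) * ?p vs"
    using dG e'(1) unfolding has_multilinear_derivative_def by metis
  define d where "d = min (min d1 d2) e'"
  have d: "d > 0" using d1(1) d2(1) e'(1) by (simp add: d_def)
  have "norm (split_product B I (F y) (G y) vs - split_product B I (F x) (G x) vs -
      (B (F' ((y - x) # nths vs I)) (G x (nths vs (- I))) + B (F x (nths vs I)) (G' ((y - x) # nths vs (- I)))))
      \<le> e * norm (y - x) * ?p vs" if y: "norm (y - x) < d" and l: "length vs = k" for y vs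
  proof -
    let ?a = "nths vs I" and ?b = "nths vs (- I)" and ?h = "norm (y - x)"
    have la: "length ?a = split_order k I" and lb: "length ?b = split_order k (- I)"
      using l by (simp_all add: split_order_length)
    have h: "?h \<le> e'" "?h \<le> 1" "?h < d1" "?h < d2" using y e' by (auto simp: d_def)
    have pa: "0 \<le> ?p ?a" and pb: "0 \<le> ?p ?b" by (rule prod_norm_nonneg)+
    have rF: "norm (F y ?a - F x ?a - F' ((y - x) # ?a)) \<le> e' * ?h * ?p ?a"
      by (rule d1(2)[OF h(3) la])
    have rG: "norm (G y ?b - G x ?b - G' ((y - x) # ?b)) \<le> e' * ?h * ?p ?b"
      by (rule d2(2)[OF h(4) lb])
    have nF': "norm (F' ((y - x) # ?a)) \<le> DF * ?h * ?p ?a"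
      using DF(2)[of "(y - x) # ?a"] la by (simp add: mult_ac)
    have nG': "norm (G' ((y - x) # ?b)) \<le> DG * ?h * ?p ?b"
      using DG(2)[of "(y - x) # ?b"] lb by (simp add: mult_ac)
    have "norm (G y ?b - G x ?b) \<le> e' * ?h * ?p ?b + DG * ?h * ?p ?b"
      using rG nG' norm_triangle_ineq[of "G y ?b - G x ?b - G' ((y - x) # ?b)" "G' ((y - x) # ?b)"] by simp
    also have "\<dots> = (e' + DG) * ?h * ?p ?b" by (simp add: algebra_simps)
    also have "\<dots> \<le> (1 + DG) * ?h * ?p ?b"
      using e'(2) pb by (intro mult_right_mono) auto
    finally have dGy: "norm (G y ?b - G x ?b) \<le> (1 + DG) * ?h * ?p ?b" .
    have "(1 + DG) * ?h * ?p ?b \<le> (1 + DG) * 1 * ?p ?b"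
      using h(2) DG(1) pb by (intro mult_mono) auto
    then have nGy: "norm (G y ?b) \<le> (CG + DG + 1) * ?p ?b"
      using dGy CG(2)[OF lb] norm_triangle_ineq[of "G y ?b - G x ?b" "G x ?b"] by (simp add: algebra_simps)
    have t1: "norm (B (F y ?a - F x ?a - F' ((y - x) # ?a)) (G y ?b))
        \<le> (e' * ?h * ?p ?a) * ((CG + DG + 1) * ?p ?b) * K"
      using K(1) pa e'(1)
      by (intro order_trans[OF K(2)] mult_right_mono mult_mono rF nGy) auto
    have t2: "norm (B (F' ((y - x) # ?a)) (G y ?b - G x ?b))
        \<le> (DF * ?h * ?p ?a) * ((1 + DG) * ?h * ?p ?b) * K"
      using K(1) pa DF(1)
      by (intro order_trans[OF K(2)] mult_right_mono mult_mono nF' dGy) auto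
    have t3: "norm (B (F x ?a) (G y ?b - G x ?b - G' ((y - x) # ?b)))
        \<le> (CF * ?p ?a) * (e' * ?h * ?p ?b) * K"
      using K(1) pa CF(1)
      by (intro order_trans[OF K(2)] mult_right_mono mult_mono CF(2)[OF la] rG) auto
    have "(DF * ?h * ?p ?a) * ((1 + DG) * ?h * ?p ?b) * K = ?h * (DF * (1 + DG) * K * ?h * (?p ?a * ?p ?b))"
      by (simp add: mult_ac)
    also have "\<dots> \<le> e' * (DF * (1 + DG) * K * ?h * (?p ?a * ?p ?b))"
      using h(1) DF(1) DG(1) K(1) pa pb by (intro mult_right_mono mult_nonneg_nonneg) auto
    finally have t2': "norm (B (F' ((y - x) # ?a)) (G y ?b - G x ?b))
        \<le> e' * (DF * (1 + DG) * K * ?h * (?p ?a * ?p ?b))" using t2 by linarith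
    have eq: "split_product B I (F y) (G y) vs - split_product B I (F x) (G x) vs -
        (B (F' ((y - x) # ?a)) (G x ?b) + B (F x ?a) (G' ((y - x) # ?b)))
      = B (F y ?a - F x ?a - F' ((y - x) # ?a)) (G y ?b) + B (F' ((y - x) # ?a)) (G y ?b - G x ?b)
        + B (F x ?a) (G y ?b - G x ?b - G' ((y - x) # ?b))"
      by (simp add: split_product_def diff_left diff_right)
    have "norm (split_product B I (F y) (G y) vs - split_product B I (F x) (G x) vs -
        (B (F' ((y - x) # ?a)) (G x ?b) + B (F x ?a) (G' ((y - x) # ?b))))
      \<le> (e' * ?h * ?p ?a) * ((CG + DG + 1) * ?p ?b) * K
        + e' * (DF * (1 + DG) * K * ?h * (?p ?a * ?p ?b)) + (CF * ?p ?a) * (e' * ?h * ?p ?b) * K"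
      unfolding eq by (intro norm_triangle_mono t1 t2' t3)
    also have "\<dots> = e' * (M - 1) * (?h * (?p ?a * ?p ?b))"
      by (simp add: M_def algebra_simps)
    also have "\<dots> \<le> e * (?h * (?p ?a * ?p ?b))"
      using e' pa pb by (intro mult_right_mono) (auto simp: right_diff_distrib)
    finally show ?thesis by (simp add: prod_norm_nths mult.assoc)
  qed
  then show "\<exists>d>0. \<forall>y. norm (y - x) < d \<longrightarrow> (\<forall>vs. length vs = k \<longrightarrow>
      norm (split_product B I (F y) (G y) vs - split_product B I (F x) (G x) vs -
      (B (F' ((y - x) # nths vs I)) (G x (nths vs (- I))) + B (F x (nths vs I)) (G' ((y - x) # nths vs (- I)))))
      \<le> e * norm (y - x) * ?p vs)"
    using d by blast
qed

lemma bounded_multilinear_1_linear: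
  assumes "bounded_multilinear (Suc 0) F"
  shows "bounded_linear (\<lambda>v. F [v])"
proof -
  obtain C where "\<And>vs. length vs = Suc 0 \<Longrightarrow> norm (F vs) \<le> C * prod_list (map norm vs)"
    using bounded_multilinearE[OF assms] by metis
  from this[of "[_]"] have C: "norm (F [v]) \<le> C * norm v" for v by simp
  have "linear (\<lambda>v. F ([0][0 := v]))"
    by (rule bounded_multilinear_linear[OF assms]) auto
  then have l: "linear (\<lambda>v. F [v])" by simp
  show ?thesis
    by (rule bounded_linear_intro[of _ C])
       (auto simp: C linear_add[OF l] linear_scale[OF l] mult.commute)
qed

lemma has_multilinear_derivative_0:
  assumes "bounded_multilinear (Suc 0) F'"
  shows "has_multilinear_derivative 0 F F' x \<longleftrightarrow>
    ((\<lambda>y. F y []) has_derivative (\<lambda>v. F' [v])) (at x)"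
  using bounded_multilinear_1_linear[OF assms]
  by (simp add: has_multilinear_derivative_def has_derivative_at_alt)

subsection \<open>Smooth functions\<close>

text \<open>
  To prove smoothness without writing down any higher derivative, it is enough to have a class of
  multilinear families that contains the function and in which every member has a derivative.
\<close>

lemma smooth_on_if_derivatives_stay_in_class:
  assumes cls: "\<And>k F. P k F \<Longrightarrow> \<exists>F'. P (Suc k) F' \<and> (\<forall>x\<in>S. has_multilinear_derivative k F (F' x) x)"
    and bnd: "\<And>k F x. P k F \<Longrightarrow> x \<in> S \<Longrightarrow> bounded_multilinear k (F x)"
    and start: "P 0 F0" "\<And>x. x \<in> S \<Longrightarrow> F0 x [] = f x"
  shows "smooth_on S f"
proof -
  obtain next_F where n: "\<And>k F. P k F \<Longrightarrow> P (Suc k) (next_F k F) \<and>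
      (\<forall>x\<in>S. has_multilinear_derivative k F (next_F k F x) x)"
    using cls by metis
  define D where "D = rec_nat F0 next_F"
  have P: "P k (D k)" for k
    by (induction k) (auto simp: D_def start n)
  have "D (Suc k) = next_F k (D k)" for k by (simp add: D_def)
  then have "\<forall>x\<in>S. has_multilinear_derivative k (D k) (D (Suc k) x) x" for k
    using n[OF P[of k]] by simp
  moreover have "D 0 = F0" by (simp add: D_def)
  ultimately show ?thesis unfolding smooth_on_def using bnd[OF P] start(2)
    by (intro exI[of _ D]) auto
qed

lemma smooth_on_cong: "smooth_on S f \<Longrightarrow> (\<And>x. x \<in> S \<Longrightarrow> f x = g x) \<Longrightarrow> smooth_on S g"
  unfolding smooth_on_def by auto

lemma smooth_on_const [simp]: "smooth_on S (\<lambda>_. c)"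
proof -
  define D where "D k x vs = (if k = 0 then c else 0)" for k :: nat and x :: 'a and vs :: "'a list"
  have "bounded_multilinear k (D k x)" for k x
    unfolding bounded_multilinear_def D_def
    by (auto intro!: exI[of _ "norm c"] module_hom_zero mult_nonneg_nonneg prod_norm_nonneg)
  moreover have "has_multilinear_derivative k (D k) (D (Suc k) x) x" for k x
    unfolding has_multilinear_derivative_def D_def
    by (auto intro!: exI[of _ 1] mult_nonneg_nonneg prod_norm_nonneg)
  ultimately show ?thesis unfolding smooth_on_def by (intro exI[of _ D]) (simp add: D_def)
qed

lemma smooth_on_bounded_linear:
  assumes "bounded_linear f"
  shows "smooth_on S f"
proof -
  interpret bounded_linear f by (rule assms)
  define D where "D k x vs = (if k = 0 then f x else if k = 1 then f (hd vs) else 0)"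
    for k :: nat and x :: 'a and vs :: "'a list"
  obtain C where C: "\<And>x. norm (f x) \<le> norm x * C" using bounded by blast
  have "bounded_multilinear k (D k x)" for k x
  proof -
    consider "k = 0" | "k = 1" | "k \<ge> 2" by linarith
    then show ?thesis
    proof cases
      case 1 then show ?thesis unfolding bounded_multilinear_def D_def by auto
    next
      case 2
      have "linear (\<lambda>v. f (hd (vs[i := v])))" if "length vs = 1" "i < 1" for vs i
        using that linear_axioms by (cases vs) auto
      moreover have "norm (f (hd vs)) \<le> C * prod_list (map norm vs)" if "length vs = 1" for vs
        using that C by (cases vs) (auto simp: mult.commute)
      ultimately show ?thesis unfolding bounded_multilinear_def D_def using 2 by auto
    next
      case 3 then show ?thesis unfolding bounded_multilinear_def D_def
        by (auto intro!: exI[of _ 0] module_hom_zero)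
    qed
  qed
  moreover have "has_multilinear_derivative k (D k) (D (Suc k) x) x" for k x
    unfolding has_multilinear_derivative_def D_def
    by (auto intro!: exI[of _ 1] mult_nonneg_nonneg prod_norm_nonneg simp: diff)
  ultimately show ?thesis unfolding smooth_on_def by (intro exI[of _ D]) (simp add: D_def)
qed

text \<open>
  By the Leibniz rule, the sums of split products of derivatives of the two factors form a class of
  multilinear families that is closed under differentiation.
\<close>

inductive bilinear_jet ::
    "('b \<Rightarrow> 'c \<Rightarrow> 'd::real_normed_vector) \<Rightarrow> (nat \<Rightarrow> 'a \<Rightarrow> 'a list \<Rightarrow> 'b) \<Rightarrow> (nat \<Rightarrow> 'a \<Rightarrow> 'a list \<Rightarrow> 'c)
      \<Rightarrow> nat \<Rightarrow> ('a \<Rightarrow> 'a list \<Rightarrow> 'd) \<Rightarrow> bool" for B D E where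
  product: "bilinear_jet B D E k (\<lambda>x. split_product B I (D (split_order k I) x) (E (split_order k (- I)) x))"
| sum: "bilinear_jet B D E k F \<Longrightarrow> bilinear_jet B D E k G \<Longrightarrow> bilinear_jet B D E k (\<lambda>x vs. F x vs + G x vs)"

lemma smooth_on_bilinear:
  assumes B: "bounded_bilinear B" and f: "smooth_on S f" and g: "smooth_on S g"
  shows "smooth_on S (\<lambda>x. B (f x) (g x))"
proof -
  obtain D where D: "\<And>x. x \<in> S \<Longrightarrow> D 0 x [] = f x"
      "\<And>k x. x \<in> S \<Longrightarrow> bounded_multilinear k (D k x)"
      "\<And>k x. x \<in> S \<Longrightarrow> has_multilinear_derivative k (D k) (D (Suc k) x) x"
    using f unfolding smooth_on_def by blast
  obtain E where E: "\<And>x. x \<in> S \<Longrightarrow> E 0 x [] = g x"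
      "\<And>k x. x \<in> S \<Longrightarrow> bounded_multilinear k (E k x)"
      "\<And>k x. x \<in> S \<Longrightarrow> has_multilinear_derivative k (E k) (E (Suc k) x) x"
    using g unfolding smooth_on_def by blast
  show ?thesis
  proof (rule smooth_on_if_derivatives_stay_in_class[where P = "bilinear_jet B D E"])
    fix k F x assume "bilinear_jet B D E k F" "x \<in> S"
    then show "bounded_multilinear k (F x)"
      by induction (auto intro: bounded_multilinear_split_product bounded_multilinear_add B D E)
  next
    fix k F assume "bilinear_jet B D E k F"
    then show "\<exists>F'. bilinear_jet B D E (Suc k) F' \<and> (\<forall>x\<in>S. has_multilinear_derivative k F (F' x) x)"
    proof induction
      case (product k I)
      let ?F' = "\<lambda>x vs. split_product B (insert 0 (Suc ` I)) (D (Suc (split_order k I)) x) (E (split_order k (- I)) x) vs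
        + split_product B (Suc ` I) (D (split_order k I) x) (E (Suc (split_order k (- I))) x) vs"
      have "bilinear_jet B D E (Suc k) ?F'"
        using bilinear_jet.product[of B D E "Suc k" "insert 0 (Suc ` I)"]
          bilinear_jet.product[of B D E "Suc k" "Suc ` I"]
        by (intro bilinear_jet.sum) (simp_all only: split_order_Suc)
      moreover have "\<forall>x\<in>S. has_multilinear_derivative k
          (\<lambda>y. split_product B I (D (split_order k I) y) (E (split_order k (- I)) y)) (?F' x) x"
        by (intro ballI has_multilinear_derivative_split_product B D E)
      ultimately show ?case by (intro exI[of _ ?F']) simp
    next
      case (sum k F G)
      then obtain F' G' where "bilinear_jet B D E (Suc k) F'" "bilinear_jet B D E (Suc k) G'"
          "\<forall>x\<in>S. has_multilinear_derivative k F (F' x) x" "\<forall>x\<in>S. has_multilinear_derivative k G (G' x) x"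
        by blast
      then show ?case
        by (intro exI[of _ "\<lambda>x vs. F' x vs + G' x vs"])
           (auto intro: bilinear_jet.sum has_multilinear_derivative_add)
    qed
  next
    show "bilinear_jet B D E 0 (\<lambda>x. split_product B {} (D (split_order 0 {}) x) (E (split_order 0 (- {})) x))"
      by (rule bilinear_jet.product)
    show "split_product B {} (D (split_order 0 {}) x) (E (split_order 0 (- {})) x) [] = B (f x) (g x)"
      if "x \<in> S" for x
      using D(1)[OF that] E(1)[OF that] by (simp add: split_product_def split_order_def)
  qed
qed

lemma smooth_on_add:
  assumes f: "smooth_on S f" and g: "smooth_on S g"
  shows "smooth_on S (\<lambda>x. f x + g x)"
proof -
  obtain D where D: "\<And>x. x \<in> S \<Longrightarrow> D 0 x [] = f x"
      "\<And>k x. x \<in> S \<Longrightarrow> bounded_multilinear k (D k x)"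
      "\<And>k x. x \<in> S \<Longrightarrow> has_multilinear_derivative k (D k) (D (Suc k) x) x"
    using f unfolding smooth_on_def by blast
  obtain E where E: "\<And>x. x \<in> S \<Longrightarrow> E 0 x [] = g x"
      "\<And>k x. x \<in> S \<Longrightarrow> bounded_multilinear k (E k x)"
      "\<And>k x. x \<in> S \<Longrightarrow> has_multilinear_derivative k (E k) (E (Suc k) x) x"
    using g unfolding smooth_on_def by blast
  show ?thesis unfolding smooth_on_def
    by (intro exI[of _ "\<lambda>k x vs. D k x vs + E k x vs"] conjI ballI allI
        bounded_multilinear_add has_multilinear_derivative_add D E) (simp_all add: D E)
qed

text \<open>
  The reciprocal \<open>u\<close> of a function with derivatives \<open>E k\<close> satisfies \<open>u' = - u * u * E 1\<close>. Hence
  the polynomial expressions in \<open>u\<close> and the \<open>E k\<close> are closed under differentiation.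
\<close>

inductive inverse_jet ::
    "('a \<Rightarrow> real) \<Rightarrow> (nat \<Rightarrow> 'a \<Rightarrow> 'a list \<Rightarrow> real) \<Rightarrow> nat \<Rightarrow> ('a \<Rightarrow> 'a list \<Rightarrow> real) \<Rightarrow> bool" for u E where
  inverse: "inverse_jet u E 0 (\<lambda>x vs. u x)"
| jet: "inverse_jet u E k (E k)"
| product: "inverse_jet u E (split_order k I) F \<Longrightarrow> inverse_jet u E (split_order k (- I)) G \<Longrightarrow>
    inverse_jet u E k (\<lambda>x. split_product (*) I (F x) (G x))"
| sum: "inverse_jet u E k F \<Longrightarrow> inverse_jet u E k G \<Longrightarrow> inverse_jet u E k (\<lambda>x vs. F x vs + G x vs)"
| uminus: "inverse_jet u E k F \<Longrightarrow> inverse_jet u E k (\<lambda>x vs. - F x vs)"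

lemma smooth_on_inverse:
  fixes f :: "'a::real_normed_vector \<Rightarrow> real"
  assumes f: "smooth_on S f" and nz: "\<And>x. x \<in> S \<Longrightarrow> f x \<noteq> 0"
  shows "smooth_on S (\<lambda>x. inverse (f x))"
proof -
  obtain E where E: "\<And>x. x \<in> S \<Longrightarrow> E 0 x [] = f x"
      "\<And>k x. x \<in> S \<Longrightarrow> bounded_multilinear k (E k x)"
      "\<And>k x. x \<in> S \<Longrightarrow> has_multilinear_derivative k (E k) (E (Suc k) x) x"
    using f unfolding smooth_on_def by blast
  define u where "u x = inverse (E 0 x [])" for x
  have bnd: "bounded_multilinear k (F x)" if "inverse_jet u E k F" "x \<in> S" for k F x
    using that
  proof induction
    case inverse
    then show ?case unfolding bounded_multilinear_def by auto
  qed (auto intro: bounded_multilinear_split_product bounded_multilinear_add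
      bounded_multilinear_uminus bounded_bilinear_mult E)
  show ?thesis
  proof (rule smooth_on_if_derivatives_stay_in_class[where P = "inverse_jet u E"])
    show "bounded_multilinear k (F x)" if "inverse_jet u E k F" "x \<in> S" for k F x
      using that by (rule bnd)
  next
    fix k F assume "inverse_jet u E k F"
    then show "\<exists>F'. inverse_jet u E (Suc k) F' \<and> (\<forall>x\<in>S. has_multilinear_derivative k F (F' x) x)"
    proof induction
      case inverse
      let ?F' = "\<lambda>x vs. - split_product (*) {} (split_product (*) {} (\<lambda>_. u x) (\<lambda>_. u x)) (E (Suc 0) x) vs"
      have o: "split_order k {} = 0" "split_order k (- {}) = k" for k
        by (simp_all add: split_order_def)
      have uu: "inverse_jet u E 0 (\<lambda>x. split_product (*) {} (\<lambda>_. u x) (\<lambda>_. u x))"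
        by (rule inverse_jet.product[where F = "\<lambda>x _. u x" and G = "\<lambda>x _. u x"])
           (simp_all only: o inverse_jet.inverse)
      have F': "inverse_jet u E (Suc 0) ?F'"
        by (rule inverse_jet.uminus, rule inverse_jet.product[where F = "\<lambda>x. split_product (*) {} (\<lambda>_. u x) (\<lambda>_. u x)"])
           (simp_all only: o uu inverse_jet.jet)
      have "has_multilinear_derivative 0 (\<lambda>x vs. u x) (?F' x) x" if x: "x \<in> S" for x
      proof -
        have "((\<lambda>y. E 0 y []) has_derivative (\<lambda>v. E (Suc 0) x [v])) (at x)"
          using has_multilinear_derivative_0 E(2,3)[OF x] by blast
        moreover have "E 0 x [] \<noteq> 0" using nz[OF x] E(1)[OF x] by simp
        ultimately have "(u has_derivative (\<lambda>v. - (u x * E (Suc 0) x [v] * u x))) (at x)"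
          unfolding u_def by (intro Deriv.has_derivative_inverse)
        moreover have "- (u x * E (Suc 0) x [v] * u x) = ?F' x [v]" for v
          by (simp add: split_product_def nths_singleton)
        ultimately show ?thesis
          by (subst has_multilinear_derivative_0[OF bnd[OF F' x]]) simp
      qed
      then show ?case using F' by blast
    next
      case (jet k)
      then show ?case using E(3) inverse_jet.jet by blast
    next
      case (product k I F G)
      then obtain F' G' where F': "inverse_jet u E (Suc (split_order k I)) F'"
          "\<forall>x\<in>S. has_multilinear_derivative (split_order k I) F (F' x) x"
        and G': "inverse_jet u E (Suc (split_order k (- I))) G'"
          "\<forall>x\<in>S. has_multilinear_derivative (split_order k (- I)) G (G' x) x"
        by blast
      let ?D = "\<lambda>x vs. split_product (*) (insert 0 (Suc ` I)) (F' x) (G x) vs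
        + split_product (*) (Suc ` I) (F x) (G' x) vs"
      have "inverse_jet u E (Suc k) ?D"
        by (intro inverse_jet.sum inverse_jet.product) (simp_all only: split_order_Suc F' G' product.hyps)
      moreover have "\<forall>x\<in>S. has_multilinear_derivative k (\<lambda>x. split_product (*) I (F x) (G x)) (?D x) x"
        by (intro ballI has_multilinear_derivative_split_product bounded_bilinear_mult)
           (auto intro: bnd product.hyps F' G' simp: F'(2) G'(2))
      ultimately show ?case by (intro exI[of _ ?D]) simp
    next
      case (sum k F G)
      then obtain F' G' where "inverse_jet u E (Suc k) F'" "inverse_jet u E (Suc k) G'"
          "\<forall>x\<in>S. has_multilinear_derivative k F (F' x) x" "\<forall>x\<in>S. has_multilinear_derivative k G (G' x) x"
        by blast
      then show ?case
        by (intro exI[of _ "\<lambda>x vs. F' x vs + G' x vs"])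
           (auto intro: inverse_jet.sum has_multilinear_derivative_add)
    next
      case (uminus k F)
      then obtain F' where "inverse_jet u E (Suc k) F'" "\<forall>x\<in>S. has_multilinear_derivative k F (F' x) x"
        by blast
      then show ?case
        by (intro exI[of _ "\<lambda>x vs. - F' x vs"])
           (auto intro: inverse_jet.uminus has_multilinear_derivative_uminus)
    qed
  next
    show "inverse_jet u E 0 (\<lambda>x vs. u x)" by (rule inverse_jet.inverse)
    show "u x = inverse (f x)" if "x \<in> S" for x using E(1)[OF that] by (simp add: u_def)
  qed
qed

text \<open>
  Being smooth is a local property. It is used for a function that is given by different formulas on
  the pieces of a partition into open sets; on each piece the derivatives of its own formula serve.
\<close>

lemma smooth_on_locally_constant_choice:
  assumes loc: "\<And>x. x \<in> S \<Longrightarrow> \<exists>d>0. \<forall>y. norm (y - x) < d \<longrightarrow> idx y = idx x"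
    and sm: "\<And>i. smooth_on {x \<in> S. idx x = i} (h i)"
    and f: "\<And>x. x \<in> S \<Longrightarrow> f x = h (idx x) x"
  shows "smooth_on S f"
proof -
  let ?jets = "\<lambda>i D. (\<forall>x\<in>{x \<in> S. idx x = i}. D 0 x [] = h i x) \<and>
      (\<forall>k. \<forall>x\<in>{x \<in> S. idx x = i}. bounded_multilinear k (D k x) \<and>
        has_multilinear_derivative k (D k) (D (Suc k) x) x)"
  have "\<forall>i. \<exists>D. ?jets i D" using sm unfolding smooth_on_def by (rule allI)
  from choice[OF this] obtain D where D0: "\<forall>i. ?jets i (D i)" ..
  have D: "x \<in> S \<Longrightarrow> idx x = i \<Longrightarrow> D i 0 x [] = h i x"
    "x \<in> S \<Longrightarrow> idx x = i \<Longrightarrow> bounded_multilinear k (D i k x)"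
    "x \<in> S \<Longrightarrow> idx x = i \<Longrightarrow> has_multilinear_derivative k (D i k) (D i (Suc k) x) x" for i k x
    using spec[OF D0, of i] by auto
  have "has_multilinear_derivative k (\<lambda>x. D (idx x) k x) (D (idx x) (Suc k) x) x" if x: "x \<in> S" for k x
    unfolding has_multilinear_derivative_def
  proof (intro allI impI)
    fix e :: real assume "e > 0"
    obtain d where d: "d > 0" "\<And>y. norm (y - x) < d \<Longrightarrow> idx y = idx x" using loc[OF x] by blast
    obtain d' where d': "d' > 0" "\<forall>y. norm (y - x) < d' \<longrightarrow> (\<forall>vs. length vs = k \<longrightarrow>
        norm (D (idx x) k y vs - D (idx x) k x vs - D (idx x) (Suc k) x ((y - x) # vs))
          \<le> e * norm (y - x) * prod_list (map norm vs))"
      using D(3)[OF x refl, of k] \<open>e > 0\<close> unfolding has_multilinear_derivative_def by blast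
    show "\<exists>d>0. \<forall>y. norm (y - x) < d \<longrightarrow> (\<forall>vs. length vs = k \<longrightarrow>
        norm (D (idx y) k y vs - D (idx x) k x vs - D (idx x) (Suc k) x ((y - x) # vs))
          \<le> e * norm (y - x) * prod_list (map norm vs))"
    proof (intro exI[of _ "min d d'"] conjI allI impI)
      show "min d d' > 0" using d(1) d'(1) by simp
      fix y and vs :: "'a list" assume y: "norm (y - x) < min d d'" and l: "length vs = k"
      then have "idx y = idx x" by (intro d(2)) simp
      then show "norm (D (idx y) k y vs - D (idx x) k x vs - D (idx x) (Suc k) x ((y - x) # vs))
          \<le> e * norm (y - x) * prod_list (map norm vs)"
        using d'(2) y l by simp
    qed
  qed
  then show ?thesis unfolding smooth_on_def using D f
    by (intro exI[of _ "\<lambda>k x. D (idx x) k x"]) simp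
qed

lemma smooth_on_has_derivative:
  assumes "smooth_on S f" "open S" "x \<in> S"
  shows "\<exists>f'. (f has_derivative f') (at x)"
proof -
  obtain D where D: "\<And>x. x \<in> S \<Longrightarrow> D 0 x [] = f x"
      "\<And>k x. x \<in> S \<Longrightarrow> bounded_multilinear k (D k x)"
      "\<And>k x. x \<in> S \<Longrightarrow> has_multilinear_derivative k (D k) (D (Suc k) x) x"
    using assms(1) unfolding smooth_on_def by blast
  have "((\<lambda>y. D 0 y []) has_derivative (\<lambda>v. D (Suc 0) x [v])) (at x)"
    using has_multilinear_derivative_0 D(2,3)[OF assms(3)] by blast
  then have "(f has_derivative (\<lambda>v. D (Suc 0) x [v])) (at x)"
    by (rule has_derivative_transform_within_open[OF _ assms(2,3)]) (simp add: D)
  then show ?thesis by blast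
qed

section \<open>The unit sphere of a Hilbert space\<close>

subsection \<open>Linear isometries\<close>

definition linear_isometry :: "('a::real_inner \<Rightarrow> 'b::real_inner) \<Rightarrow> bool" where
  "linear_isometry f \<longleftrightarrow> linear f \<and> (\<forall>x. norm (f x) = norm x)"

lemma linear_isometry_norm: "linear_isometry f \<Longrightarrow> norm (f x) = norm x"
  by (simp add: linear_isometry_def)

lemma linear_isometry_bounded_linear: "linear_isometry f \<Longrightarrow> bounded_linear f"
  by (auto simp: linear_isometry_def linear_conv_bounded_linear[symmetric] linear_add linear_scale
      intro!: bounded_linear_intro[of f 1])

lemma linear_isometry_diff: "linear_isometry f \<Longrightarrow> f (x - y) = f x - f y"
  by (simp add: linear_isometry_def linear_diff)

lemma linear_isometry_inj: "linear_isometry f \<Longrightarrow> f x = f y \<longleftrightarrow> x = y"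
  using linear_isometry_norm[of f "x - y"] linear_isometry_diff[of f x y] by auto

lemma linear_isometry_inner: 
  assumes "linear_isometry f" 
  shows "inner (f x) (f y) = inner x y"
proof -
  have "f x + f y = f (x + y)" using assms by (simp add: linear_isometry_def linear_add)
  then have "(norm (f x + f y))\<^sup>2 = (norm (x + y))\<^sup>2"
    using linear_isometry_norm[OF assms] by metis
  moreover have "(norm (f x))\<^sup>2 = (norm x)\<^sup>2" "(norm (f y))\<^sup>2 = (norm y)\<^sup>2"
    using linear_isometry_norm[OF assms] by simp_all
  ultimately show ?thesis
    unfolding power2_norm_eq_inner
    by (simp add: inner_add_left inner_add_right inner_commute[of "f y" "f x"] inner_commute[of y x])
qed

lemma linear_isometry_inverse:
  assumes "linear_isometry f" "surj f"
  shows "inv_into UNIV f (f x) = x" "f (inv_into UNIV f x) = x"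
  using linear_isometry_inj[OF assms(1)] assms(2) by (auto simp: surj_f_inv_f intro!: inv_into_f_f injI)

lemma linear_isometry_comp:
  "linear_isometry f \<Longrightarrow> linear_isometry g \<Longrightarrow> linear_isometry (f \<circ> g)"
  by (simp add: linear_isometry_def linear_compose)

lemma linear_isometry_inv:
  assumes f: "linear_isometry f" "surj f"
  shows "linear_isometry (inv_into UNIV f)" "surj (inv_into UNIV f)"
proof -
  have i: "inj f" using linear_isometry_inj[OF f(1)] by (auto intro: injI)
  have l: "linear f" using f(1) by (simp add: linear_isometry_def)
  have "linear (inv_into UNIV f)"
  proof (rule linearI)
    fix r :: real and x y
    show "inv_into UNIV f (x + y) = inv_into UNIV f x + inv_into UNIV f y"
      by (subst linear_isometry_inj[OF f(1), symmetric]) (simp add: linear_add[OF l] surj_f_inv_f f(2))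
    show "inv_into UNIV f (r *\<^sub>R x) = r *\<^sub>R inv_into UNIV f x"
      by (subst linear_isometry_inj[OF f(1), symmetric]) (simp add: linear_scale[OF l] surj_f_inv_f f(2))
  qed
  moreover have "norm (inv_into UNIV f x) = norm x" for x
    using linear_isometry_norm[OF f(1), of "inv_into UNIV f x"] by (simp add: surj_f_inv_f f(2))
  ultimately show "linear_isometry (inv_into UNIV f)" by (simp add: linear_isometry_def)
  show "surj (inv_into UNIV f)" using i by (rule inj_imp_surj_inv)
qed

text \<open>The reflection in the hyperplane orthogonal to \<open>x - y\<close> exchanges the unit vectors \<open>x\<close> and \<open>y\<close>.\<close>

lemma linear_isometry_transitive:
  fixes x y :: "'a::real_inner"
  assumes "norm x = 1" "norm y = 1"
  shows "\<exists>W :: 'a \<Rightarrow> 'a. linear_isometry W \<and> surj W \<and> W x = y"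
proof (cases "x = y")
  case True
  then show ?thesis by (intro exI[of _ "\<lambda>z. z"]) (simp add: linear_isometry_def linear_id[unfolded id_def])
next
  case False
  define u where "u = x - y"
  define c where "c = 2 / inner u u"
  have u: "inner u u \<noteq> 0" using False by (simp add: u_def)
  define W where "W z = z - (c * inner z u) *\<^sub>R u" for z
  have lin: "linear W"
    by (rule linearI) (simp_all add: W_def inner_add_left algebra_simps)
  have "inner (W z) (W z) = inner z z" for z
  proof -
    have "inner (W z) (W z) = inner z z - 2 * c * (inner z u)\<^sup>2 + c * c * (inner z u)\<^sup>2 * inner u u"
      unfolding W_def inner_diff_left inner_diff_right inner_scaleR_left inner_scaleR_right
        inner_commute[of u z] by (simp add: power2_eq_square algebra_simps)
    also have "c * c * (inner z u)\<^sup>2 * inner u u = 2 * c * (inner z u)\<^sup>2"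
      using u by (simp add: c_def field_simps)
    finally show ?thesis by simp
  qed
  then have iso: "linear_isometry W" using lin by (simp add: linear_isometry_def norm_eq_sqrt_inner)
  have "W (W z) = z" for z
  proof -
    have "inner (W z) u = inner z u - c * inner z u * inner u u" by (simp add: W_def inner_diff_left)
    also have "c * inner z u * inner u u = 2 * inner z u" using u by (simp add: c_def)
    finally have "inner (W z) u = - inner z u" by simp
    then show ?thesis by (simp add: W_def[of "W z"]) (simp add: W_def)
  qed
  then have "surj W" by (metis surjI)
  moreover have "W x = y"
  proof -
    have n: "inner x x = 1" "inner y y = 1" using assms by (simp_all add: norm_eq_sqrt_inner)
    have "inner u u = 2 * inner x u"
      unfolding u_def inner_diff_left inner_diff_right inner_commute[of y x] using n by simp
    then have "c * inner x u = 1" using u by (simp add: c_def)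
    then show ?thesis by (simp add: W_def u_def)
  qed
  ultimately show ?thesis using iso by blast
qed

subsection \<open>Stereographic projection\<close>

text \<open>
  An infinite-dimensional Hilbert space is isometric to a hyperplane \<open>N\<^sup>\<bottom>\<close> in it. The isometry \<open>T\<close>
  identifies the target \<open>N\<^sup>\<bottom>\<close> of the stereographic projection with the whole space, so that the
  sphere is modelled on the space that contains it. That \<open>-1\<close> is not an eigenvalue of \<open>T\<close>
  makes the sphere contractible.
\<close>

locale sphere_projection =
  fixes T :: "'h::{real_inner, banach} \<Rightarrow> 'h" and N :: 'h
  assumes T_isometry: "linear_isometry T"
    and T_range: "range T = {y. inner y N = 0}"
    and N_unit: "norm N = 1"
    and T_no_reversal: "T x = - x \<Longrightarrow> x = 0"

definition conformal_factor :: "'h::real_inner \<Rightarrow> real" where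
  "conformal_factor x = 2 / (1 + inner x x)"

lemma conformal_factor_pos [simp]: "conformal_factor x > 0"
  unfolding conformal_factor_def by (intro divide_pos_pos add_pos_nonneg) auto

lemma conformal_factor_nonneg [simp]: "conformal_factor x \<ge> 0"
  using conformal_factor_pos[of x] by linarith

lemma conformal_factor_nz [simp]: "conformal_factor x \<noteq> 0"
  using conformal_factor_pos[of x] by linarith

lemma conformal_factor_inner: "conformal_factor x * inner x x = 2 - conformal_factor x"
proof -
  have "1 + inner x x > 0" by (intro add_pos_nonneg) auto
  then show ?thesis unfolding conformal_factor_def by (simp add: field_simps)
qed

lemma conformal_factor_eq_inverse: "conformal_factor x = 2 * inverse (1 + inner x x)"
  by (simp add: conformal_factor_def divide_inverse)

lemma smooth_conformal_factor: "smooth_on S conformal_factor"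
proof -
  have "1 + inner x x \<noteq> 0" for x :: 'a using inner_ge_zero[of x] by linarith
  then have "smooth_on S (\<lambda>x::'a. 2 * inverse (1 + inner x x))"
    by (intro smooth_on_bilinear[OF bounded_bilinear_mult] smooth_on_inverse smooth_on_add smooth_on_const
        smooth_on_bilinear[OF bounded_bilinear_inner] smooth_on_bounded_linear bounded_linear_ident)
  then show ?thesis by (rule smooth_on_cong) (simp add: conformal_factor_eq_inverse)
qed

lemma conformal_factor_has_derivative:
  "(conformal_factor has_derivative (\<lambda>v. - (conformal_factor x)\<^sup>2 * inner x v)) (at x within S)"
proof -
  have p: "1 + inner x x \<noteq> 0" using inner_ge_zero[of x] by linarith
  show ?thesis unfolding conformal_factor_def[abs_def]
    by (rule derivative_eq_intros refl p)+
       (simp add: p field_simps power2_eq_square inner_commute)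
qed

context sphere_projection
begin

lemma T_inner: "inner (T x) (T y) = inner x y"
  by (rule linear_isometry_inner[OF T_isometry])

lemma T_N: "inner (T x) N = 0" "inner N (T x) = 0"
  using T_range by (auto simp: inner_commute[of N])

lemma N_N: "inner N N = 1"
  using N_unit by (simp add: norm_eq_sqrt_inner)

text \<open>
  The point where the line through the pole \<open>N\<close> and the point \<open>T x\<close> of the hyperplane meets the
  sphere again. The map \<open>T_inv\<close> is the inverse of \<open>T\<close> preceded by the orthogonal projection
  onto \<open>N\<^sup>\<bottom>\<close>, so that it is linear on the whole space.
\<close>

definition stereo :: "'h \<Rightarrow> 'h" where
  "stereo x = conformal_factor x *\<^sub>R (T x - N) + N"

definition T_inv :: "'h \<Rightarrow> 'h" where
  "T_inv y = inv_into UNIV T (y - inner y N *\<^sub>R N)"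

definition stereo_inv :: "'h \<Rightarrow> 'h" where
  "stereo_inv y = inverse (1 - inner y N) *\<^sub>R T_inv y"

lemma T_inj: "inj T"
  using linear_isometry_inj[OF T_isometry] by (auto intro: injI)

lemma T_T_inv: "T (T_inv y) = y - inner y N *\<^sub>R N"
proof -
  have "y - inner y N *\<^sub>R N \<in> range T" by (simp add: T_range inner_diff_left N_N)
  then show ?thesis unfolding T_inv_def by (rule f_inv_into_f)
qed

lemma T_inv_unique: "T x = y - inner y N *\<^sub>R N \<Longrightarrow> T_inv y = x"
  unfolding T_inv_def using inv_into_f_f[OF T_inj, of x] by simp

lemma T_linear: "linear T" using T_isometry by (simp add: linear_isometry_def)

lemma bounded_linear_T_inv: "bounded_linear T_inv"
proof (rule bounded_linear_intro[of _ 2])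
  show "T_inv (x + y) = T_inv x + T_inv y" for x y
    by (rule T_inv_unique) (simp add: linear_add[OF T_linear] T_T_inv inner_add_left algebra_simps)
  show "T_inv (r *\<^sub>R x) = r *\<^sub>R T_inv x" for r x
    by (rule T_inv_unique) (simp add: linear_scale[OF T_linear] T_T_inv algebra_simps)
  show "norm (T_inv x) \<le> norm x * 2" for x
  proof -
    have "norm (T_inv x) = norm (x - inner x N *\<^sub>R N)"
      using linear_isometry_norm[OF T_isometry, of "T_inv x"] by (simp add: T_T_inv)
    also have "\<dots> \<le> norm x + \<bar>inner x N\<bar>"
      using norm_triangle_ineq4[of x "inner x N *\<^sub>R N"] by (simp add: N_unit)
    also have "\<bar>inner x N\<bar> \<le> norm x" using Cauchy_Schwarz_ineq2[of x N] by (simp add: N_unit)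
    finally show ?thesis by simp
  qed
qed

text \<open>
  This identity, in the form of \<open>stereo_chord\<close>, relates distances on the sphere to distances in the
  chart; it contains that \<open>stereo\<close> maps into the sphere, is injective and is conformal.
\<close>

lemma stereo_inner:
  "inner (stereo x) (stereo y) = 1 - conformal_factor x * conformal_factor y * (norm (x - y))\<^sup>2 / 2"
proof -
  let ?s = "conformal_factor x" and ?t = "conformal_factor y"
  have 1: "inner (stereo x) (stereo y) = ?s * ?t * (inner x y + 1) - ?s - ?t + 1"
    unfolding stereo_def inner_add_left inner_add_right inner_diff_left inner_diff_right
      inner_scaleR_left inner_scaleR_right T_N N_N T_inner by (simp add: algebra_simps)
  have 2: "(norm (x - y))\<^sup>2 = inner x x + inner y y - 2 * inner x y"
    unfolding power2_norm_eq_inner inner_diff_left inner_diff_right inner_commute[of y x] by simp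
  have 3: "?s * ?t * inner x x = ?t * (2 - ?s)" "?s * ?t * inner y y = ?s * (2 - ?t)"
    using conformal_factor_inner[of x] conformal_factor_inner[of y] by (metis mult.assoc mult.commute)+
  have "?s * ?t * (norm (x - y))\<^sup>2 = ?s * ?t * inner x x + ?s * ?t * inner y y - 2 * (?s * ?t * inner x y)"
    unfolding 2 by (simp add: algebra_simps)
  also have "\<dots> = 2 * (?s + ?t - ?s * ?t * (inner x y + 1))"
    unfolding 3 by (simp add: algebra_simps)
  finally have 4: "?s * ?t * (norm (x - y))\<^sup>2 = 2 * (?s + ?t - ?s * ?t * (inner x y + 1))" .
  have "B - s - t + 1 = 1 - A / 2" if "A = 2 * (s + t - B)" for A B s t :: real
    using that by (simp add: field_simps)
  from this[OF 4] show ?thesis unfolding 1 .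
qed

lemma stereo_norm [simp]: "norm (stereo x) = 1"
  using stereo_inner[of x x] by (simp add: norm_eq_sqrt_inner)

lemma stereo_chord:
  "(norm (stereo x - stereo y))\<^sup>2 = conformal_factor x * conformal_factor y * (norm (x - y))\<^sup>2"
proof -
  have "inner (stereo x) (stereo x) = 1" "inner (stereo y) (stereo y) = 1"
    by (simp_all add: power2_norm_eq_inner[symmetric])
  then show ?thesis
    unfolding power2_norm_eq_inner[of "stereo x - stereo y"] inner_diff_left inner_diff_right
      inner_commute[of "stereo y" "stereo x"] stereo_inner[of x y] by simp
qed

lemma stereo_N: "inner (stereo x) N = 1 - conformal_factor x"
  by (simp add: stereo_def inner_add_left inner_diff_left T_N N_N)

lemma stereo_0: "stereo 0 = - N"
  by (simp add: stereo_def conformal_factor_def linear_0[OF T_linear] scaleR_2)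

lemma stereo_inv_stereo: "stereo_inv (stereo x) = x"
proof -
  have "T (conformal_factor x *\<^sub>R x) = stereo x - inner (stereo x) N *\<^sub>R N"
    by (simp add: stereo_N) (simp add: stereo_def linear_scale[OF T_linear] algebra_simps)
  from T_inv_unique[OF this] show ?thesis by (simp add: stereo_inv_def stereo_N)
qed

lemma stereo_inj: "stereo x = stereo y \<longleftrightarrow> x = y"
  using stereo_inv_stereo by metis

lemma unit_inner_N:
  assumes "norm y = 1" "y \<noteq> N" 
  shows "inner y N < 1"
proof -
  have "inner y y = 1" using assms(1) by (simp add: power2_norm_eq_inner[symmetric])
  then have "(norm (y - N))\<^sup>2 = 2 - 2 * inner y N"
    unfolding power2_norm_eq_inner inner_diff_left inner_diff_right inner_commute[of N y] N_N by simp
  moreover have "(norm (y - N))\<^sup>2 > 0" using assms(2) by simp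
  ultimately show ?thesis by linarith
qed

lemma stereo_stereo_inv:
  assumes "norm y = 1" "y \<noteq> N"
  shows "stereo (stereo_inv y) = y"
proof -
  define c where "c = inner y N"
  have c: "c < 1" using unit_inner_N[OF assms] by (simp add: c_def)
  have "inner (T_inv y) (T_inv y) = inner (y - c *\<^sub>R N) (y - c *\<^sub>R N)"
    using T_inner[of "T_inv y" "T_inv y"] by (simp add: T_T_inv c_def)
  also have "\<dots> = 1 - c\<^sup>2"
    using assms(1) unfolding norm_eq_sqrt_inner inner_diff_left inner_diff_right inner_scaleR_left
      inner_scaleR_right N_N inner_commute[of N y] c_def[symmetric]
    by (simp add: power2_eq_square)
  finally have "inner (stereo_inv y) (stereo_inv y) = (1 - c\<^sup>2) / (1 - c)\<^sup>2"
    by (simp add: stereo_inv_def c_def[symmetric] power2_eq_square field_simps)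
  also have "\<dots> = (1 + c) / (1 - c)"
    using c by (simp add: power2_eq_square divide_simps) (simp add: algebra_simps)
  finally have q: "inner (stereo_inv y) (stereo_inv y) = (1 + c) / (1 - c)" .
  have "1 + (1 + c) / (1 - c) = 2 / (1 - c)" using c by (simp add: field_simps)
  then have "conformal_factor (stereo_inv y) = 1 - c"
    unfolding conformal_factor_def q by simp
  moreover have "T (stereo_inv y) = inverse (1 - c) *\<^sub>R (y - c *\<^sub>R N)"
    by (simp add: stereo_inv_def linear_scale[OF T_linear] T_T_inv c_def)
  ultimately have "conformal_factor (stereo_inv y) *\<^sub>R T (stereo_inv y) = y - c *\<^sub>R N"
    "conformal_factor (stereo_inv y) = 1 - c" using c by simp_all
  then show ?thesis by (simp add: stereo_def scaleR_diff_right) (simp add: scaleR_diff_left)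
qed

lemma stereo_has_derivative:
  "(stereo has_derivative (\<lambda>v. conformal_factor x *\<^sub>R T v
      - ((conformal_factor x)\<^sup>2 * inner x v) *\<^sub>R (T x - N))) (at x within S)"
proof -
  have T: "(T has_derivative T) (at x within S)"
    using linear_isometry_bounded_linear[OF T_isometry] by (rule bounded_linear_imp_has_derivative)
  show ?thesis unfolding stereo_def[abs_def]
    by (rule derivative_eq_intros conformal_factor_has_derivative T refl)+
       (simp add: algebra_simps)
qed

text \<open>Stereographic projection is conformal: this is the first-order form of \<open>stereo_chord\<close>.\<close>

lemma stereo_derivative_norm:
  "norm (conformal_factor x *\<^sub>R T v - ((conformal_factor x)\<^sup>2 * inner x v) *\<^sub>R (T x - N))
    = conformal_factor x * norm v"
proof -
  let ?s = "conformal_factor x" and ?a = "inner x v"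
  let ?w = "?s *\<^sub>R T v - (?s\<^sup>2 * ?a) *\<^sub>R (T x - N)"
  have "inner ?w ?w = ?s\<^sup>2 * inner v v - 2 * ?s^3 * ?a\<^sup>2 + ?s^3 * ?a\<^sup>2 * (?s * inner x x + ?s)"
    unfolding inner_diff_left inner_diff_right inner_scaleR_left inner_scaleR_right T_N N_N T_inner
      inner_commute[of v x] by (simp add: algebra_simps power2_eq_square power3_eq_cube)
  then have "(norm ?w)\<^sup>2 = (?s * norm v)\<^sup>2"
    unfolding power2_norm_eq_inner conformal_factor_inner
    by (simp add: power_mult_distrib power2_norm_eq_inner)
  then show ?thesis by (rule power2_eq_imp_eq) auto
qed

text \<open>
  These maps are the transition maps of the quotient. They are built from bounded linear maps, inner
  products and reciprocals, and the denominator vanishes only where the image point is the pole.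
\<close>

lemma smooth_stereo_inv_isometry_stereo:
  assumes V: "linear_isometry V" and S: "\<And>x. x \<in> S \<Longrightarrow> V (stereo x) \<noteq> N"
  shows "smooth_on S (\<lambda>x. stereo_inv (V (stereo x)))"
proof -
  have "(1 + - inner (V (stereo x)) N) \<noteq> 0" if "x \<in> S" for x
    using unit_inner_N[OF _ S[OF that]] linear_isometry_norm[OF V] by simp
  moreover have c: "smooth_on S (\<lambda>x. f (stereo x))" if "bounded_linear f" for f :: "'h \<Rightarrow> 'b::real_normed_vector"
  proof -
    have "smooth_on S (\<lambda>x. conformal_factor x *\<^sub>R (f (T x) + - f N) + f N)"
      by (intro smooth_on_add smooth_on_const smooth_on_bilinear[OF bounded_bilinear_scaleR]
          smooth_conformal_factor smooth_on_bounded_linear bounded_linear_compose[OF that]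
          linear_isometry_bounded_linear T_isometry)
    then show ?thesis
      by (rule smooth_on_cong)
         (simp add: stereo_def linear_add linear_diff linear_scale bounded_linear.linear[OF that])
  qed
  have i: "bounded_linear (\<lambda>y. - inner (V y) N)"
    by (intro bounded_linear_minus bounded_linear_inner_left_comp linear_isometry_bounded_linear V)
  have "smooth_on S (\<lambda>x. inverse (1 + - inner (V (stereo x)) N) *\<^sub>R T_inv (V (stereo x)))"
    by (intro smooth_on_bilinear[OF bounded_bilinear_scaleR] smooth_on_inverse smooth_on_add smooth_on_const
        c[OF i] c[OF bounded_linear_compose[OF bounded_linear_T_inv linear_isometry_bounded_linear[OF V]]] calculation)
  then show ?thesis by (rule smooth_on_cong) (simp add: stereo_inv_def)
qed

lemma continuous_on_stereo: "continuous_on S stereo"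
  using stereo_has_derivative by (intro has_derivative_continuous_on) blast

lemma continuous_on_stereo_inv: "continuous_on (sphere 0 1 - {N}) stereo_inv"
  unfolding stereo_inv_def[abs_def]
  by (intro continuous_intros linear_continuous_on bounded_linear_T_inv)
     (use unit_inner_N in force)

subsection \<open>The sphere is contractible\<close>

text \<open>
  Two maps to the sphere that are nowhere opposite are homotopic, by normalizing the segments between
  their values. The identity is nowhere opposite to \<open>T\<close>, and \<open>T\<close>, having its values orthogonal to \<open>N\<close>,
  is nowhere opposite to the constant map \<open>N\<close>.
\<close>

lemma contractible_sphere: "contractible (sphere 0 1 :: 'h set)"
proof -
  let ?S = "sphere 0 1 :: 'h set"
  have hom: "homotopic_with_canon (\<lambda>_. True) ?S ?S f g"
    if f: "continuous_on ?S f" "f ` ?S \<subseteq> ?S" and g: "continuous_on ?S g" "g ` ?S \<subseteq> ?S"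
      and nz: "\<And>x t. norm x = 1 \<Longrightarrow> 0 \<le> t \<Longrightarrow> t \<le> 1 \<Longrightarrow> (1 - t) *\<^sub>R f x + t *\<^sub>R g x \<noteq> 0" for f g :: "'h \<Rightarrow> 'h"
  proof -
    have 1: "homotopic_with_canon (\<lambda>_. True) ?S (UNIV - {0}) f g"
      using nz by (intro homotopic_with_linear f g) (fastforce simp: closed_segment_def)
    have "homotopic_with_canon (\<lambda>_. True) ?S ?S (sgn \<circ> f) (sgn \<circ> g)"
      by (rule homotopic_with_compose_continuous_left[OF homotopic_with_mono[OF 1]])
         (auto intro!: continuous_intros simp: norm_sgn)
    moreover have "sgn y = y" if "y \<in> ?S" for y :: 'h using that by (simp add: sgn_div_norm)
    ultimately show ?thesis
      using f(2) g(2) by (elim homotopic_with_eq) (auto simp: image_subset_iff)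
  qed
  have T: "continuous_on ?S T" by (intro linear_continuous_on linear_isometry_bounded_linear T_isometry)
  have Tn: "norm (T x) = norm x" for x by (rule linear_isometry_norm[OF T_isometry])
  have "homotopic_with_canon (\<lambda>_. True) ?S ?S id T"
  proof (rule hom)
    fix x :: 'h and t :: real assume x: "norm x = 1" and t: "0 \<le> t" "t \<le> 1"
    show "(1 - t) *\<^sub>R id x + t *\<^sub>R T x \<noteq> 0"
    proof
      assume "(1 - t) *\<^sub>R id x + t *\<^sub>R T x = 0"
      then have e: "t *\<^sub>R T x = - ((1 - t) *\<^sub>R x)" by (simp add: add_eq_0_iff)
      then have "norm (t *\<^sub>R T x) = norm ((1 - t) *\<^sub>R x)" by simp
      then have t2: "t = 1 / 2" using t x by (simp add: Tn)
      have "(1 / 2) *\<^sub>R T x = (1 / 2) *\<^sub>R - x" using e unfolding t2 by simp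
      then have "T x = - x" unfolding scaleR_cancel_left by simp
      then show False using T_no_reversal x by fastforce
    qed
  qed (auto simp: Tn T)
  moreover have "homotopic_with_canon (\<lambda>_. True) ?S ?S T (\<lambda>_. N)"
  proof (rule hom)
    fix x :: 'h and t :: real assume x: "norm x = 1"
    show "(1 - t) *\<^sub>R T x + t *\<^sub>R N \<noteq> 0"
    proof
      assume e: "(1 - t) *\<^sub>R T x + t *\<^sub>R N = 0"
      have "inner ((1 - t) *\<^sub>R T x + t *\<^sub>R N) N = t" by (simp add: inner_add_left T_N N_N)
      then have "t = 0" using e by simp
      then have "T x = 0" using e by simp
      then show False using Tn[of x] x by simp
    qed
  qed (auto simp: Tn T N_unit)
  ultimately show ?thesis unfolding contractible_def using homotopic_with_trans by blast
qed

end

subsection \<open>The spherical metric in stereographic coordinates has curvature 1\<close>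

context
  fixes m :: "'h::{real_inner, complete_space} \<Rightarrow> 'h \<Rightarrow> 'h \<Rightarrow> real" and U :: "'h set"
  assumes U: "open U" and m: "\<And>y v w. y \<in> U \<Longrightarrow> m y v w = (conformal_factor y)\<^sup>2 * inner v w"
begin

lemma spherical_metric_derivative:
  assumes x: "x \<in> U"
  shows "frechet_derivative (\<lambda>y. m y v w) (at x) h = - 2 * (conformal_factor x)^3 * inner x h * inner v w"
proof -
  have "((\<lambda>y. (conformal_factor y)\<^sup>2 * inner v w) has_derivative
      (\<lambda>h. - 2 * (conformal_factor x)^3 * inner x h * inner v w)) (at x)"
    by (rule derivative_eq_intros conformal_factor_has_derivative refl)+
       (simp add: power2_eq_square power3_eq_cube mult_ac)
  then have "((\<lambda>y. m y v w) has_derivative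
      (\<lambda>h. - 2 * (conformal_factor x)^3 * inner x h * inner v w)) (at x)"
    by (rule has_derivative_transform_within_open[OF _ U x]) (simp add: m)
  from frechet_derivative_at[OF this] show ?thesis by metis
qed

text \<open>
  For a metric \<open>s\<^sup>2 \<langle>v, w\<rangle>\<close> the Christoffel map is \<open>(D\<^sub>v \<phi>) w + (D\<^sub>w \<phi>) v - \<langle>v, w\<rangle> grad \<phi>\<close> with \<open>\<phi> = ln s\<close>;
  for \<open>s = 2 / (1 + \<bar>x\<bar>\<^sup>2)\<close> the gradient of \<open>\<phi>\<close> at \<open>x\<close> is \<open>- s x\<close>.
\<close>

definition spherical_christoffel :: "'h \<Rightarrow> 'h \<Rightarrow> 'h \<Rightarrow> 'h" where
  "spherical_christoffel x v w =
    - (conformal_factor x *\<^sub>R (inner x v *\<^sub>R w + inner x w *\<^sub>R v - inner v w *\<^sub>R x))"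

lemma christoffel_spherical:
  assumes x: "x \<in> U"
  shows "christoffel m x v w = spherical_christoffel x v w"
  unfolding christoffel_def spherical_metric_derivative[OF x] m[OF x]
proof (rule the_equality)
  let ?R = "\<lambda>u. - 2 * (conformal_factor x)^3 * inner x v * inner w u +
      - 2 * (conformal_factor x)^3 * inner x w * inner v u - - 2 * (conformal_factor x)^3 * inner x u * inner v w"
  show *: "\<forall>u. 2 * ((conformal_factor x)\<^sup>2 * inner (spherical_christoffel x v w) u) = ?R u"
    by (simp add: spherical_christoffel_def inner_diff_left inner_add_left algebra_simps
        power2_eq_square power3_eq_cube)
  fix z assume "\<forall>u. 2 * ((conformal_factor x)\<^sup>2 * inner z u) = ?R u"
  then have "\<forall>u. inner z u = inner (spherical_christoffel x v w) u"
    using * by (metis conformal_factor_nz mult_cancel_left power_not_zero zero_neq_numeral)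
  then show "z = spherical_christoffel x v w" by (metis vector_eq_rdot)
qed

lemma spherical_christoffel_has_derivative:
  "((\<lambda>y. spherical_christoffel y v w) has_derivative
    (\<lambda>h. ((conformal_factor x)\<^sup>2 * inner x h) *\<^sub>R (inner x v *\<^sub>R w + inner x w *\<^sub>R v - inner v w *\<^sub>R x)
      - conformal_factor x *\<^sub>R (inner h v *\<^sub>R w + inner h w *\<^sub>R v - inner v w *\<^sub>R h))) (at x)"
  unfolding spherical_christoffel_def
  by (rule derivative_eq_intros conformal_factor_has_derivative refl)+
     (simp add: algebra_simps)

lemma covariant_deriv_spherical:
  assumes x: "x \<in> U"
  shows "covariant_deriv m (\<lambda>_. u) (covariant_deriv m (\<lambda>_. v) (\<lambda>_. w)) x =
    ((conformal_factor x)\<^sup>2 * inner x u) *\<^sub>R (inner x v *\<^sub>R w + inner x w *\<^sub>R v - inner v w *\<^sub>R x)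
      - conformal_factor x *\<^sub>R (inner u v *\<^sub>R w + inner u w *\<^sub>R v - inner v w *\<^sub>R u)
      + spherical_christoffel x u (spherical_christoffel x v w)"
proof -
  have c: "covariant_deriv m (\<lambda>_. v) (\<lambda>_. w) y = spherical_christoffel y v w" if "y \<in> U" for y
    using that by (simp add: covariant_deriv_def christoffel_spherical)
  have "((\<lambda>y. covariant_deriv m (\<lambda>_. v) (\<lambda>_. w) y) has_derivative
    (\<lambda>h. ((conformal_factor x)\<^sup>2 * inner x h) *\<^sub>R (inner x v *\<^sub>R w + inner x w *\<^sub>R v - inner v w *\<^sub>R x)
      - conformal_factor x *\<^sub>R (inner h v *\<^sub>R w + inner h w *\<^sub>R v - inner v w *\<^sub>R h))) (at x)"
    by (rule has_derivative_transform_within_open[OF spherical_christoffel_has_derivative U x])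
       (simp add: c)
  from fun_cong[OF frechet_derivative_at[OF this], of u] show ?thesis
    unfolding covariant_deriv_def[of m "\<lambda>_. u"] by (simp add: c[OF x] christoffel_spherical[OF x])
qed

lemma gram_determinant_pos:
  assumes "u \<noteq> v" "independent {u, v}"
  shows "inner u u * inner v v - (inner u v)\<^sup>2 > 0"
proof -
  have v: "v \<noteq> 0" and "u \<notin> span {v}"
    using assms by (auto simp: independent_insert dependent_zero)
  define w where "w = inner v v *\<^sub>R u - inner u v *\<^sub>R v"
  have q: "inner v v > 0" using v by simp
  have "w \<noteq> 0"
  proof
    assume "w = 0"
    then have "inverse (inner v v) *\<^sub>R (inner v v *\<^sub>R u) = inverse (inner v v) *\<^sub>R (inner u v *\<^sub>R v)"
      by (simp add: w_def)
    then have "u = (inverse (inner v v) * inner u v) *\<^sub>R v" using q by simp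
    then show False using \<open>u \<notin> span {v}\<close> by (metis span_base span_scale singletonI)
  qed
  then have "0 < inner w w" by simp
  also have "inner w w = inner v v * (inner u u * inner v v - (inner u v)\<^sup>2)"
    unfolding w_def inner_diff_left inner_diff_right inner_scaleR_left inner_scaleR_right
      inner_commute[of v u] by (simp add: algebra_simps power2_eq_square)
  finally show ?thesis using q by (simp add: zero_less_mult_iff)
qed

text \<open>
  After inserting the Christoffel map the numerator is a polynomial in the inner products of \<open>x\<close>, \<open>u\<close>,
  \<open>v\<close> and in the conformal factor \<open>s\<close>; the relation \<open>s \<langle>x, x\<rangle> = 2 - s\<close> reduces it to the
  denominator.
\<close>

lemma sectional_curvature_spherical:
  assumes x: "x \<in> U" and uv: "u \<noteq> v" "independent {u, v}"
  shows "sectional_curvature m x u v = 1"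
proof -
  let ?s = "conformal_factor x" and ?a = "inner x u" and ?b = "inner x v" and ?p = "inner u u"
    and ?q = "inner v v" and ?r = "inner u v" and ?n = "inner x x"
  have c: "inner u x = ?a" "inner v x = ?b" "inner v u = ?r" by (simp_all add: inner_commute)
  have "inner (curvature_tensor m x u v v) u = (2 * ?s - ?s * (?s * ?n)) * (?p * ?q - ?r\<^sup>2)"
    unfolding curvature_tensor_def covariant_deriv_spherical[OF x] spherical_christoffel_def
    unfolding inner_add_left inner_add_right inner_diff_left inner_diff_right inner_scaleR_left
      inner_scaleR_right inner_minus_left inner_minus_right c
    by (simp add: algebra_simps power2_eq_square)
  also have "2 * ?s - ?s * (?s * ?n) = ?s\<^sup>2"
    unfolding conformal_factor_inner by (simp add: algebra_simps power2_eq_square)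
  finally have "m x (curvature_tensor m x u v v) u = ?s\<^sup>2 * (?s\<^sup>2 * (?p * ?q - ?r\<^sup>2))"
    by (simp add: m[OF x])
  moreover have "m x u u * m x v v - (m x u v)\<^sup>2 = ?s\<^sup>2 * (?s\<^sup>2 * (?p * ?q - ?r\<^sup>2))"
    by (simp add: m[OF x] algebra_simps power2_eq_square)
  moreover have "?s\<^sup>2 * (?s\<^sup>2 * (?p * ?q - ?r\<^sup>2)) \<noteq> 0"
    using gram_determinant_pos[OF uv] by simp
  ultimately show ?thesis by (simp add: sectional_curvature_def)
qed

end

subsection \<open>Angular distance and lengths of curves on the sphere\<close>

definition angle :: "'h::real_inner \<Rightarrow> 'h \<Rightarrow> real" where
  "angle x y = arccos (inner x y)"

lemma unit_inner_bounds:
  fixes x y :: "'h::real_inner"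
  assumes "norm x = 1" "norm y = 1"
  shows "- 1 \<le> inner x y" "inner x y \<le> 1"
  using Cauchy_Schwarz_ineq2[of x y] assms by auto

lemma cos_angle: "norm x = 1 \<Longrightarrow> norm y = 1 \<Longrightarrow> cos (angle x y) = inner x y"
  using unit_inner_bounds[of x y] by (simp add: angle_def)

lemma angle_nonneg: "norm x = 1 \<Longrightarrow> norm y = 1 \<Longrightarrow> 0 \<le> angle x y"
  using unit_inner_bounds[of x y] by (simp add: angle_def arccos_lbound)

lemma angle_le_pi: "norm x = 1 \<Longrightarrow> norm y = 1 \<Longrightarrow> angle x y \<le> pi"
  using unit_inner_bounds[of x y] by (simp add: angle_def arccos_ubound)

lemma angle_commute: "angle x y = angle y x"
  by (simp add: angle_def inner_commute)

lemma angle_isometry: "linear_isometry f \<Longrightarrow> angle (f x) (f y) = angle x y"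
  by (simp add: angle_def linear_isometry_inner)

text \<open>
  The components of \<open>x\<close> and \<open>z\<close> orthogonal to \<open>y\<close> have norms \<open>sin (angle x y)\<close> and
  \<open>sin (angle z y)\<close>. By the Cauchy-Schwarz inequality for them, \<open>\<langle>x, z\<rangle>\<close> is at least the cosine of the
  sum of the two angles.
\<close>

lemma angle_triangle:
  fixes x y z :: "'h::real_inner"
  assumes u: "norm x = 1" "norm y = 1" "norm z = 1"
  shows "angle x z \<le> angle x y + angle y z"
proof (cases "angle x y + angle y z \<le> pi")
  case True
  have n: "inner y y = 1" "inner x x = 1" "inner z z = 1"
    using u by (simp_all add: power2_norm_eq_inner[symmetric])
  have proj: "norm (w - cos (angle w y) *\<^sub>R y) = sin (angle w y)" if w: "norm w = 1" for w
  proof (rule power2_eq_imp_eq)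
    have "inner w w = 1" using w by (simp add: power2_norm_eq_inner[symmetric])
    then show "(norm (w - cos (angle w y) *\<^sub>R y))\<^sup>2 = (sin (angle w y))\<^sup>2"
      unfolding power2_norm_eq_inner sin_squared_eq cos_angle[OF w u(2)] inner_diff_left inner_diff_right
        inner_scaleR_left inner_scaleR_right n inner_commute[of y w] by (simp add: power2_eq_square)
    show "0 \<le> sin (angle w y)" using angle_nonneg[OF w u(2)] angle_le_pi[OF w u(2)] by (rule sin_ge_zero)
  qed simp
  have "\<bar>inner (x - cos (angle x y) *\<^sub>R y) (z - cos (angle z y) *\<^sub>R y)\<bar> \<le> sin (angle x y) * sin (angle z y)"
    using Cauchy_Schwarz_ineq2[of "x - cos (angle x y) *\<^sub>R y" "z - cos (angle z y) *\<^sub>R y"]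
    unfolding proj[OF u(1)] proj[OF u(3)] .
  moreover have "inner (x - cos (angle x y) *\<^sub>R y) (z - cos (angle z y) *\<^sub>R y)
      = inner x z - cos (angle x y) * cos (angle z y)"
    unfolding inner_diff_left inner_diff_right inner_scaleR_left inner_scaleR_right n
      cos_angle[OF u(1,2)] cos_angle[OF u(3,2)] inner_commute[of y z] by simp
  ultimately have "cos (angle x y + angle y z) \<le> inner x z"
    unfolding cos_add angle_commute[of y z] by linarith
  then have "arccos (inner x z) \<le> arccos (cos (angle x y + angle y z))"
    using unit_inner_bounds[OF u(1,3)] by (intro arccos_le_arccos) auto
  also have "\<dots> = angle x y + angle y z"
    using True angle_nonneg[OF u(1,2)] angle_nonneg[OF u(2,3)] by (intro arccos_cos) auto
  finally show ?thesis by (simp add: angle_def)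
next
  case False
  then show ?thesis using angle_le_pi[OF u(1,3)] by simp
qed

lemma chord_eq_sin:
  fixes x y :: "'h::real_inner"
  assumes u: "norm x = 1" "norm y = 1"
  shows "norm (x - y) = 2 * sin (angle x y / 2)"
proof (rule power2_eq_imp_eq)
  have n: "inner y y = 1" "inner x x = 1" using u by (simp_all add: power2_norm_eq_inner[symmetric])
  have "(norm (x - y))\<^sup>2 = 2 - 2 * cos (2 * (angle x y / 2))"
    unfolding power2_norm_eq_inner inner_diff_left inner_diff_right n inner_commute[of y x]
    using cos_angle[OF u] by simp
  also have "\<dots> = (2 * sin (angle x y / 2))\<^sup>2"
    unfolding cos_double_sin by (simp add: power_mult_distrib)
  finally show "(norm (x - y))\<^sup>2 = (2 * sin (angle x y / 2))\<^sup>2" .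
  show "0 \<le> 2 * sin (angle x y / 2)"
    using angle_nonneg[OF u] angle_le_pi[OF u] by (simp add: sin_ge_zero)
qed simp

lemma chord_le_angle:
  assumes u: "norm x = 1" "norm y = 1"
  shows "norm (x - y) \<le> angle x y"
  unfolding chord_eq_sin[OF u] using sin_x_le_x[of "angle x y / 2"] angle_nonneg[OF u] by simp

lemma angle_eq_arcsin:
  assumes u: "norm x = 1" "norm y = 1"
  shows "angle x y = 2 * arcsin (norm (x - y) / 2)"
proof -
  have "arcsin (sin (angle x y / 2)) = angle x y / 2"
    using angle_nonneg[OF u] angle_le_pi[OF u] by (intro arcsin_sin) auto
  then show ?thesis unfolding chord_eq_sin[OF u] by simp
qed

lemma angle_le_multiple_of_chord:
  assumes "e > 0"
  shows "\<exists>d>0. \<forall>x y :: 'h::real_inner. norm x = 1 \<longrightarrow> norm y = 1 \<longrightarrow> norm (x - y) < d \<longrightarrow>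
    angle x y \<le> (1 + e) * norm (x - y)"
proof -
  have "(*) 1 = (\<lambda>h::real. h)" by auto
  then have "(arcsin has_derivative (\<lambda>h. h)) (at 0)"
    using DERIV_arcsin[of 0] by (simp add: has_field_derivative_def)
  then obtain d where d: "d > 0" "\<And>t. \<bar>t\<bar> < d \<Longrightarrow> \<bar>arcsin t - t\<bar> \<le> e * \<bar>t\<bar>"
    using assms unfolding has_derivative_at_alt by (auto simp: real_norm_def)
  have "angle x y \<le> (1 + e) * norm (x - y)"
    if u: "norm x = 1" "norm y = 1" and n: "norm (x - y) < 2 * d" for x y :: 'h
  proof -
    define c where "c = norm (x - y) / 2"
    have c: "\<bar>c\<bar> = c" "\<bar>c\<bar> < d" using n by (simp_all add: c_def)
    have "arcsin c - c \<le> e * c" using d(2)[OF c(2)] c(1) by (simp only: abs_le_iff)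
    then have "arcsin (norm (x - y) / 2) - norm (x - y) / 2 \<le> e * (norm (x - y) / 2)"
      by (simp only: c_def)
    then show ?thesis unfolding angle_eq_arcsin[OF u] by (simp add: field_simps)
  qed
  then show ?thesis using d(1) by (intro exI[of _ "2 * d"]) auto
qed

text \<open>
  The chord between two points of a curve is at most the length of the curve between them. Angles
  exceed small chords only by a factor close to 1, so the bound follows from the triangle
  inequality for a fine subdivision.
\<close>

lemma angle_le_length:
  fixes \<gamma> :: "real \<Rightarrow> 'h::{real_inner, banach}"
  assumes ab: "a \<le> b" and D: "continuous_on {a..b} D"
    and \<gamma>: "\<And>t. t \<in> {a..b} \<Longrightarrow> (\<gamma> has_vector_derivative D t) (at t within {a..b})"
    and unit: "\<And>t. t \<in> {a..b} \<Longrightarrow> norm (\<gamma> t) = 1"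
  shows "angle (\<gamma> a) (\<gamma> b) \<le> integral {a..b} (\<lambda>t. norm (D t))"
proof -
  have int: "(\<lambda>t. norm (D t)) integrable_on {s..t}" if "a \<le> s" "t \<le> b" for s t
    using that by (intro integrable_continuous_interval continuous_on_norm continuous_on_subset[OF D]) auto
  have chord: "norm (\<gamma> t - \<gamma> s) \<le> integral {s..t} (\<lambda>t. norm (D t))" if st: "a \<le> s" "s \<le> t" "t \<le> b" for s t
  proof -
    have "(D has_integral (\<gamma> t - \<gamma> s)) {s..t}"
      using st by (intro fundamental_theorem_of_calculus)
        (auto intro!: has_vector_derivative_within_subset[OF \<gamma>])
    then show ?thesis
      using integral_norm_bound_integral[of D "{s..t}" "\<lambda>t. norm (D t)"] int[OF st(1,3)]
      by (auto simp: integral_unique has_integral_integrable)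
  qed
  let ?L = "integral {a..b} (\<lambda>t. norm (D t))"
  have approx: "angle (\<gamma> a) (\<gamma> b) \<le> (1 + e) * ?L" if e: "e > 0" for e
  proof -
    obtain d where d: "d > 0" "\<And>x y :: 'h. norm x = 1 \<Longrightarrow> norm y = 1 \<Longrightarrow> norm (x - y) < d \<Longrightarrow>
        angle x y \<le> (1 + e) * norm (x - y)"
      using angle_le_multiple_of_chord[OF e] by blast
    have "continuous_on {a..b} \<gamma>"
      using \<gamma> by (intro continuous_on_vector_derivative) auto
    then have "uniformly_continuous_on {a..b} \<gamma>" by (intro compact_uniformly_continuous) auto
    then obtain \<eta> where \<eta>: "\<eta> > 0" "\<And>s t. s \<in> {a..b} \<Longrightarrow> t \<in> {a..b} \<Longrightarrow> \<bar>t - s\<bar> < \<eta> \<Longrightarrow> norm (\<gamma> t - \<gamma> s) < d"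
      using d(1) unfolding uniformly_continuous_on_def dist_norm real_norm_def by blast
    obtain n :: nat where n: "(b - a) / \<eta> < real n" using reals_Archimedean2 by blast
    then have n0: "n > 0" using ab \<eta>(1) by (cases n) (auto simp: divide_less_0_iff)
    define h where "h = (b - a) / real n"
    have h: "0 \<le> h" "h < \<eta>" "real n * h = b - a"
      using n n0 ab \<eta>(1) by (auto simp: h_def field_simps)
    have "angle (\<gamma> a) (\<gamma> (a + real k * h)) \<le> (1 + e) * integral {a..a + real k * h} (\<lambda>t. norm (D t))"
      if "k \<le> n" for k
      using that
    proof (induction k)
      case 0
      have "norm (\<gamma> a) = 1" using unit ab by simp
      then show ?case by (simp add: angle_def power2_norm_eq_inner[symmetric])
    next
      case (Suc k)
      let ?s = "a + real k * h" and ?t = "a + real (Suc k) * h"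
      have "real (Suc k) * h \<le> real n * h" using Suc.prems h(1) by (intro mult_right_mono) auto
      then have st: "a \<le> ?s" "?s \<le> ?t" "?t \<le> b" "?t - ?s = h" using h by (auto simp: algebra_simps)
      have u: "norm (\<gamma> a) = 1" "norm (\<gamma> ?s) = 1" "norm (\<gamma> ?t) = 1" using st ab by (auto intro!: unit)
      have "angle (\<gamma> ?s) (\<gamma> ?t) \<le> (1 + e) * norm (\<gamma> ?s - \<gamma> ?t)"
        using \<eta>(2)[of ?s ?t] st h by (intro d u) (auto simp: norm_minus_commute)
      also have "\<dots> \<le> (1 + e) * integral {?s..?t} (\<lambda>t. norm (D t))"
        using chord[OF st(1,2,3)] e by (intro mult_left_mono) (auto simp: norm_minus_commute)
      finally have "angle (\<gamma> a) (\<gamma> ?t) \<le> (1 + e) * (integral {a..?s} (\<lambda>t. norm (D t)) + integral {?s..?t} (\<lambda>t. norm (D t)))"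
        using angle_triangle[OF u] Suc by (simp add: distrib_left)
      also have "integral {a..?s} (\<lambda>t. norm (D t)) + integral {?s..?t} (\<lambda>t. norm (D t)) = integral {a..?t} (\<lambda>t. norm (D t))"
        using st by (intro Henstock_Kurzweil_Integration.integral_combine int) auto
      finally show ?case .
    qed
    from this[of n] show ?thesis
      using h(3) by simp
  qed
  show ?thesis
  proof (rule field_le_epsilon)
    fix e :: real assume e: "e > 0"
    have L: "?L \<ge> 0" by (intro integral_nonneg int) auto
    have "angle (\<gamma> a) (\<gamma> b) \<le> (1 + e / (1 + ?L)) * ?L" using e L by (intro approx) auto
    also have "\<dots> = ?L + e * (?L / (1 + ?L))" by (simp add: algebra_simps)
    also have "\<dots> \<le> ?L + e * 1" using e L by (intro add_left_mono mult_left_mono) auto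
    finally show "angle (\<gamma> a) (\<gamma> b) \<le> ?L + e" by simp
  qed
qed

text \<open>The vector \<open>e\<close> supplies the direction when \<open>y = \<plusminus>x\<close>, where \<open>y\<close> does not determine the great circle.\<close>

lemma great_circle_direction:
  fixes x y :: "'h::real_inner"
  assumes u: "norm x = 1" "norm y = 1" and e: "norm e = 1" "inner x e = 0"
  shows "\<exists>u. norm u = 1 \<and> inner x u = 0 \<and> y = cos (angle x y) *\<^sub>R x + sin (angle x y) *\<^sub>R u"
proof -
  define w where "w = y - cos (angle x y) *\<^sub>R x"
  have n: "inner x x = 1" "inner y y = 1" using u by (simp_all add: power2_norm_eq_inner[symmetric])
  have s: "0 \<le> sin (angle x y)" using angle_nonneg[OF u] angle_le_pi[OF u] by (rule sin_ge_zero)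
  have w: "norm w = sin (angle x y)"
  proof (rule power2_eq_imp_eq[OF _ _ s])
    show "(norm w)\<^sup>2 = (sin (angle x y))\<^sup>2"
      unfolding power2_norm_eq_inner sin_squared_eq cos_angle[OF u] inner_diff_left inner_diff_right w_def
        inner_scaleR_left inner_scaleR_right n inner_commute[of y x] by (simp add: power2_eq_square)
  qed simp
  have xw: "inner x w = 0"
    unfolding w_def inner_diff_right inner_scaleR_right n cos_angle[OF u] by simp
  show ?thesis
  proof (cases "w = 0")
    case True
    then show ?thesis using w e by (intro exI[of _ e]) (simp add: w_def)
  next
    case False
    then show ?thesis using xw w[symmetric]
      by (intro exI[of _ "inverse (norm w) *\<^sub>R w"]) (simp add: w_def)
  qed
qed

lemma great_circle_norm:
  assumes "norm x = 1" "norm u = 1" "inner x u = 0"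
  shows "norm (cos t *\<^sub>R x + sin t *\<^sub>R u) = 1" "norm (- sin t *\<^sub>R x + cos t *\<^sub>R u) = 1"
proof -
  have n: "inner x x = 1" "inner u u = 1" using assms by (simp_all add: power2_norm_eq_inner[symmetric])
  have "(norm (a *\<^sub>R x + b *\<^sub>R u))\<^sup>2 = a\<^sup>2 + b\<^sup>2" for a b
    unfolding power2_norm_eq_inner inner_add_left inner_add_right inner_scaleR_left inner_scaleR_right
      inner_commute[of u x] n assms(3) by (simp add: power2_eq_square)
  then have "(norm (cos t *\<^sub>R x + sin t *\<^sub>R u))\<^sup>2 = 1\<^sup>2" "(norm (- sin t *\<^sub>R x + cos t *\<^sub>R u))\<^sup>2 = 1\<^sup>2"
    by (simp_all del: scaleR_minus_left)
  then show "norm (cos t *\<^sub>R x + sin t *\<^sub>R u) = 1" "norm (- sin t *\<^sub>R x + cos t *\<^sub>R u) = 1"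
    by (auto simp only: power2_eq_iff_nonneg norm_ge_zero zero_le_one)
qed

section \<open>Quotients of the sphere by uniformly free isometric actions\<close>

text \<open>
  The last condition says that the action is free and that every orbit is uniformly discrete: by
  isometry, any two points of the orbit of \<open>x\<close> are at least \<open>e\<close> apart.
\<close>

locale sphere_quotient = sphere_projection T N + group G
  for T :: "'h::{real_inner, banach} \<Rightarrow> 'h" and N :: 'h and G :: "('g, 'm) monoid_scheme" (structure) +
  fixes \<rho> :: "'g \<Rightarrow> 'h \<Rightarrow> 'h"
  assumes \<rho>_isometry: "g \<in> carrier G \<Longrightarrow> linear_isometry (\<rho> g)"
    and \<rho>_one: "\<rho> \<one> x = x"
    and \<rho>_mult: "g \<in> carrier G \<Longrightarrow> h \<in> carrier G \<Longrightarrow> \<rho> (g \<otimes> h) x = \<rho> g (\<rho> h x)"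
    and displacement: "norm x = 1 \<Longrightarrow> \<exists>e>0. \<forall>g\<in>carrier G. g \<noteq> \<one> \<longrightarrow> e \<le> norm (\<rho> g x - x)"
begin

subsection \<open>Orbits and their separation\<close>

definition orbit :: "'h \<Rightarrow> 'h set" where
  "orbit x = (\<lambda>g. \<rho> g x) ` carrier G"

definition orbits :: "'h set set" where
  "orbits = orbit ` sphere 0 1"

lemma \<rho>_norm: "g \<in> carrier G \<Longrightarrow> norm (\<rho> g x) = norm x"
  using linear_isometry_norm \<rho>_isometry by blast

lemma \<rho>_diff: "g \<in> carrier G \<Longrightarrow> \<rho> g (x - y) = \<rho> g x - \<rho> g y"
  using linear_isometry_diff \<rho>_isometry by blast

lemma \<rho>_dist: "g \<in> carrier G \<Longrightarrow> norm (\<rho> g x - \<rho> g y) = norm (x - y)"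
  using \<rho>_diff \<rho>_norm by metis

lemma \<rho>_inverse: "g \<in> carrier G \<Longrightarrow> \<rho> (m_inv G g) (\<rho> g x) = x" "g \<in> carrier G \<Longrightarrow> \<rho> g (\<rho> (m_inv G g) x) = x"
  by (simp_all add: \<rho>_mult[symmetric] \<rho>_one)

lemma self_in_orbit: "x \<in> orbit x"
  unfolding orbit_def using \<rho>_one[of x] by (metis image_eqI one_closed)

lemma orbit_\<rho>: 
  assumes g: "g \<in> carrier G"
  shows "orbit (\<rho> g x) = orbit x"
proof
  show "orbit (\<rho> g x) \<subseteq> orbit x"
    using g by (auto simp: orbit_def \<rho>_mult[symmetric])
  show "orbit x \<subseteq> orbit (\<rho> g x)"
  proof
    fix z assume "z \<in> orbit x"
    then obtain h where h: "h \<in> carrier G" "z = \<rho> h x" by (auto simp: orbit_def)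
    then have "z = \<rho> (h \<otimes> m_inv G g) (\<rho> g x)" using g by (simp add: \<rho>_mult \<rho>_inverse)
    moreover have "h \<otimes> m_inv G g \<in> carrier G" using g h by simp
    ultimately show "z \<in> orbit (\<rho> g x)" unfolding orbit_def by (rule image_eqI)
  qed
qed

lemma orbit_eq_iff: "orbit x = orbit y \<longleftrightarrow> (\<exists>g\<in>carrier G. x = \<rho> g y)"
proof
  assume "orbit x = orbit y"
  then have "x \<in> orbit y" using self_in_orbit[of x] by simp
  then show "\<exists>g\<in>carrier G. x = \<rho> g y" by (auto simp: orbit_def)
qed (auto simp: orbit_\<rho>)

lemma orbit_norm: "norm x = 1 \<Longrightarrow> y \<in> orbit x \<Longrightarrow> norm y = 1"
  by (auto simp: orbit_def \<rho>_norm)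

lemma orbits_E:
  assumes "p \<in> orbits"
  obtains x where "norm x = 1" "p = orbit x"
  using assms by (auto simp: orbits_def)

lemma orbit_in_orbits: "norm x = 1 \<Longrightarrow> orbit x \<in> orbits"
  by (simp add: orbits_def)

lemma orbits_member:
  assumes "p \<in> orbits"
  shows "x \<in> p \<longleftrightarrow> norm x = 1 \<and> orbit x = p"
proof -
  obtain y where y: "norm y = 1" "p = orbit y" using assms by (rule orbits_E)
  have "x \<in> orbit y \<longleftrightarrow> orbit x = orbit y" unfolding orbit_eq_iff by (auto simp: orbit_def)
  then show ?thesis using y orbit_norm by auto
qed

lemma free_action:
  assumes "norm x = 1" "g \<in> carrier G" "h \<in> carrier G" "\<rho> g x = \<rho> h x"
  shows "g = h"
proof -
  have "\<rho> (m_inv G h \<otimes> g) x = x" using assms by (simp add: \<rho>_mult \<rho>_inverse)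
  then have "m_inv G h \<otimes> g = \<one>" using displacement[OF assms(1)] assms by fastforce
  then show ?thesis using assms(2,3) by (metis inv_closed inv_equality inv_inv)
qed

lemma orbit_separated:
  assumes "norm x = 1"
  shows "\<exists>e>0. \<forall>g\<in>carrier G. \<forall>h\<in>carrier G. norm (\<rho> g x - \<rho> h x) < e \<longrightarrow> g = h"
proof -
  obtain e where e: "e > 0" "\<And>g. g \<in> carrier G \<Longrightarrow> g \<noteq> \<one> \<Longrightarrow> e \<le> norm (\<rho> g x - x)"
    using displacement[OF assms] by blast
  have "g = h" if gh: "g \<in> carrier G" "h \<in> carrier G" and n: "norm (\<rho> g x - \<rho> h x) < e" for g h
  proof -
    have "norm (\<rho> (m_inv G h \<otimes> g) x - x) = norm (\<rho> (m_inv G h) (\<rho> g x) - \<rho> (m_inv G h) (\<rho> h x))"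
      using gh by (simp add: \<rho>_mult \<rho>_inverse)
    also have "\<dots> < e" using n gh by (simp add: \<rho>_dist)
    finally have "m_inv G h \<otimes> g = \<one>" using e(2)[of "m_inv G h \<otimes> g"] gh by fastforce
    then show ?thesis using gh by (metis inv_closed inv_equality inv_inv)
  qed
  then show ?thesis using e(1) by blast
qed

text \<open>Uniformly discrete sets are closed.\<close>

lemma in_orbit_if_arbitrarily_close:
  assumes y: "norm y = 1" and close: "\<And>d. d > 0 \<Longrightarrow> \<exists>g\<in>carrier G. norm (x - \<rho> g y) < d"
  shows "\<exists>g\<in>carrier G. x = \<rho> g y"
proof -
  obtain e where e: "e > 0" "\<And>g h. g \<in> carrier G \<Longrightarrow> h \<in> carrier G \<Longrightarrow> norm (\<rho> g y - \<rho> h y) < e \<Longrightarrow> g = h"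
    using orbit_separated[OF y] by blast
  obtain g where g: "g \<in> carrier G" "norm (x - \<rho> g y) < e / 2"
    using close[of "e / 2"] e(1) by auto
  have "norm (x - \<rho> g y) < d" if d: "d > 0" for d
  proof -
    obtain h where h: "h \<in> carrier G" "norm (x - \<rho> h y) < min d (e / 2)"
      using close[of "min d (e / 2)"] e(1) d by auto
    have "norm (\<rho> g y - \<rho> h y) \<le> norm (x - \<rho> g y) + norm (x - \<rho> h y)"
      using norm_triangle_ineq4[of "x - \<rho> h y" "x - \<rho> g y"] by simp
    then have "g = h" using g h by (intro e(2)) auto
    then show ?thesis using h by simp
  qed
  from this[of "norm (x - \<rho> g y)"] have "norm (x - \<rho> g y) \<le> 0" by (meson not_le less_irrefl)
  then show ?thesis using g(1) by auto
qed

text \<open>The ball around \<open>x\<close> is disjoint from its translates: this makes small patches inject into the quotient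
  and the projection a covering map.\<close>

lemma wandering_neighbourhood:
  assumes "norm x = 1"
  shows "\<exists>e>0. \<forall>y z. \<forall>g\<in>carrier G. norm (y - x) < e \<longrightarrow> norm (z - x) < e \<longrightarrow> z = \<rho> g y \<longrightarrow> g = \<one>"
proof -
  obtain e where e: "e > 0" "\<And>g. g \<in> carrier G \<Longrightarrow> g \<noteq> \<one> \<Longrightarrow> e \<le> norm (\<rho> g x - x)"
    using displacement[OF assms] by blast
  have "g = \<one>" if g: "g \<in> carrier G" and n: "norm (y - x) < e / 2" "norm (z - x) < e / 2" "z = \<rho> g y" for y z g
  proof (rule ccontr)
    assume "g \<noteq> \<one>"
    then have "e \<le> norm (\<rho> g x - x)" using e(2) g by blast
    also have "\<dots> \<le> norm (\<rho> g x - \<rho> g y) + norm (z - x)"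
      using norm_triangle_ineq[of "\<rho> g x - \<rho> g y" "z - x"] n(3) by simp
    also have "norm (\<rho> g x - \<rho> g y) = norm (y - x)" using g by (simp add: \<rho>_dist norm_minus_commute)
    finally show False using n by simp
  qed
  then show ?thesis using e(1) by (intro exI[of _ "e / 2"]) auto
qed

subsection \<open>The quotient topology\<close>

text \<open>
  Orbits are told apart by their distance functions. Truncated at 2, these are bounded, and the
  supremum norm of their difference is small exactly if the orbits are close. This embeds the
  quotient into a normed space, where the theory of covering spaces applies to it.
\<close>

definition orbit_distance :: "'h set \<Rightarrow> 'h \<Rightarrow>\<^sub>C real" where
  "orbit_distance p = Bcontfun (\<lambda>y. min 2 (infdist y p))"

definition quotient_topology :: "'h set topology" where
  "quotient_topology = pullback_topology orbits orbit_distance euclidean"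

lemma apply_orbit_distance: "apply_bcontfun (orbit_distance p) y = min 2 (infdist y p)"
proof -
  have "(\<lambda>y. min 2 (infdist y p)) \<in> bcontfun"
    unfolding bcontfun_def
    by (auto intro!: continuous_intros boundedI[of _ 2] simp: infdist_nonneg)
  then show ?thesis unfolding orbit_distance_def by (simp add: Bcontfun_inverse)
qed

lemma topspace_quotient [simp]: "topspace quotient_topology = orbits"
  by (simp add: quotient_topology_def topspace_pullback_topology)

lemma infdist_orbit_le: "infdist z (orbit x) \<le> infdist z (orbit y) + norm (x - y)"
proof -
  have "infdist z (orbit x) - norm (x - y) \<le> infdist z (orbit y)"
  proof -
    have ne: "orbit y \<noteq> {}" using self_in_orbit[of y] by blast
    have "infdist z (orbit x) - norm (x - y) \<le> dist z a" if a: "a \<in> orbit y" for a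
    proof -
      obtain g where g: "g \<in> carrier G" "a = \<rho> g y" using a by (auto simp: orbit_def)
      have "infdist z (orbit x) \<le> dist z (\<rho> g x)" using g by (intro infdist_le) (auto simp: orbit_def)
      also have "\<dots> \<le> dist z a + dist a (\<rho> g x)" by (rule dist_triangle)
      also have "dist a (\<rho> g x) = norm (x - y)"
        using g \<rho>_dist[of g y x] by (simp add: dist_norm norm_minus_commute)
      finally show ?thesis by simp
    qed
    then show ?thesis unfolding infdist_notempty[OF ne] by (intro cINF_greatest ne)
  qed
  then show ?thesis by simp
qed

lemma orbit_distance_lipschitz: "dist (orbit_distance (orbit x)) (orbit_distance (orbit y)) \<le> norm (x - y)"
proof (rule dist_bound)
  fix z
  show "dist (apply_bcontfun (orbit_distance (orbit x)) z) (apply_bcontfun (orbit_distance (orbit y)) z) \<le> norm (x - y)"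
    unfolding apply_orbit_distance dist_real_def
    using infdist_orbit_le[of z x y] infdist_orbit_le[of z y x] norm_minus_commute[of x y]
    by (auto simp: min_def abs_le_iff)
qed

text \<open>Evaluate both distance functions at \<open>x\<close>, where the first one vanishes.\<close>

lemma orbit_distance_close:
  assumes d: "dist (orbit_distance (orbit x)) (orbit_distance (orbit y)) < d" and "d \<le> 1"
  shows "\<exists>g\<in>carrier G. norm (x - \<rho> g y) < d"
proof -
  have ne: "orbit y \<noteq> {}" using self_in_orbit[of y] by blast
  have "dist (apply_bcontfun (orbit_distance (orbit x)) x) (apply_bcontfun (orbit_distance (orbit y)) x) < d"
    using dist_bounded d by (rule le_less_trans)
  moreover have "infdist x (orbit x) = 0" using self_in_orbit by (rule infdist_zero)
  ultimately have "infdist x (orbit y) < d"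
    using \<open>d \<le> 1\<close> infdist_nonneg[of x "orbit y"] by (auto simp: apply_orbit_distance dist_real_def min_def split: if_splits)
  then obtain a where "a \<in> orbit y" "dist x a < d"
    unfolding infdist_notempty[OF ne] using cINF_less_iff[OF ne, of "dist x" d] by (auto intro: bdd_belowI2[of _ 0])
  then show ?thesis by (auto simp: orbit_def dist_norm)
qed

lemma inj_orbit_distance: "inj_on orbit_distance orbits"
proof (rule inj_onI)
  fix p q assume pq: "p \<in> orbits" "q \<in> orbits" and e: "orbit_distance p = orbit_distance q"
  obtain x y where x: "norm x = 1" "p = orbit x" and y: "norm y = 1" "q = orbit y"
    using pq orbits_E by metis
  have "\<exists>g\<in>carrier G. x = \<rho> g y"
  proof (rule in_orbit_if_arbitrarily_close[OF y(1)])
    fix d :: real assume "d > 0"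
    then have "\<exists>g\<in>carrier G. norm (x - \<rho> g y) < min d 1"
      using e x y by (intro orbit_distance_close) auto
    then show "\<exists>g\<in>carrier G. norm (x - \<rho> g y) < d" by auto
  qed
  then show "p = q" using x y orbit_eq_iff by blast
qed

lemma openin_quotientI:
  assumes S: "S \<subseteq> orbits"
    and nb: "\<And>p. p \<in> S \<Longrightarrow> \<exists>d>0. \<forall>q\<in>orbits. dist (orbit_distance p) (orbit_distance q) < d \<longrightarrow> q \<in> S"
  shows "openin quotient_topology S"
proof -
  obtain d where d: "\<And>p. p \<in> S \<Longrightarrow> d p > 0"
      "\<And>p q. p \<in> S \<Longrightarrow> q \<in> orbits \<Longrightarrow> dist (orbit_distance p) (orbit_distance q) < d p \<Longrightarrow> q \<in> S"
    using nb by metis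
  let ?U = "\<Union>p\<in>S. ball (orbit_distance p) (d p)"
  have "S = orbit_distance -` ?U \<inter> orbits"
  proof (intro equalityI subsetI)
    fix p assume "p \<in> S"
    then show "p \<in> orbit_distance -` ?U \<inter> orbits" using S d(1)[of p] by (auto intro!: bexI[of _ p])
  next
    fix p assume "p \<in> orbit_distance -` ?U \<inter> orbits"
    then show "p \<in> S" using d(2) by auto
  qed
  moreover have "open ?U" by auto
  ultimately show ?thesis unfolding quotient_topology_def openin_pullback_topology by (metis open_openin)
qed

lemma continuous_map_orbit: "continuous_map (top_of_set (sphere 0 1)) quotient_topology orbit"
  unfolding quotient_topology_def
proof (rule continuous_map_pullback')
  have "continuous_on (sphere 0 1) (orbit_distance \<circ> orbit)"
    unfolding continuous_on_iff
    using orbit_distance_lipschitz by (auto simp: dist_norm intro: le_less_trans)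
  then show "continuous_map (top_of_set (sphere 0 1)) euclidean (orbit_distance \<circ> orbit)" by simp
qed (auto simp: orbits_def)

lemma open_map_orbit: "open_map (top_of_set (sphere 0 1)) quotient_topology orbit"
  unfolding open_map_def
proof (intro allI impI)
  fix V :: "'h set" assume V: "openin (top_of_set (sphere 0 1)) V"
  then have VS: "V \<subseteq> sphere 0 1" by (rule openin_imp_subset)
  show "openin quotient_topology (orbit ` V)"
  proof (rule openin_quotientI)
    show "orbit ` V \<subseteq> orbits" using VS by (auto simp: orbits_def)
    fix p assume "p \<in> orbit ` V"
    then obtain x where x: "x \<in> V" "p = orbit x" by blast
    then obtain e where e: "e > 0" "\<And>y. norm y = 1 \<Longrightarrow> dist y x < e \<Longrightarrow> y \<in> V"
      using V unfolding openin_euclidean_subtopology_iff by (auto simp: Ball_def)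
    have "q \<in> orbit ` V" if q: "q \<in> orbits" "dist (orbit_distance p) (orbit_distance q) < min e 1" for q
    proof -
      obtain y where y: "norm y = 1" "q = orbit y" using q(1) by (rule orbits_E)
      obtain g where g: "g \<in> carrier G" "norm (x - \<rho> g y) < min e 1"
        using orbit_distance_close[of x y "min e 1"] q(2) x y by auto
      then have "\<rho> g y \<in> V" using y by (intro e) (auto simp: \<rho>_norm dist_norm norm_minus_commute)
      then show ?thesis using orbit_\<rho>[OF g(1), of y] y by blast
    qed
    then show "\<exists>d>0. \<forall>q\<in>orbits. dist (orbit_distance p) (orbit_distance q) < d \<longrightarrow> q \<in> orbit ` V"
      using e(1) by (intro exI[of _ "min e 1"]) auto
  qed
qed

lemma Hausdorff_quotient: "Hausdorff_space quotient_topology"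
  unfolding Hausdorff_space_def
proof (intro allI impI)
  fix p q assume pq: "p \<in> topspace quotient_topology \<and> q \<in> topspace quotient_topology \<and> p \<noteq> q"
  then have "orbit_distance p \<noteq> orbit_distance q" using inj_orbit_distance by (auto simp: inj_on_def)
  then obtain U V where UV: "open U" "open V" "orbit_distance p \<in> U" "orbit_distance q \<in> V" "U \<inter> V = {}"
    using separation_t2 by metis
  have "openin quotient_topology (orbit_distance -` W \<inter> orbits)" if "open W" for W
    using that unfolding quotient_topology_def openin_pullback_topology by auto
  then show "\<exists>U V. openin quotient_topology U \<and> openin quotient_topology V \<and> p \<in> U \<and> q \<in> V \<and> disjnt U V"
    using UV pq by (intro exI[of _ "orbit_distance -` U \<inter> orbits"] exI[of _ "orbit_distance -` V \<inter> orbits"])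
      (auto simp: disjnt_def)
qed

lemma connected_quotient: "connected_space quotient_topology"
proof -
  have "connected_space (top_of_set (sphere 0 1 :: 'h set))"
    using contractible_imp_connected[OF contractible_sphere] 
    by (metis connectedin_def connectedin_iff_connected)
  then show ?thesis
    by (rule connected_space_quotient_map_image[rotated])
       (rule continuous_open_imp_quotient_map[OF continuous_map_orbit open_map_orbit], simp add: orbits_def)
qed

subsection \<open>The atlas\<close>

definition patch :: "('h \<Rightarrow> 'h) \<Rightarrow> 'h \<Rightarrow> 'h set" where
  "patch W x = orbit (W (stereo x))"

text \<open>
  Every stereographic patch that injects into the quotient is a chart, wherever a linear isometry
  \<open>W\<close> places it; with all of them in the atlas no centres have to be selected.
\<close>

definition chart_data :: "('h \<Rightarrow> 'h) \<Rightarrow> real \<Rightarrow> bool" where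
  "chart_data W r \<longleftrightarrow> linear_isometry W \<and> surj W \<and> r > 0 \<and> inj_on (patch W) (ball 0 r)"

definition atlas :: "('h set, 'h) chart set" where
  "atlas = {(patch W ` ball 0 r, inv_into (ball 0 r) (patch W)) | W r. chart_data W r}"

definition represents :: "('h \<Rightarrow> 'h) \<Rightarrow> real \<Rightarrow> ('h set, 'h) chart \<Rightarrow> bool" where
  "represents W r c \<longleftrightarrow> chart_data W r \<and> c = (patch W ` ball 0 r, inv_into (ball 0 r) (patch W))"

lemma atlas_E: assumes "c \<in> atlas" obtains W r where "represents W r c"
  using assms by (auto simp: atlas_def represents_def)

lemma represents_atlas: "represents W r c \<Longrightarrow> c \<in> atlas"
  by (auto simp: atlas_def represents_def)

lemma chart_data_isometry: "chart_data W r \<Longrightarrow> linear_isometry W"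
  by (simp add: chart_data_def)

lemma patch_in_orbits: "linear_isometry W \<Longrightarrow> patch W x \<in> orbits"
  by (auto simp: patch_def linear_isometry_norm intro!: orbit_in_orbits)

lemma open_placed_stereo:
  fixes W :: "'h \<Rightarrow> 'h"
  assumes W: "linear_isometry W" "surj W" and U: "open U"
  shows "openin (top_of_set (sphere 0 1)) ((\<lambda>x. W (stereo x)) ` U)"
proof -
  let ?W' = "inv_into UNIV W"
  note W' = linear_isometry_inverse[OF W]
  have nW: "norm (W x) = norm x" "norm (?W' x) = norm x" for x
    using linear_isometry_norm W linear_isometry_inv by metis+
  have "openin (top_of_set (sphere 0 1 - {W N})) ((sphere 0 1 - {W N}) \<inter> (\<lambda>y. stereo_inv (?W' y)) -` U)"
  proof (rule continuous_openin_preimage_gen[OF _ U])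
    have "?W' ` (sphere 0 1 - {W N}) \<subseteq> sphere 0 1 - {N}" using nW W' by (auto)
    then show "continuous_on (sphere 0 1 - {W N}) (\<lambda>y. stereo_inv (?W' y))"
      by (intro continuous_on_compose2[OF continuous_on_stereo_inv] linear_continuous_on
          linear_isometry_bounded_linear linear_isometry_inv W)
  qed
  moreover have "(sphere 0 1 - {W N}) \<inter> (\<lambda>y. stereo_inv (?W' y)) -` U = (\<lambda>x. W (stereo x)) ` U"
  proof -
    have "\<exists>x\<in>U. y = W (stereo x)" if y: "norm y = 1" "y \<noteq> W N" "stereo_inv (?W' y) \<in> U" for y
      using y stereo_stereo_inv[of "?W' y"] W'(2)[of y] nW by (metis)
    moreover have "W (stereo x) \<noteq> W N" for x
      using linear_isometry_inj[OF W(1)] stereo_N[of x] N_N by (metis conformal_factor_nz diff_eq_eq add_cancel_right_right)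
    ultimately show ?thesis
    proof (intro equalityI subsetI, goal_cases)
      case (1 y)
      then show ?case by auto
    next
      case (2 y)
      then show ?case by (auto simp: nW W' stereo_inv_stereo)
    qed
  qed
  moreover have "openin (top_of_set (sphere 0 1)) (sphere 0 1 - {W N})"
    by (rule openin_delete) simp
  ultimately show ?thesis using openin_trans by metis
qed

context
  fixes W r c
  assumes c: "represents W r c"
begin

lemma represents_isometry: "linear_isometry W" "surj W" "r > 0" "inj_on (patch W) (ball 0 r)"
  using c by (auto simp: represents_def chart_data_def)

lemma chart_domain: "fst c = patch W ` ball 0 r"
  using c by (simp add: represents_def)

lemma chart_of_patch: "x \<in> ball 0 r \<Longrightarrow> snd c (patch W x) = x"
  using c represents_isometry(4) by (simp add: represents_def inv_into_f_f)

lemma chart_in_ball: "p \<in> fst c \<Longrightarrow> snd c p \<in> ball 0 r"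
  using chart_domain chart_of_patch by auto

lemma patch_of_chart: "p \<in> fst c \<Longrightarrow> patch W (snd c p) = p"
  using chart_domain chart_of_patch by auto

lemma chart_range: "snd c ` fst c = ball 0 r"
  unfolding chart_domain image_image using chart_of_patch by simp

lemma chart_inj: "inj_on (snd c) (fst c)"
  using patch_of_chart by (metis inj_onI)

lemma chart_inv_eq: "x \<in> ball 0 r \<Longrightarrow> chart_inv c x = patch W x"
  unfolding chart_inv_def using chart_inj chart_of_patch chart_domain
  by (intro inv_into_f_eq) auto

lemma transition_eq: "x \<in> ball 0 r \<Longrightarrow> transition c c' x = snd c' (patch W x)"
  by (simp add: transition_def chart_inv_eq)

lemma openin_chart_domain: "openin quotient_topology (fst c)"
  and chart_homeomorphism:
    "homeomorphic_map (subtopology quotient_topology (fst c)) (top_of_set (snd c ` fst c)) (snd c)"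
proof -
  have W: "linear_isometry W" "surj W" using represents_isometry by auto
  have nW: "norm (W x) = norm x" for x by (rule linear_isometry_norm[OF W(1)])
  note op = open_placed_stereo[OF W]
  have opQ: "openin quotient_topology (patch W ` U)" if "open U" for U
  proof -
    have "patch W ` U = orbit ` ((\<lambda>x. W (stereo x)) ` U)" by (auto simp: patch_def)
    then show ?thesis using op[OF that] open_map_orbit by (simp add: open_map_def)
  qed
  show dom: "openin quotient_topology (fst c)" unfolding chart_domain by (rule opQ) simp
  have "continuous_map (top_of_set (ball 0 r)) (top_of_set (sphere 0 1)) (\<lambda>x. W (stereo x))"
    using continuous_on_stereo
    by (auto simp: nW intro!: continuous_on_compose2[OF linear_continuous_on[OF linear_isometry_bounded_linear[OF W(1)]]])
  from continuous_map_compose[OF this continuous_map_orbit]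
  have contQ: "continuous_map (top_of_set (ball 0 r)) quotient_topology (patch W)"
    by (simp add: o_def patch_def[abs_def])
  have hQ: "homeomorphic_map (top_of_set (ball 0 r)) (subtopology quotient_topology (fst c)) (patch W)"
  proof (rule bijective_open_imp_homeomorphic_map)
    show "continuous_map (top_of_set (ball 0 r)) (subtopology quotient_topology (fst c)) (patch W)"
      using contQ by (auto simp: continuous_map_in_subtopology chart_domain)
    show "open_map (top_of_set (ball 0 r)) (subtopology quotient_topology (fst c)) (patch W)"
      unfolding open_map_def openin_open_subtopology[OF dom] using opQ chart_domain
      by (auto simp: openin_open_eq)
    show "patch W ` topspace (top_of_set (ball 0 r)) = topspace (subtopology quotient_topology (fst c))"
      using openin_subset[OF dom] by (auto simp: chart_domain)
    show "inj_on (patch W) (topspace (top_of_set (ball 0 r)))"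
      using represents_isometry by simp
  qed
  then obtain k where k: "homeomorphic_maps (top_of_set (ball 0 r)) (subtopology quotient_topology (fst c)) (patch W) k"
    using homeomorphic_map_maps by blast
  then have "homeomorphic_map (subtopology quotient_topology (fst c)) (top_of_set (ball 0 r)) k"
    by (simp add: homeomorphic_maps_map)
  then have "homeomorphic_map (subtopology quotient_topology (fst c)) (top_of_set (ball 0 r)) (snd c)"
  proof (rule homeomorphic_map_eq)
    fix p assume "p \<in> topspace (subtopology quotient_topology (fst c))"
    then obtain x where "x \<in> ball 0 r" "p = patch W x" using chart_domain by auto
    then show "k p = snd c p" using k chart_of_patch by (auto simp: homeomorphic_maps_def)
  qed
  then show "homeomorphic_map (subtopology quotient_topology (fst c)) (top_of_set (snd c ` fst c)) (snd c)"
    by (simp add: chart_range)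
qed

end

lemma stereo_near_0: "norm (stereo x - stereo 0) \<le> 2 * norm x"
proof -
  have "conformal_factor x * conformal_factor 0 \<le> 2 * 2"
    by (intro mult_mono) (auto simp: conformal_factor_def divide_le_eq)
  then have "(norm (stereo x - stereo 0))\<^sup>2 \<le> (2 * norm x)\<^sup>2"
    unfolding stereo_chord using mult_right_mono[of _ 4 "(norm x)\<^sup>2"] by (simp add: power_mult_distrib)
  then show ?thesis by (rule power2_le_imp_le) simp
qed

text \<open>Since \<open>stereo 0 = - N\<close>, an isometry that takes \<open>- N\<close> to \<open>x\<close> centres the patch at \<open>x\<close>.\<close>

lemma chart_around:
  assumes x: "norm x = 1"
  shows "\<exists>W r. chart_data W r \<and> W (stereo 0) = x"
proof -
  have "norm (- N) = 1" by (simp add: N_unit)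
  then obtain W :: "'h \<Rightarrow> 'h" where W: "linear_isometry W" "surj W" "W (- N) = x"
    using linear_isometry_transitive x by blast
  obtain e where e: "e > 0" "\<And>y z g. g \<in> carrier G \<Longrightarrow> norm (y - x) < e \<Longrightarrow> norm (z - x) < e \<Longrightarrow> z = \<rho> g y \<Longrightarrow> g = \<one>"
    using wandering_neighbourhood[OF x] by blast
  have near: "norm (W (stereo y) - x) < e" if "y \<in> ball 0 (e / 2)" for y
  proof -
    have "norm (W (stereo y) - x) = norm (stereo y - stereo 0)"
      using linear_isometry_diff[OF W(1), of "stereo y" "- N"] linear_isometry_norm[OF W(1)] W(3)
      by (metis stereo_0)
    also have "\<dots> \<le> 2 * norm y" by (rule stereo_near_0)
    finally show ?thesis using that by simp
  qed
  have "y = z" if yz: "y \<in> ball 0 (e / 2)" "z \<in> ball 0 (e / 2)" and eq: "patch W y = patch W z" for y z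
  proof -
    obtain g where g: "g \<in> carrier G" "W (stereo y) = \<rho> g (W (stereo z))"
      using eq by (auto simp: patch_def orbit_eq_iff)
    then have "g = \<one>" using e(2)[OF g(1)] near yz by blast
    then have "W (stereo y) = W (stereo z)" using g by (simp add: \<rho>_one)
    then show ?thesis by (simp add: linear_isometry_inj[OF W(1)] stereo_inj)
  qed
  then have "chart_data W (e / 2)" using W e(1) by (auto simp: chart_data_def inj_on_def)
  then show ?thesis using W(3) stereo_0 by auto
qed

lemma atlas_covers: "(\<Union>c\<in>atlas. fst c) = orbits"
proof
  show "(\<Union>c\<in>atlas. fst c) \<subseteq> orbits"
    by (auto simp: atlas_def patch_in_orbits chart_data_isometry)
  show "orbits \<subseteq> (\<Union>c\<in>atlas. fst c)"
  proof
    fix p assume "p \<in> orbits"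
    then obtain x where x: "norm x = 1" "p = orbit x" by (rule orbits_E)
    obtain W r where W: "chart_data W r" "W (stereo 0) = x" using chart_around[OF x(1)] by blast
    then have "p \<in> patch W ` ball 0 r" using x by (auto simp: patch_def chart_data_def intro!: image_eqI[of _ _ 0])
    moreover have "(patch W ` ball 0 r, inv_into (ball 0 r) (patch W)) \<in> atlas"
      using W(1) unfolding atlas_def by blast
    ultimately show "p \<in> (\<Union>c\<in>atlas. fst c)" by (intro UN_I) auto
  qed
qed

text \<open>
  On each piece of the overlap of two charts the transition map is the stereographic expression of
  one isometry of the sphere: the two lifts of a point differ by an element of the group, which
  is locally constant because the action is free.
\<close>

definition overlap :: "('h set, 'h) chart \<Rightarrow> ('h set, 'h) chart \<Rightarrow> 'h set" where
  "overlap c c' = snd c ` (fst c \<inter> fst c')"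

lemma overlap_iff:
  assumes "represents W r c"
  shows "x \<in> overlap c c' \<longleftrightarrow> x \<in> ball 0 r \<and> patch W x \<in> fst c'"
  using assms unfolding overlap_def by (auto simp: chart_of_patch patch_of_chart chart_in_ball chart_domain intro!: image_eqI)

lemma transition_locally:
  assumes c: "represents W r c" and c': "represents W' r' c'"
  shows "\<exists>idx. \<forall>x\<in>overlap c c'. idx x \<in> carrier G \<and>
    stereo (transition c c' x) = inv_into UNIV W' (\<rho> (idx x) (W (stereo x))) \<and>
    (\<exists>d>0. \<forall>y. norm (y - x) < d \<longrightarrow> y \<in> overlap c c' \<and> idx y = idx x)"
proof -
  let ?W' = "inv_into UNIV W'"
  let ?good = "\<lambda>x g. g \<in> carrier G \<and> W' (stereo (transition c c' x)) = \<rho> g (W (stereo x))"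
  \<comment> \<open>the group element between the lifts of the common point to the two patches\<close>
  define idx where "idx x = (SOME g. ?good x g)" for x
  have W: "linear_isometry W" and W': "linear_isometry W'" "surj W'"
    using represents_isometry c c' by auto
  note inv = linear_isometry_inverse[OF W']
  have nrm: "norm (W (stereo x)) = 1" for x using linear_isometry_norm[OF W] by simp
  have tr: "transition c c' x \<in> ball 0 r'" "patch W' (transition c c' x) = patch W x" if "x \<in> overlap c c'" for x
  proof -
    have x: "x \<in> ball 0 r" "patch W x \<in> fst c'" using that unfolding overlap_iff[OF c] by auto
    show "transition c c' x \<in> ball 0 r'" "patch W' (transition c c' x) = patch W x"
      unfolding transition_eq[OF c x(1)] by (rule chart_in_ball[OF c' x(2)], rule patch_of_chart[OF c' x(2)])
  qed
  have ex: "\<exists>g. ?good x g" if "x \<in> overlap c c'" for x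
    using tr(2)[OF that] unfolding patch_def orbit_eq_iff by blast
  have good: "?good x (idx x)" if "x \<in> overlap c c'" for x
    unfolding idx_def by (rule someI_ex[OF ex[OF that]])
  have uniq: "g = idx x" if "x \<in> overlap c c'" "?good x g" for x g
    using good[OF that(1)] that(2) by (intro free_action[OF nrm[of x]]) auto
  have loc: "\<exists>d>0. \<forall>y. norm (y - x) < d \<longrightarrow> y \<in> overlap c c' \<and> idx y = idx x" if x: "x \<in> overlap c c'" for x
  proof -
    let ?g = "idx x"
    define V where "V = ?W' \<circ> (\<rho> ?g \<circ> W)"
    have V: "linear_isometry V"
      unfolding V_def using good[OF x] W W' linear_isometry_inv[OF W'] by (intro linear_isometry_comp \<rho>_isometry) auto
    have Vx: "V (stereo x) = stereo (transition c c' x)"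
      using good[OF x] inv(1)[of "stereo (transition c c' x)"] by (simp add: V_def)
    have ne: "stereo z \<noteq> N" for z using stereo_N[of z] N_N by auto
    have cV: "continuous_on UNIV (\<lambda>y. V (stereo y))"
      by (intro continuous_on_compose2[OF linear_continuous_on[OF linear_isometry_bounded_linear[OF V]]]
          continuous_on_stereo) auto
    let ?O = "{y. V (stereo y) \<noteq> N}"
    have oO: "open ?O" using open_Collect_neq[OF cV continuous_on_const] .
    have nV: "norm (V (stereo y)) = 1" for y using linear_isometry_norm[OF V] by simp
    have cf: "continuous_on ?O (\<lambda>y. stereo_inv (V (stereo y)))"
      by (rule continuous_on_compose2[OF continuous_on_stereo_inv continuous_on_subset[OF cV]]) (auto simp: nV)
    have xO: "x \<in> ?O" using ne Vx by simp
    have fx: "stereo_inv (V (stereo x)) \<in> ball 0 r'" unfolding Vx stereo_inv_stereo by (rule tr(1)[OF x])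
    have "open (?O \<inter> (\<lambda>y. stereo_inv (V (stereo y))) -` ball 0 r')"
      by (rule continuous_open_preimage[OF cf oO]) simp
    then have "open (ball 0 r \<inter> (?O \<inter> (\<lambda>y. stereo_inv (V (stereo y))) -` ball 0 r'))" (is "open ?B") by auto
    moreover have "x \<in> ?B" using x xO fx unfolding overlap_iff[OF c] by simp
    ultimately obtain d where d: "d > 0" "\<And>y. dist y x < d \<Longrightarrow> y \<in> ?B" unfolding open_dist by blast
    have "y \<in> overlap c c' \<and> idx y = ?g" if "norm (y - x) < d" for y
    proof -
      have y: "y \<in> ?B" using d(2) that by (simp add: dist_norm)
      let ?f = "stereo_inv (V (stereo y))"
      have "stereo ?f = V (stereo y)" using y by (intro stereo_stereo_inv) (auto simp: nV)
      then have Wf: "W' (stereo ?f) = \<rho> ?g (W (stereo y))" by (simp add: V_def inv)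
      then have p: "patch W' ?f = patch W y" using good[OF x] by (simp add: patch_def orbit_\<rho>)
      then have "patch W y \<in> fst c'" using y chart_domain[OF c'] by (auto intro!: image_eqI[of _ _ ?f])
      then have yo: "y \<in> overlap c c'" using y by (simp add: overlap_iff[OF c])
      moreover have "transition c c' y = ?f"
        using y chart_of_patch[OF c', of ?f] by (simp add: transition_eq[OF c] p)
      ultimately show ?thesis using uniq[OF yo, of ?g] Wf good[OF x] by simp
    qed
    then show ?thesis using d(1) by blast
  qed
  show ?thesis
  proof (intro exI[of _ idx] ballI conjI)
    fix x assume x: "x \<in> overlap c c'"
    show "idx x \<in> carrier G" using good[OF x] by blast
    show "stereo (transition c c' x) = ?W' (\<rho> (idx x) (W (stereo x)))"
      using good[OF x] inv(1)[of "stereo (transition c c' x)"] by simp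
    show "\<exists>d>0. \<forall>y. norm (y - x) < d \<longrightarrow> y \<in> overlap c c' \<and> idx y = idx x" by (rule loc[OF x])
  qed
qed

lemma open_overlap: "c \<in> atlas \<Longrightarrow> c' \<in> atlas \<Longrightarrow> open (overlap c c')"
  unfolding open_dist dist_norm using transition_locally atlas_E by metis

lemma transition_isometry:
  assumes "c \<in> atlas" "c' \<in> atlas" "x \<in> overlap c c'"
  shows "\<exists>V. linear_isometry V \<and>
    (\<exists>d>0. \<forall>y. norm (y - x) < d \<longrightarrow> y \<in> overlap c c' \<and> stereo (transition c c' y) = V (stereo y))"
proof -
  obtain W r W' r' where c: "represents W r c" and c': "represents W' r' c'"
    using assms atlas_E by metis
  obtain idx where idx: "\<And>x. x \<in> overlap c c' \<Longrightarrow> idx x \<in> carrier G"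
    "\<And>x. x \<in> overlap c c' \<Longrightarrow> stereo (transition c c' x) = inv_into UNIV W' (\<rho> (idx x) (W (stereo x)))"
    "\<And>x. x \<in> overlap c c' \<Longrightarrow> \<exists>d>0. \<forall>y. norm (y - x) < d \<longrightarrow> y \<in> overlap c c' \<and> idx y = idx x"
    using transition_locally[OF c c'] by blast
  have "linear_isometry (inv_into UNIV W' \<circ> (\<rho> (idx x) \<circ> W))"
    using represents_isometry[OF c] represents_isometry[OF c'] linear_isometry_inv idx(1)[OF assms(3)]
    by (intro linear_isometry_comp \<rho>_isometry) auto
  moreover obtain d where d: "d > 0" "\<And>y. norm (y - x) < d \<Longrightarrow> y \<in> overlap c c' \<and> idx y = idx x"
    using idx(3)[OF assms(3)] by blast
  moreover have "stereo (transition c c' y) = (inv_into UNIV W' \<circ> (\<rho> (idx x) \<circ> W)) (stereo y)"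
    if "norm (y - x) < d" for y
    using d(2)[OF that] idx(2)[of y] by simp
  ultimately show ?thesis by blast
qed

lemma smooth_transition:
  assumes "c \<in> atlas" "c' \<in> atlas"
  shows "smooth_on (overlap c c') (transition c c')"
proof -
  obtain W r W' r' where c: "represents W r c" and c': "represents W' r' c'"
    using assms atlas_E by metis
  obtain idx where idx: "\<And>x. x \<in> overlap c c' \<Longrightarrow> idx x \<in> carrier G"
    "\<And>x. x \<in> overlap c c' \<Longrightarrow> stereo (transition c c' x) = inv_into UNIV W' (\<rho> (idx x) (W (stereo x)))"
    "\<And>x. x \<in> overlap c c' \<Longrightarrow> \<exists>d>0. \<forall>y. norm (y - x) < d \<longrightarrow> y \<in> overlap c c' \<and> idx y = idx x"
    using transition_locally[OF c c'] by blast
  have ne: "stereo z \<noteq> N" for z using stereo_N[of z] N_N by auto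
  let ?V = "\<lambda>g. inv_into UNIV W' \<circ> (\<rho> g \<circ> W)"
  show ?thesis
  proof (rule smooth_on_locally_constant_choice[where idx = idx and h = "\<lambda>g x. stereo_inv (?V g (stereo x))"])
    show "\<exists>d>0. \<forall>y. norm (y - x) < d \<longrightarrow> idx y = idx x" if "x \<in> overlap c c'" for x
      using idx(3)[OF that] by blast
    show "transition c c' x = stereo_inv (?V (idx x) (stereo x))" if "x \<in> overlap c c'" for x
      using idx(2)[OF that] stereo_inv_stereo[of "transition c c' x"] by simp
    fix g
    show "smooth_on {x \<in> overlap c c'. idx x = g} (\<lambda>x. stereo_inv (?V g (stereo x)))"
    proof (cases "g \<in> carrier G")
      case True
      have "linear_isometry (?V g)"
        using represents_isometry[OF c] represents_isometry[OF c'] linear_isometry_inv True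
        by (intro linear_isometry_comp \<rho>_isometry) auto
      moreover have "?V g (stereo x) \<noteq> N" if "x \<in> {x \<in> overlap c c'. idx x = g}" for x
        using that idx(2)[of x] ne by auto
      ultimately show ?thesis by (rule smooth_stereo_inv_isometry_stereo)
    next
      case False
      then have e: "{x \<in> overlap c c'. idx x = g} = {}" using idx(1) by auto
      show ?thesis unfolding e by (simp add: smooth_on_def)
    qed
  qed
qed

theorem hilbert_manifold_quotient: "hilbert_manifold quotient_topology atlas"
  unfolding hilbert_manifold_def
proof (intro conjI ballI)
  show "Hausdorff_space quotient_topology" by (rule Hausdorff_quotient)
  show "(\<Union>c\<in>atlas. fst c) = topspace quotient_topology" by (simp add: atlas_covers)
  fix c assume c: "c \<in> atlas"
  then obtain W r where W: "represents W r c" by (rule atlas_E)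
  show "openin quotient_topology (fst c)" by (rule openin_chart_domain[OF W])
  show "open (snd c ` fst c)" by (simp add: chart_range[OF W])
  show "homeomorphic_map (subtopology quotient_topology (fst c)) (top_of_set (snd c ` fst c)) (snd c)"
    by (rule chart_homeomorphism[OF W])
  show "smooth_on (snd c ` (fst c \<inter> fst c')) (transition c c')" if "c' \<in> atlas" for c'
    using smooth_transition[OF c that] by (simp add: overlap_def)
qed

end

context sphere_quotient
begin

subsection \<open>The spherical metric on the quotient\<close>

lemma mem_overlap: "c \<in> charts_at atlas p \<Longrightarrow> c' \<in> charts_at atlas p \<Longrightarrow> snd c p \<in> overlap c c'"
  by (auto simp: charts_at_def overlap_def)

lemma charts_at_E:
  assumes "c \<in> charts_at atlas p"
  obtains W r where "represents W r c" "p \<in> fst c"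
proof -
  have c: "c \<in> atlas" "p \<in> fst c" using assms by (simp_all add: charts_at_def)
  obtain W r where "represents W r c" using c(1) by (rule atlas_E)
  then show thesis using c(2) by (rule that)
qed

lemma charts_at_nonempty: "p \<in> orbits \<Longrightarrow> charts_at atlas p \<noteq> {}"
  using atlas_covers unfolding charts_at_def by blast

lemma chart_inv_chart: "c \<in> charts_at atlas p \<Longrightarrow> chart_inv c (snd c p) = p"
  by (elim charts_at_E) (simp only: chart_inv_eq chart_in_ball patch_of_chart)

lemma transition_chart: "c \<in> charts_at atlas p \<Longrightarrow> transition c c' (snd c p) = snd c' p"
  by (simp add: transition_def chart_inv_chart)

lemma transition_has_derivative:
  assumes "c \<in> atlas" "c' \<in> atlas" "x \<in> overlap c c'"
  shows "(transition c c' has_derivative frechet_derivative (transition c c') (at x)) (at x)"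
  using smooth_on_has_derivative[OF smooth_transition open_overlap] assms
  by (metis frechet_derivative_at)

text \<open>
  Differentiating \<open>stereo (\<tau> y) = V (stereo y)\<close> for a linear isometry \<open>V\<close> shows that the
  transition map \<open>\<tau>\<close> preserves the spherical metric.
\<close>

lemma transition_derivative_inner:
  assumes "c \<in> atlas" "c' \<in> atlas" "x \<in> overlap c c'"
  shows "(conformal_factor (transition c c' x))\<^sup>2 *
      inner (frechet_derivative (transition c c') (at x) v) (frechet_derivative (transition c c') (at x) w)
    = (conformal_factor x)\<^sup>2 * inner v w"
proof -
  let ?\<tau> = "transition c c'" and ?D = "frechet_derivative (transition c c') (at x)"
  let ?s = "conformal_factor x" and ?t = "conformal_factor (transition c c' x)"
  let ?S = "\<lambda>x v. conformal_factor x *\<^sub>R T v - ((conformal_factor x)\<^sup>2 * inner x v) *\<^sub>R (T x - N)"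
  obtain V d where V: "linear_isometry V" and d: "d > 0"
      "\<And>y. norm (y - x) < d \<Longrightarrow> stereo (?\<tau> y) = V (stereo y)"
    using transition_isometry[OF assms] by blast
  have D: "(?\<tau> has_derivative ?D) (at x)" by (rule transition_has_derivative[OF assms])
  have "((\<lambda>y. stereo (?\<tau> y)) has_derivative (\<lambda>v. ?S (?\<tau> x) (?D v))) (at x)"
    using diff_chain_at[OF D stereo_has_derivative] by (simp add: o_def)
  moreover have "((\<lambda>y. stereo (?\<tau> y)) has_derivative (\<lambda>v. V (?S x v))) (at x)"
  proof (rule has_derivative_transform_within[where f = "\<lambda>y. V (stereo y)"])
    show "((\<lambda>y. V (stereo y)) has_derivative (\<lambda>v. V (?S x v))) (at x)"
      using bounded_linear.has_derivative[OF linear_isometry_bounded_linear[OF V] stereo_has_derivative] .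
  qed (use d in \<open>auto simp: dist_norm\<close>)
  ultimately have "(\<lambda>v. ?S (?\<tau> x) (?D v)) = (\<lambda>v. V (?S x v))" by (rule has_derivative_unique)
  then have "norm (?S (?\<tau> x) (?D v)) = norm (V (?S x v))" for v by (rule arg_cong[OF fun_cong])
  then have eq: "?t * norm (?D v) = ?s * norm v" for v
    using stereo_derivative_norm[of "?\<tau> x"] stereo_derivative_norm[of x] linear_isometry_norm[OF V] by simp
  have lin: "linear ?D" using D by (rule has_derivative_linear)
  have "linear_isometry (\<lambda>v. (?t / ?s) *\<^sub>R ?D v)"
    unfolding linear_isometry_def
    using linear_compose_scale_right[OF lin, of "?t / ?s"] eq by (simp add: field_simps)
  from linear_isometry_inner[OF this, of v w] show ?thesis by (simp add: power2_eq_square field_simps)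
qed

lemma tangent_space_transition:
  "\<xi> \<in> tangent_space atlas p \<Longrightarrow> c \<in> charts_at atlas p \<Longrightarrow> c' \<in> charts_at atlas p \<Longrightarrow>
    \<xi> c' = frechet_derivative (transition c c') (at (snd c p)) (\<xi> c)"
  unfolding tangent_space_def by blast

text \<open>By \<open>transition_derivative_inner\<close> the value on tangent vectors is the same for all charts around \<open>p\<close>.\<close>

definition spherical_metric :: "('h set, 'h) metric_tensor" where
  "spherical_metric p \<xi> \<eta> = (let c = (SOME c. c \<in> charts_at atlas p) in
    (conformal_factor (snd c p))\<^sup>2 * inner (\<xi> c) (\<eta> c))"

lemma spherical_metric_chart:
  assumes c: "c \<in> charts_at atlas p" and \<xi>: "\<xi> \<in> tangent_space atlas p" and \<eta>: "\<eta> \<in> tangent_space atlas p"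
  shows "spherical_metric p \<xi> \<eta> = (conformal_factor (snd c p))\<^sup>2 * inner (\<xi> c) (\<eta> c)"
proof -
  define c0 where "c0 = (SOME c. c \<in> charts_at atlas p)"
  have c0: "c0 \<in> charts_at atlas p" unfolding c0_def using c by (rule someI)
  have a: "c0 \<in> atlas" "c \<in> atlas" using c c0 by (simp_all add: charts_at_def)
  show ?thesis
    using transition_derivative_inner[OF a mem_overlap[OF c0 c], of "\<xi> c0" "\<eta> c0"]
    unfolding tangent_space_transition[OF \<xi> c0 c, symmetric] tangent_space_transition[OF \<eta> c0 c, symmetric]
      transition_chart[OF c0]
    by (simp add: spherical_metric_def Let_def c0_def[symmetric])
qed

lemma transition_derivative_comp:
  assumes c: "c \<in> charts_at atlas p" "c' \<in> charts_at atlas p" "c'' \<in> charts_at atlas p"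
  shows "frechet_derivative (transition c c'') (at (snd c p)) v =
    frechet_derivative (transition c' c'') (at (snd c' p)) (frechet_derivative (transition c c') (at (snd c p)) v)"
proof -
  have a: "c \<in> atlas" "c' \<in> atlas" "c'' \<in> atlas" using c by (auto simp: charts_at_def)
  have D1: "(transition c c' has_derivative frechet_derivative (transition c c') (at (snd c p))) (at (snd c p))"
    by (rule transition_has_derivative[OF a(1,2) mem_overlap[OF c(1,2)]])
  have D2: "(transition c' c'' has_derivative frechet_derivative (transition c' c'') (at (snd c' p)))
      (at (transition c c' (snd c p)))"
    using transition_has_derivative[OF a(2,3) mem_overlap[OF c(2,3)]] by (simp add: transition_chart[OF c(1)])
  have "((transition c' c'' \<circ> transition c c') has_derivative
      (frechet_derivative (transition c' c'') (at (snd c' p)) \<circ> frechet_derivative (transition c c') (at (snd c p))))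
      (at (snd c p))"
    by (rule diff_chain_at[OF D1 D2])
  then have "(transition c c'' has_derivative
      (frechet_derivative (transition c' c'') (at (snd c' p)) \<circ> frechet_derivative (transition c c') (at (snd c p))))
      (at (snd c p))"
  proof (rule has_derivative_transform_within_open)
    show "open (overlap c c')" by (rule open_overlap[OF a(1,2)])
    show "snd c p \<in> overlap c c'" by (rule mem_overlap[OF c(1,2)])
    fix x assume "x \<in> overlap c c'"
    then obtain q where q: "q \<in> fst c" "q \<in> fst c'" "x = snd c q" by (auto simp: overlap_def)
    then show "(transition c' c'' \<circ> transition c c') x = transition c c'' x"
      using a by (simp add: transition_chart[of _ q] charts_at_def)
  qed
  from fun_cong[OF frechet_derivative_at[OF this], of v] show ?thesis by simp
qed

lemma transition_self_derivative:
  assumes c: "c \<in> charts_at atlas p"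
  shows "frechet_derivative (transition c c) (at (snd c p)) v = v"
proof -
  obtain W r where W: "represents W r c" and p: "p \<in> fst c" using c by (rule charts_at_E)
  have "((\<lambda>x. x) has_derivative (\<lambda>v. v)) (at (snd c p))" by (rule has_derivative_ident)
  then have "(transition c c has_derivative (\<lambda>v. v)) (at (snd c p))"
  proof (rule has_derivative_transform_within_open)
    show "snd c p \<in> ball 0 r" by (rule chart_in_ball[OF W p])
    show "x = transition c c x" if "x \<in> ball 0 r" for x
      by (simp only: transition_eq[OF W that] chart_of_patch[OF W that])
  qed simp
  from fun_cong[OF frechet_derivative_at[OF this], of v] show ?thesis by simp
qed

lemma tangent_vector_in_tangent_space:
  assumes "c \<in> charts_at atlas p"
  shows "tangent_vector atlas p c v \<in> tangent_space atlas p"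
  unfolding tangent_space_def
proof (intro CollectI conjI ballI allI impI)
  show "tangent_vector atlas p c v c' = 0" if "c' \<notin> charts_at atlas p" for c'
    using that by (simp add: tangent_vector_def)
  fix c' c'' assume "c' \<in> charts_at atlas p" "c'' \<in> charts_at atlas p"
  then show "tangent_vector atlas p c v c'' =
      frechet_derivative (transition c' c'') (at (snd c' p)) (tangent_vector atlas p c v c')"
    unfolding tangent_vector_def using transition_derivative_comp[OF assms, of c' c''] by (simp only: if_True)
qed

lemma tangent_vector_self: "c \<in> charts_at atlas p \<Longrightarrow> tangent_vector atlas p c v c = v"
  by (simp add: tangent_vector_def transition_self_derivative)

lemma spherical_metric_tangent_vector:
  assumes "c \<in> charts_at atlas p"
  shows "spherical_metric p (tangent_vector atlas p c v) (tangent_vector atlas p c w)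
    = (conformal_factor (snd c p))\<^sup>2 * inner v w"
  using spherical_metric_chart[OF assms tangent_vector_in_tangent_space tangent_vector_in_tangent_space] assms
  by (simp add: tangent_vector_self)

lemma local_metric_spherical:
  assumes "c \<in> atlas" "x \<in> snd c ` fst c"
  shows "local_metric atlas spherical_metric c x v w = (conformal_factor x)\<^sup>2 * inner v w"
proof -
  obtain p where p: "p \<in> fst c" "x = snd c p" using assms(2) by blast
  then have "c \<in> charts_at atlas p" using assms(1) by (simp add: charts_at_def)
  then show ?thesis
    using p by (simp add: local_metric_def Let_def chart_inv_chart spherical_metric_tangent_vector)
qed

theorem riemannian_metric_spherical: "riemannian_metric quotient_topology atlas spherical_metric"
  unfolding riemannian_metric_def
proof (intro conjI ballI)
  fix p assume "p \<in> topspace quotient_topology"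
  then have "p \<in> orbits" by simp
  then obtain c1 where c1: "c1 \<in> charts_at atlas p" using charts_at_nonempty by blast
  define c0 where "c0 = (SOME c. c \<in> charts_at atlas p)"
  have c0: "c0 \<in> charts_at atlas p" unfolding c0_def using c1 by (rule someI)
  have m: "spherical_metric p \<xi> \<eta> = (conformal_factor (snd c0 p))\<^sup>2 * inner (\<xi> c0) (\<eta> c0)" for \<xi> \<eta>
    by (simp add: spherical_metric_def Let_def c0_def)
  have "\<xi> c0 \<noteq> 0" if \<xi>: "\<xi> \<in> tangent_space atlas p" and nz: "\<xi> \<noteq> (\<lambda>_. 0)" for \<xi>
  proof
    assume z: "\<xi> c0 = 0"
    have "\<xi> c = 0" for c
    proof (cases "c \<in> charts_at atlas p")
      case True
      have "linear (frechet_derivative (transition c0 c) (at (snd c0 p)))"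
        using transition_has_derivative[OF _ _ mem_overlap[OF c0 True]] c0 True
        by (intro has_derivative_linear) (auto simp: charts_at_def)
      moreover have "\<xi> c = frechet_derivative (transition c0 c) (at (snd c0 p)) (\<xi> c0)"
        by (rule tangent_space_transition[OF \<xi> c0 True])
      ultimately show ?thesis using z by (simp add: linear_0)
    next
      case False
      then show ?thesis using \<xi> unfolding tangent_space_def by blast
    qed
    then show False using nz by auto
  qed
  then show "inner_product_on (tangent_space atlas p) (spherical_metric p)"
    unfolding inner_product_on_def m inner_add_left inner_scaleR_left
    by (auto simp: inner_commute distrib_left)
  fix c assume c: "c \<in> charts_at atlas p"
  have "sqrt (spherical_metric p \<xi> \<xi>) = conformal_factor (snd c p) * norm (\<xi> c)"
    if "\<xi> \<in> tangent_space atlas p" for \<xi>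
    by (simp add: spherical_metric_chart[OF c that that] real_sqrt_mult norm_eq_sqrt_inner)
  then show "\<exists>a>0. \<exists>b>0. \<forall>\<xi>\<in>tangent_space atlas p.
      a * norm (\<xi> c) \<le> sqrt (spherical_metric p \<xi> \<xi>) \<and> sqrt (spherical_metric p \<xi> \<xi>) \<le> b * norm (\<xi> c)"
    by (intro exI[of _ "conformal_factor (snd c p)"] conjI) auto
next
  fix c :: "('h set, 'h) chart" assume c: "c \<in> atlas"
  let ?B = "\<lambda>x :: 'h. (conformal_factor x * conformal_factor x) *\<^sub>R Blinfun (blinfun_inner_right :: 'h \<Rightarrow> _)"
  have "smooth_on (snd c ` fst c) ?B"
    by (intro smooth_on_bilinear[OF bounded_bilinear_scaleR] smooth_on_bilinear[OF bounded_bilinear_mult]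
        smooth_conformal_factor smooth_on_const)
  moreover have "blinfun_apply (blinfun_apply (?B x) v) w = local_metric atlas spherical_metric c x v w"
    if "x \<in> snd c ` fst c" for x v w
    by (simp add: local_metric_spherical[OF c that] blinfun.scaleR_left power2_eq_square
        bounded_linear_Blinfun_apply[OF bounded_linear_blinfun_inner_right])
  ultimately show "\<exists>B :: 'h \<Rightarrow> 'h \<Rightarrow>\<^sub>L 'h \<Rightarrow>\<^sub>L real. smooth_on (snd c ` fst c) B \<and>
      (\<forall>x \<in> snd c ` fst c. \<forall>v w. blinfun_apply (blinfun_apply (B x) v) w
        = local_metric atlas spherical_metric c x v w)"
    by blast
qed

theorem constant_curvature_spherical: "constant_sectional_curvature atlas spherical_metric 1"
  unfolding constant_sectional_curvature_def
proof (intro ballI allI impI)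
  fix c x and u v :: 'h assume c: "c \<in> atlas" and x: "x \<in> snd c ` fst c" and uv: "u \<noteq> v \<and> independent {u, v}"
  obtain W r where W: "represents W r c" using c by (rule atlas_E)
  have "open (snd c ` fst c)" by (simp add: chart_range[OF W])
  from sectional_curvature_spherical[OF this local_metric_spherical[OF c] x] uv
  show "sectional_curvature (local_metric atlas spherical_metric c) x u v = 1" by blast
qed

subsection \<open>The angular distance between orbits\<close>

text \<open>This turns out to be the Riemannian distance of the quotient.\<close>

definition orbit_angle :: "'h set \<Rightarrow> 'h set \<Rightarrow> real" where
  "orbit_angle p q = Inf {angle x y | x y. x \<in> p \<and> y \<in> q}"

lemma orbits_unit: "p \<in> orbits \<Longrightarrow> x \<in> p \<Longrightarrow> norm x = 1"
  by (simp add: orbits_member)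

lemma orbit_angle_bdd: "p \<in> orbits \<Longrightarrow> q \<in> orbits \<Longrightarrow> bdd_below {angle x y | x y. x \<in> p \<and> y \<in> q}"
  using angle_nonneg orbits_unit by (intro bdd_belowI[of _ 0]) auto

lemma orbit_angle_le: "p \<in> orbits \<Longrightarrow> q \<in> orbits \<Longrightarrow> x \<in> p \<Longrightarrow> y \<in> q \<Longrightarrow> orbit_angle p q \<le> angle x y"
  unfolding orbit_angle_def by (intro cInf_lower orbit_angle_bdd) auto

lemma orbits_nonempty: "p \<in> orbits \<Longrightarrow> \<exists>x. x \<in> p"
  by (metis orbits_E self_in_orbit)

text \<open>The group acts by isometries, so nearly optimal representatives can be moved to start at any given \<open>x\<close>.\<close>

lemma orbit_angle_attained_nearly:
  assumes p: "p \<in> orbits" and q: "q \<in> orbits" and x: "x \<in> p" and d: "orbit_angle p q < d"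
  shows "\<exists>y\<in>q. angle x y < d"
proof -
  have "{angle x y | x y. x \<in> p \<and> y \<in> q} \<noteq> {}" using orbits_nonempty[OF q] x by auto
  from cInf_lessD[OF this d[unfolded orbit_angle_def]]
  obtain x' y' where xy: "x' \<in> p" "y' \<in> q" "angle x' y' < d" by auto
  have "orbit x = orbit x'" using x xy(1) p by (simp add: orbits_member)
  then obtain g where g: "g \<in> carrier G" "x = \<rho> g x'" by (auto simp: orbit_eq_iff)
  have "\<rho> g y' \<in> q" using xy(2) g(1) q by (simp add: orbits_member \<rho>_norm orbit_\<rho>)
  moreover have "angle x (\<rho> g y') = angle x' y'" using g by (simp add: angle_isometry \<rho>_isometry)
  ultimately show ?thesis using xy(3) by (intro bexI[of _ "\<rho> g y'"]) auto
qed

lemma orbit_angle_nonneg: 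
  assumes "p \<in> orbits" "q \<in> orbits" 
  shows "0 \<le> orbit_angle p q"
  unfolding orbit_angle_def
proof (rule cInf_greatest)
  show "{angle x y | x y. x \<in> p \<and> y \<in> q} \<noteq> {}"
    using orbits_nonempty[OF assms(1)] orbits_nonempty[OF assms(2)] by blast
  fix a assume "a \<in> {angle x y | x y. x \<in> p \<and> y \<in> q}"
  then show "0 \<le> a" using angle_nonneg orbits_unit[OF assms(1)] orbits_unit[OF assms(2)] by auto
qed

lemma orbit_angle_commute: "orbit_angle p q = orbit_angle q p"
proof -
  have "{angle x y | x y. x \<in> p \<and> y \<in> q} = {angle x y | x y. x \<in> q \<and> y \<in> p}"
    using angle_commute by blast
  then show ?thesis by (simp add: orbit_angle_def)
qed

lemma orbit_angle_triangle:
  assumes "p \<in> orbits" "q \<in> orbits" "r \<in> orbits"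
  shows "orbit_angle p r \<le> orbit_angle p q + orbit_angle q r"
proof (rule field_le_epsilon)
  fix e :: real assume e: "e > 0"
  obtain x where x: "x \<in> p" using orbits_nonempty assms by blast
  obtain y where y: "y \<in> q" "angle x y < orbit_angle p q + e / 2"
    using orbit_angle_attained_nearly[OF assms(1,2) x, of "orbit_angle p q + e / 2"] e by auto
  obtain z where z: "z \<in> r" "angle y z < orbit_angle q r + e / 2"
    using orbit_angle_attained_nearly[OF assms(2,3) y(1), of "orbit_angle q r + e / 2"] e by auto
  have "orbit_angle p r \<le> angle x z" by (rule orbit_angle_le[OF assms(1,3) x z(1)])
  also have "\<dots> \<le> angle x y + angle y z"
    by (intro angle_triangle orbits_unit[OF assms(1) x] orbits_unit[OF assms(2) y(1)] orbits_unit[OF assms(3) z(1)])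
  finally show "orbit_angle p r \<le> orbit_angle p q + orbit_angle q r + e" using y z by (simp add: field_simps)
qed

lemma orbit_angle_eq_0_iff:
  assumes "p \<in> orbits" "q \<in> orbits"
  shows "orbit_angle p q = 0 \<longleftrightarrow> p = q"
proof
  assume z: "orbit_angle p q = 0"
  obtain x where x: "norm x = 1" "p = orbit x" using assms(1) by (rule orbits_E)
  obtain y where y: "norm y = 1" "q = orbit y" using assms(2) by (rule orbits_E)
  have "\<exists>g\<in>carrier G. x = \<rho> g y"
  proof (rule in_orbit_if_arbitrarily_close[OF y(1)])
    fix d :: real assume "d > 0"
    then obtain y' where y': "y' \<in> q" "angle x y' < d"
      using orbit_angle_attained_nearly[OF assms, of x d] z x self_in_orbit by auto
    have "norm (x - y') \<le> angle x y'" using x y' orbits_unit[OF assms(2)] by (intro chord_le_angle) auto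
    then have "norm (x - y') < d" using y'(2) by (rule le_less_trans)
    moreover obtain g where "g \<in> carrier G" "y' = \<rho> g y" using y' y by (auto simp: orbit_def)
    ultimately show "\<exists>g\<in>carrier G. norm (x - \<rho> g y) < d" by blast
  qed
  then show "p = q" using x y orbit_eq_iff by blast
next
  assume "p = q"
  then show "orbit_angle p q = 0"
  proof -
    obtain x where x: "x \<in> p" using orbits_nonempty assms by blast
    have "angle x x = 0" using orbits_unit[OF assms(1) x] by (simp add: angle_def power2_norm_eq_inner[symmetric])
    then show ?thesis
      using orbit_angle_le[OF assms(1,1) x x] orbit_angle_nonneg[OF assms(1,1)] \<open>p = q\<close> by simp
  qed
qed

lemma Metric_space_orbit_angle: "Metric_space orbits (\<lambda>p q. if p \<in> orbits \<and> q \<in> orbits then orbit_angle p q else 0)"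
proof
  fix p q r
  show "0 \<le> (if p \<in> orbits \<and> q \<in> orbits then orbit_angle p q else 0)" 
    by (simp add: orbit_angle_nonneg)
  show "(if p \<in> orbits \<and> q \<in> orbits then orbit_angle p q else 0) =
      (if q \<in> orbits \<and> p \<in> orbits then orbit_angle q p else 0)"
    using orbit_angle_commute[of p q] by simp
  assume p: "p \<in> orbits" and q: "q \<in> orbits"
  show "(if p \<in> orbits \<and> q \<in> orbits then orbit_angle p q else 0) = 0 \<longleftrightarrow> p = q"
    using p q orbit_angle_eq_0_iff by simp
  assume r: "r \<in> orbits"
  show "(if p \<in> orbits \<and> r \<in> orbits then orbit_angle p r else 0) \<le>
      (if p \<in> orbits \<and> q \<in> orbits then orbit_angle p q else 0) +
      (if q \<in> orbits \<and> r \<in> orbits then orbit_angle q r else 0)"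
    using p q r orbit_angle_triangle by simp
qed

text \<open>
  A Cauchy sequence of orbits has a subsequence whose consecutive angular distances are summable;
  representatives can then be chosen one after the other so that they form a Cauchy sequence on
  the sphere, which is complete.
\<close>

lemma orbit_angle_complete:
  fixes \<sigma> :: "nat \<Rightarrow> 'h set"
  assumes \<sigma>: "\<And>n. \<sigma> n \<in> orbits"
    and cauchy: "\<And>e. e > 0 \<Longrightarrow> \<exists>M. \<forall>m n. M \<le> m \<longrightarrow> M \<le> n \<longrightarrow> orbit_angle (\<sigma> m) (\<sigma> n) < e"
  shows "\<exists>k p. strict_mono (k :: nat \<Rightarrow> nat) \<and> p \<in> orbits \<and> (\<forall>e>0. \<exists>M. \<forall>n\<ge>M. orbit_angle (\<sigma> (k n)) p < e)"
proof -
  let ?P = "\<lambda>n (m, x). x \<in> \<sigma> m \<and> (\<forall>i j. m \<le> i \<longrightarrow> m \<le> j \<longrightarrow> orbit_angle (\<sigma> i) (\<sigma> j) < (1/2) ^ n)"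
  let ?Q = "\<lambda>(n::nat) (m::nat, x::'h) (m'::nat, x'::'h). m < m' \<and> angle x x' < (1/2) ^ n"
  have "\<exists>f. \<forall>n. ?P n (f n) \<and> ?Q n (f n) (f (Suc n))"
  proof (rule dependent_nat_choice)
    obtain M where "\<forall>m n. M \<le> m \<longrightarrow> M \<le> n \<longrightarrow> orbit_angle (\<sigma> m) (\<sigma> n) < (1/2) ^ 0"
      using cauchy[of "(1/2) ^ 0"] by auto
    moreover obtain x where "x \<in> \<sigma> M" using orbits_nonempty[OF \<sigma>] by blast
    ultimately show "\<exists>z. ?P 0 z" by (intro exI[of _ "(M, x)"]) simp
    fix z n assume z: "?P n z"
    obtain m x where mx: "z = (m, x)" by (cases z)
    obtain M where M: "\<forall>i j. M \<le> i \<longrightarrow> M \<le> j \<longrightarrow> orbit_angle (\<sigma> i) (\<sigma> j) < (1/2) ^ Suc n"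
      using cauchy[of "(1/2) ^ Suc n"] by auto
    let ?m = "max M (Suc m)"
    have "orbit_angle (\<sigma> m) (\<sigma> ?m) < (1/2) ^ n" using z mx by simp
    then obtain x' where "x' \<in> \<sigma> ?m" "angle x x' < (1/2) ^ n"
      using orbit_angle_attained_nearly[OF \<sigma> \<sigma>, of x m ?m "(1/2) ^ n"] z mx by auto
    then show "\<exists>z'. ?P (Suc n) z' \<and> ?Q n z z'" using M mx by (intro exI[of _ "(?m, x')"]) auto
  qed
  then obtain f where "\<forall>n. ?P n (f n) \<and> ?Q n (f n) (f (Suc n))" ..
  note f0 = spec[OF this]
  note f = conjunct1[OF f0] conjunct2[OF f0]
  define k where "k n = fst (f n)" for n
  define x where "x n = snd (f n)" for n
  have k: "strict_mono k" using f(2) by (auto simp: strict_mono_Suc_iff k_def case_prod_unfold)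
  have x: "x n \<in> \<sigma> (k n)" "angle (x n) (x (Suc n)) < (1/2) ^ n" for n
    using f by (auto simp: k_def x_def case_prod_unfold)
  have unit: "norm (x n) = 1" for n by (rule orbits_unit[OF \<sigma> x(1)])
  have "norm (x (Suc n) - x n) \<le> (1/2) ^ n" for n
    using chord_le_angle[OF unit unit, of "Suc n" n] x(2)[of n] angle_commute[of "x n" "x (Suc n)"] by linarith
  then have "summable (\<lambda>n. x (Suc n) - x n)"
    by (rule summable_comparison_test'[where g = "\<lambda>n. (1/2) ^ n" and N = 0, OF summable_geometric, rotated]) auto
  then have "convergent (\<lambda>n. \<Sum>i<n. x (Suc i) - x i)" by (simp add: summable_iff_convergent)
  then have "convergent (\<lambda>n. x n - x 0)" by (simp add: sum_lessThan_telescope)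
  then have "convergent x" using convergent_add_const_iff[of "- x 0" x] by (simp add: add.commute)
  then obtain l where l: "x \<longlonglongrightarrow> l" by (auto simp: convergent_def)
  have "(\<lambda>n. norm (x n)) \<longlonglongrightarrow> norm l" using l by (rule tendsto_norm)
  then have nl: "norm l = 1" unfolding unit by (simp add: LIMSEQ_const_iff)
  have pl: "orbit l \<in> orbits" by (rule orbit_in_orbits[OF nl])
  have "\<exists>M. \<forall>n\<ge>M. orbit_angle (\<sigma> (k n)) (orbit l) < e" if e: "e > 0" for e
  proof -
    obtain d where d: "d > 0" "\<And>x y :: 'h. norm x = 1 \<Longrightarrow> norm y = 1 \<Longrightarrow> norm (x - y) < d \<Longrightarrow>
        angle x y \<le> (1 + 1) * norm (x - y)"
      using angle_le_multiple_of_chord[of 1] by auto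
    obtain M where M: "\<And>n. n \<ge> M \<Longrightarrow> norm (x n - l) < min d (e / 2)"
      using LIMSEQ_D[OF l, of "min d (e / 2)"] d(1) e by auto
    have "orbit_angle (\<sigma> (k n)) (orbit l) < e" if "n \<ge> M" for n
    proof -
      have "orbit_angle (\<sigma> (k n)) (orbit l) \<le> angle (x n) l"
        by (rule orbit_angle_le[OF \<sigma> pl x(1) self_in_orbit])
      also have "\<dots> \<le> 2 * norm (x n - l)" using d(2)[OF unit nl, of n] M[OF that] by simp
      also have "\<dots> < e" using M[OF that] by simp
      finally show ?thesis .
    qed
    then show ?thesis by blast
  qed
  then show ?thesis using k pl by blast
qed

lemma mcomplete_orbit_angle:
  "Metric_space.mcomplete orbits (\<lambda>p q. if p \<in> orbits \<and> q \<in> orbits then orbit_angle p q else 0)"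
proof -
  interpret Metric_space orbits "\<lambda>p q. if p \<in> orbits \<and> q \<in> orbits then orbit_angle p q else 0"
    by (rule Metric_space_orbit_angle)
  show ?thesis unfolding mcomplete_def
  proof (intro allI impI)
    fix \<sigma> assume c: "MCauchy \<sigma>"
    then have \<sigma>: "\<sigma> n \<in> orbits" for n unfolding MCauchy_def by blast
    have cau: "\<exists>M. \<forall>m n. M \<le> m \<longrightarrow> M \<le> n \<longrightarrow> orbit_angle (\<sigma> m) (\<sigma> n) < e" if "e > 0" for e
      using c that \<sigma> unfolding MCauchy_def by simp
    have "\<exists>k p. strict_mono (k :: nat \<Rightarrow> nat) \<and> p \<in> orbits \<and> (\<forall>e>0. \<exists>M. \<forall>n\<ge>M. orbit_angle (\<sigma> (k n)) p < e)"
      by (rule orbit_angle_complete[where \<sigma> = \<sigma>]) (rule \<sigma>, rule cau)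
    then obtain k p where k: "strict_mono (k :: nat \<Rightarrow> nat)" "p \<in> orbits"
        "\<forall>e>0. \<exists>M. \<forall>n\<ge>M. orbit_angle (\<sigma> (k n)) p < e"
      by blast
    have "limitin mtopology (\<sigma> \<circ> k) p sequentially"
      unfolding limitin_metric using k(2,3) \<sigma> by (auto simp: eventually_sequentially)
    then show "\<exists>x. limitin mtopology \<sigma> x sequentially"
      using MCauchy_convergent_subsequence[OF c k(1)] by blast
  qed
qed

end

subsection \<open>Curves on the quotient and the Riemannian distance\<close>

lemma has_integral_subdivision:
  fixes f :: "real \<Rightarrow> real" and s :: "nat \<Rightarrow> real"
  assumes "\<And>i. i < n \<Longrightarrow> s i < s (Suc i)" "\<And>i. i < n \<Longrightarrow> (f has_integral I i) {s i..s (Suc i)}"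
  shows "(f has_integral (\<Sum>i<n. I i)) {s 0..s n} \<and> s 0 \<le> s n"
  using assms
proof (induction n)
  case 0
  show ?case using has_integral_refl(2)[of f "s 0"] by simp
next
  case (Suc n)
  then have IH: "(f has_integral (\<Sum>i<n. I i)) {s 0..s n}" "s 0 \<le> s n" by auto
  have "s n < s (Suc n)" "(f has_integral I n) {s n..s (Suc n)}" using Suc.prems by auto
  then show ?case using has_integral_combine[OF IH(2) _ IH(1), of "s (Suc n)" "I n"] IH(2) by simp
qed

context sphere_quotient
begin

text \<open>
  The velocity is defined chart by chart; the chain rule for the transition maps shows that its
  coordinates in all charts come from those in one.
\<close>

lemma velocity_eq_tangent_vector:
  assumes \<gamma>: "pathin quotient_topology \<gamma>" and u: "0 < u" "u < 1"
    and c: "c \<in> charts_at atlas (\<gamma> u)" and d: "((snd c \<circ> \<gamma>) has_vector_derivative d) (at u)"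
  shows "velocity atlas \<gamma> u = tangent_vector atlas (\<gamma> u) c d"
proof
  fix c'
  show "velocity atlas \<gamma> u c' = tangent_vector atlas (\<gamma> u) c d c'"
  proof (cases "c' \<in> charts_at atlas (\<gamma> u)")
    case True
    have a: "c \<in> atlas" "c' \<in> atlas" "\<gamma> u \<in> fst c" "\<gamma> u \<in> fst c'" using c True by (auto simp: charts_at_def)
    have o: "openin quotient_topology (fst c \<inter> fst c')"
      using a(1,2) openin_chart_domain by (metis atlas_E openin_Int)
    have "openin (top_of_set {0..1}) {t \<in> {0..1}. \<gamma> t \<in> fst c \<inter> fst c'}"
      using openin_continuous_map_preimage[OF \<gamma>[unfolded pathin_def] o] by simp
    then obtain V where V: "open V" "{t \<in> {0..1}. \<gamma> t \<in> fst c \<inter> fst c'} = {0..1} \<inter> V"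
      unfolding openin_open by blast
    let ?\<tau> = "transition c c'"
    have "(?\<tau> has_derivative frechet_derivative ?\<tau> (at (snd c (\<gamma> u)))) (at (snd c (\<gamma> u)))"
      by (rule transition_has_derivative[OF a(1,2) mem_overlap[OF c True]])
    then have "((?\<tau> \<circ> (snd c \<circ> \<gamma>)) has_vector_derivative frechet_derivative ?\<tau> (at (snd c (\<gamma> u))) d) (at u)"
      by (intro vector_derivative_diff_chain_within[OF d]) (simp add: has_derivative_at_withinI)
    then have "((snd c' \<circ> \<gamma>) has_vector_derivative frechet_derivative ?\<tau> (at (snd c (\<gamma> u))) d) (at u)"
    proof (rule has_vector_derivative_transform_within_open)
      show "open (V \<inter> {0<..<1})" using V(1) by auto
      have "u \<in> {t \<in> {0..1}. \<gamma> t \<in> fst c \<inter> fst c'}" using a u by simp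
      then have "u \<in> {0..1} \<inter> V" unfolding V(2) .
      then show "u \<in> V \<inter> {0<..<1}" using u by simp
      fix t assume "t \<in> V \<inter> {0<..<1}"
      then have "t \<in> {0..1} \<inter> V" by simp
      then have "\<gamma> t \<in> fst c" unfolding V(2)[symmetric] by simp
      then have "c \<in> charts_at atlas (\<gamma> t)" using a by (simp add: charts_at_def)
      then show "(?\<tau> \<circ> (snd c \<circ> \<gamma>)) t = (snd c' \<circ> \<gamma>) t" by (simp add: transition_chart)
    qed
    then show ?thesis using True by (simp add: velocity_def tangent_vector_def vector_derivative_at)
  qed (simp add: velocity_def tangent_vector_def)
qed

lemma speed_in_chart:
  assumes \<gamma>: "pathin quotient_topology \<gamma>" and ab: "0 \<le> a" "b \<le> 1" "t \<in> {a<..<b}"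
    and c: "c \<in> atlas" "\<gamma> ` {a..b} \<subseteq> fst c"
    and D: "((snd c \<circ> \<gamma>) has_vector_derivative d) (at t within {a..b})"
  shows "sqrt (spherical_metric (\<gamma> t) (velocity atlas \<gamma> t) (velocity atlas \<gamma> t))
    = conformal_factor (snd c (\<gamma> t)) * norm d"
proof -
  have "at t within {a..b} = at t" using ab(3) by (intro at_within_interior) (simp add: interior_atLeastAtMost_real)
  then have d: "((snd c \<circ> \<gamma>) has_vector_derivative d) (at t)" using D by simp
  have ct: "c \<in> charts_at atlas (\<gamma> t)" using c ab(3) by (auto simp: charts_at_def image_subset_iff)
  have "velocity atlas \<gamma> t = tangent_vector atlas (\<gamma> t) c d"
    using ab by (intro velocity_eq_tangent_vector[OF \<gamma> _ _ ct d]) auto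
  then show ?thesis
    by (simp add: spherical_metric_tangent_vector[OF ct] real_sqrt_mult norm_eq_sqrt_inner)
qed

lemma lift_has_vector_derivative:
  assumes W: "linear_isometry W" and \<xi>: "(\<xi> has_vector_derivative d) (at t within S)"
  shows "\<exists>e. ((\<lambda>t. W (stereo (\<xi> t))) has_vector_derivative e) (at t within S) \<and>
    e = W (conformal_factor (\<xi> t) *\<^sub>R T d - ((conformal_factor (\<xi> t))\<^sup>2 * inner (\<xi> t) d) *\<^sub>R (T (\<xi> t) - N)) \<and>
    norm e = conformal_factor (\<xi> t) * norm d"
proof -
  have "((stereo \<circ> \<xi>) has_vector_derivative
      (conformal_factor (\<xi> t) *\<^sub>R T d - ((conformal_factor (\<xi> t))\<^sup>2 * inner (\<xi> t) d) *\<^sub>R (T (\<xi> t) - N)))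
      (at t within S)"
    by (rule vector_derivative_diff_chain_within[OF \<xi> stereo_has_derivative])
  from bounded_linear.has_vector_derivative[OF linear_isometry_bounded_linear[OF W] this]
  show ?thesis
    by (simp add: o_def linear_isometry_norm[OF W] stereo_derivative_norm)
qed

text \<open>As \<open>stereo\<close> is conformal, the lift \<open>W (stereo (\<xi> t))\<close> of the piece to the sphere has the same speed.\<close>

lemma length_of_piece:
  assumes \<gamma>: "pathin quotient_topology \<gamma>" and ab: "0 \<le> a" "a < b" "b \<le> 1"
    and c: "c \<in> atlas" "\<gamma> ` {a..b} \<subseteq> fst c"
    and D: "continuous_on {a..b} D" "\<And>t. t \<in> {a..b} \<Longrightarrow> ((snd c \<circ> \<gamma>) has_vector_derivative D t) (at t within {a..b})"
  shows "\<exists>I. ((\<lambda>t. sqrt (spherical_metric (\<gamma> t) (velocity atlas \<gamma> t) (velocity atlas \<gamma> t))) has_integral I) {a..b} \<and>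
    orbit_angle (\<gamma> a) (\<gamma> b) \<le> I"
proof -
  obtain W r where W: "represents W r c" using c(1) by (rule atlas_E)
  have Wi: "linear_isometry W" using represents_isometry[OF W] by simp
  define \<xi> where "\<xi> = snd c \<circ> \<gamma>"
  define E where "E t = W (conformal_factor (\<xi> t) *\<^sub>R T (D t) - ((conformal_factor (\<xi> t))\<^sup>2 * inner (\<xi> t) (D t)) *\<^sub>R (T (\<xi> t) - N))" for t
  have E: "((\<lambda>t. W (stereo (\<xi> t))) has_vector_derivative E t) (at t within {a..b})"
    "norm (E t) = conformal_factor (\<xi> t) * norm (D t)" if "t \<in> {a..b}" for t
    using lift_has_vector_derivative[OF Wi, of \<xi> "D t" t "{a..b}"] D(2)[OF that] by (simp_all add: \<xi>_def E_def)
  have c\<xi>: "continuous_on {a..b} \<xi>"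
    using D(2) by (intro continuous_on_vector_derivative) (auto simp: \<xi>_def)
  have ccf: "continuous_on {a..b} (\<lambda>t. conformal_factor (\<xi> t))"
    using has_derivative_continuous_on[OF conformal_factor_has_derivative, of UNIV]
    by (rule continuous_on_compose2[OF _ c\<xi>]) auto
  have bl: "continuous_on {a..b} (\<lambda>t. L (f t))" if "linear_isometry L" "continuous_on {a..b} f"
    for L :: "'h \<Rightarrow> 'h" and f
    by (rule continuous_on_compose2[OF linear_continuous_on[OF linear_isometry_bounded_linear[OF that(1)]] that(2), of UNIV]) auto
  have cE: "continuous_on {a..b} E"
    unfolding E_def
    by (rule bl[OF Wi]) (intro continuous_intros ccf c\<xi> D(1) bl[OF T_isometry D(1)] bl[OF T_isometry c\<xi>])
  let ?I = "integral {a..b} (\<lambda>t. norm (E t))"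
  have "((\<lambda>t. norm (E t)) has_integral ?I) {a..b}"
    using cE by (intro integrable_integral integrable_continuous_interval continuous_intros)
  then have "((\<lambda>t. sqrt (spherical_metric (\<gamma> t) (velocity atlas \<gamma> t) (velocity atlas \<gamma> t))) has_integral ?I) (cbox a b)"
    unfolding box_real[symmetric]
  proof (rule has_integral_spike_interior)
    fix t assume "t \<in> box a b"
    then have t: "t \<in> {a<..<b}" "t \<in> {a..b}" by (auto simp: box_real)
    show "sqrt (spherical_metric (\<gamma> t) (velocity atlas \<gamma> t) (velocity atlas \<gamma> t)) = norm (E t)"
      using speed_in_chart[OF \<gamma> ab(1,3) t(1) c D(2)[OF t(2)]] E(2)[OF t(2)] by (simp add: \<xi>_def)
  qed
  moreover have "orbit_angle (\<gamma> a) (\<gamma> b) \<le> ?I"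
  proof -
    have g: "\<gamma> t = orbit (W (stereo (\<xi> t)))" "\<gamma> t \<in> orbits" if "t \<in> {a..b}" for t
    proof -
      have "\<gamma> t \<in> fst c" using c(2) that by auto
      then have "patch W (\<xi> t) = \<gamma> t" by (simp add: \<xi>_def patch_of_chart[OF W])
      then show "\<gamma> t = orbit (W (stereo (\<xi> t)))" "\<gamma> t \<in> orbits"
        using patch_in_orbits[OF Wi, of "\<xi> t"] by (simp_all add: patch_def)
    qed
    have m: "a \<in> {a..b}" "b \<in> {a..b}" using ab by auto
    have "orbit_angle (\<gamma> a) (\<gamma> b) \<le> angle (W (stereo (\<xi> a))) (W (stereo (\<xi> b)))"
      using g[OF m(1)] g[OF m(2)] self_in_orbit by (intro orbit_angle_le) auto
    also have "\<dots> \<le> ?I"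
      using ab by (intro angle_le_length cE E(1)) (auto simp: linear_isometry_norm[OF Wi])
    finally show ?thesis .
  qed
  ultimately show ?thesis by (auto simp: box_real)
qed

lemma orbit_angle_le_curve_length:
  assumes "piecewise_C1_curve quotient_topology atlas \<gamma>"
  shows "orbit_angle (\<gamma> 0) (\<gamma> 1) \<le> curve_length atlas spherical_metric \<gamma>"
proof -
  let ?f = "\<lambda>t. sqrt (spherical_metric (\<gamma> t) (velocity atlas \<gamma> t) (velocity atlas \<gamma> t))"
  have \<gamma>: "pathin quotient_topology \<gamma>" using assms by (simp add: piecewise_C1_curve_def)
  obtain n :: nat and s where s: "s 0 = 0" "s n = 1"
    and pc: "\<And>i. i < n \<Longrightarrow> s i < s (Suc i) \<and> (\<exists>c\<in>atlas. \<gamma> ` {s i..s (Suc i)} \<subseteq> fst c \<and>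
          (\<exists>D. continuous_on {s i..s (Suc i)} D \<and>
            (\<forall>t\<in>{s i..s (Suc i)}. ((snd c \<circ> \<gamma>) has_vector_derivative D t) (at t within {s i..s (Suc i)}))))"
    using assms unfolding piecewise_C1_curve_def by blast
  have lo: "i \<le> n \<Longrightarrow> 0 \<le> s i" for i
  proof (induction i)
    case (Suc i)
    then show ?case using pc[of i] by auto
  qed (simp add: s)
  have hi: "i \<le> n \<Longrightarrow> s i \<le> 1" for i
  proof (induction rule: inc_induct)
    case (step i)
    then show ?case using pc[of i] by auto
  qed (simp add: s)
  have "\<exists>I. (?f has_integral I) {s i..s (Suc i)} \<and> orbit_angle (\<gamma> (s i)) (\<gamma> (s (Suc i))) \<le> I" if i: "i < n" for i
  proof -
    obtain c D where "c \<in> atlas" "\<gamma> ` {s i..s (Suc i)} \<subseteq> fst c" "continuous_on {s i..s (Suc i)} D"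
      "\<And>t. t\<in>{s i..s (Suc i)} \<Longrightarrow> ((snd c \<circ> \<gamma>) has_vector_derivative D t) (at t within {s i..s (Suc i)})"
      using pc[OF i] by blast
    then show ?thesis using pc[OF i] lo[of i] hi[of "Suc i"] i by (intro length_of_piece[OF \<gamma>]) auto
  qed
  then have "\<forall>i. \<exists>I. i < n \<longrightarrow> (?f has_integral I) {s i..s (Suc i)} \<and> orbit_angle (\<gamma> (s i)) (\<gamma> (s (Suc i))) \<le> I"
    by blast
  from choice[OF this]
  obtain I where I: "\<And>i. i < n \<Longrightarrow> (?f has_integral I i) {s i..s (Suc i)}"
      "\<And>i. i < n \<Longrightarrow> orbit_angle (\<gamma> (s i)) (\<gamma> (s (Suc i))) \<le> I i"
    by blast
  have "(?f has_integral (\<Sum>i<n. I i)) {s 0..s n}"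
    using has_integral_subdivision[of n s ?f I] pc I(1) by blast
  then have len: "curve_length atlas spherical_metric \<gamma> = (\<Sum>i<n. I i)"
    unfolding s curve_length_def by (rule integral_unique)
  have orb: "\<gamma> (s i) \<in> orbits" if "i \<le> n" for i
    using path_image_subset_topspace[OF \<gamma>] lo[OF that] hi[OF that] by auto
  have "orbit_angle (\<gamma> (s 0)) (\<gamma> (s k)) \<le> (\<Sum>i<k. I i)" if "k \<le> n" for k
    using that
  proof (induction k)
    case 0
    then show ?case using orbit_angle_eq_0_iff[OF orb orb, of 0 0] by simp
  next
    case (Suc k)
    then show ?case
      using orbit_angle_triangle[OF orb orb orb, of 0 k "Suc k"] I(2)[of k] by simp
  qed
  from this[of n] show ?thesis unfolding s len by simp
qed

text \<open>
  In a chart that contains it, a piece of the projection of a curve on the sphere is given by the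
  stereographic formula, so it is continuously differentiable and has the same speed.
\<close>

lemma projected_piece:
  assumes W: "represents W r c"
    and \<eta>: "\<And>t. (\<eta> has_vector_derivative \<eta>' t) (at t)" "continuous_on UNIV \<eta>'"
    and inpatch: "\<eta> ` {a..b} \<subseteq> (\<lambda>x. W (stereo x)) ` ball 0 r"
  shows "(\<lambda>t. orbit (\<eta> t)) ` {a..b} \<subseteq> fst c \<and> (\<exists>D. continuous_on {a..b} D \<and>
    (\<forall>t\<in>{a..b}. ((snd c \<circ> (\<lambda>t. orbit (\<eta> t))) has_vector_derivative D t) (at t within {a..b})) \<and>
    (\<forall>t\<in>{a<..<b}. conformal_factor (snd c (orbit (\<eta> t))) * norm (D t) = norm (\<eta>' t)))"
proof -
  let ?W' = "inv_into UNIV W"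
  have Wi: "linear_isometry W" "surj W" using represents_isometry[OF W] by auto
  have W'i: "linear_isometry ?W'" by (rule linear_isometry_inv[OF Wi])
  note inv = linear_isometry_inverse[OF Wi]
  define \<zeta> where "\<zeta> t = ?W' (\<eta> t)" for t
  define \<xi> where "\<xi> t = stereo_inv (\<zeta> t)" for t
  have \<xi>: "\<xi> t \<in> ball 0 r" "\<eta> t = W (stereo (\<xi> t))" if t: "t \<in> {a..b}" for t
  proof -
    obtain x where x: "x \<in> ball 0 r" "\<eta> t = W (stereo x)" using inpatch t by blast
    then have "\<xi> t = x" by (simp add: \<xi>_def \<zeta>_def inv stereo_inv_stereo)
    then show "\<xi> t \<in> ball 0 r" "\<eta> t = W (stereo (\<xi> t))" using x by auto
  qed
  have orb: "orbit (\<eta> t) = patch W (\<xi> t)" "snd c (orbit (\<eta> t)) = \<xi> t" if "t \<in> {a..b}" for t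
    using chart_of_patch[OF W \<xi>(1)[OF that]] \<xi>(2)[OF that] by (simp_all add: patch_def)
  have \<zeta>N: "inner (\<zeta> t) N \<noteq> 1" if "t \<in> {a..b}" for t
    using stereo_N[of "\<xi> t"] by (simp add: \<zeta>_def \<xi>(2)[OF that] inv)
  define D where "D t = inverse (1 - inner (\<zeta> t) N) *\<^sub>R T_inv (?W' (\<eta>' t))
    + (inner (?W' (\<eta>' t)) N * (inverse (1 - inner (\<zeta> t) N))\<^sup>2) *\<^sub>R T_inv (\<zeta> t)" for t
  have d\<zeta>: "(\<zeta> has_vector_derivative ?W' (\<eta>' t)) (at t within {a..b})" for t
    unfolding \<zeta>_def
    by (rule bounded_linear.has_vector_derivative[OF linear_isometry_bounded_linear[OF W'i]
          has_vector_derivative_at_within[OF \<eta>(1)]])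
  have dD: "(\<xi> has_vector_derivative D t) (at t within {a..b})" if t: "t \<in> {a..b}" for t
  proof -
    have "((\<lambda>t. inner (\<zeta> t) N) has_real_derivative inner (?W' (\<eta>' t)) N) (at t within {a..b})"
      unfolding has_real_derivative_iff_has_vector_derivative
      by (rule bounded_linear.has_vector_derivative[OF bounded_linear_inner_left d\<zeta>])
    then have "((\<lambda>t. inverse (1 - inner (\<zeta> t) N)) has_real_derivative
        inner (?W' (\<eta>' t)) N * (inverse (1 - inner (\<zeta> t) N))\<^sup>2) (at t within {a..b})"
      using \<zeta>N[OF t] by (auto intro!: derivative_eq_intros simp: power2_eq_square)
    from has_vector_derivative_scaleR[OF this bounded_linear.has_vector_derivative[OF bounded_linear_T_inv d\<zeta>]]
    show ?thesis unfolding \<xi>_def stereo_inv_def D_def .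
  qed
  have cl: "continuous_on {a..b} (\<lambda>t. L (f t))" if "bounded_linear L" "continuous_on {a..b} f" for L :: "'h \<Rightarrow> 'h" and f
    by (rule continuous_on_compose2[OF linear_continuous_on[OF that(1)] that(2), of UNIV]) auto
  have c\<zeta>: "continuous_on {a..b} \<zeta>" using d\<zeta> by (rule continuous_on_vector_derivative)
  have c\<eta>': "continuous_on {a..b} \<eta>'" using \<eta>(2) by (rule continuous_on_subset) simp
  have cD: "continuous_on {a..b} D"
  proof -
    have 1: "continuous_on {a..b} (\<lambda>t. ?W' (\<eta>' t))" by (rule cl[OF linear_isometry_bounded_linear[OF W'i] c\<eta>'])
    have 2: "\<forall>t\<in>{a..b}. 1 - inner (\<zeta> t) N \<noteq> 0" using \<zeta>N by force
    show ?thesis unfolding D_def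
      by (intro continuous_intros 1 2 c\<zeta> cl[OF bounded_linear_T_inv 1] cl[OF bounded_linear_T_inv c\<zeta>])
  qed
  have sp: "conformal_factor (\<xi> t) * norm (D t) = norm (\<eta>' t)" if t: "t \<in> {a<..<b}" for t
  proof -
    have t': "t \<in> {a..b}" and i: "at t within {a..b} = at t"
      using t by (auto intro!: at_within_interior simp: interior_atLeastAtMost_real)
    obtain e where e: "((\<lambda>t. W (stereo (\<xi> t))) has_vector_derivative e) (at t within {a..b})"
      "norm e = conformal_factor (\<xi> t) * norm (D t)"
      using lift_has_vector_derivative[OF Wi(1) dD[OF t']] by blast
    have "(\<eta> has_vector_derivative e) (at t within {a..b})"
      using t' \<xi>(2) e(1) by (rule has_vector_derivative_transform)
    then have "e = \<eta>' t" using \<eta>(1)[of t] unfolding i by (rule vector_derivative_unique_at)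
    then show ?thesis using e(2) by simp
  qed
  show ?thesis
  proof (intro conjI exI[of _ D] ballI)
    show "(\<lambda>t. orbit (\<eta> t)) ` {a..b} \<subseteq> fst c"
    proof
      fix p assume "p \<in> (\<lambda>t. orbit (\<eta> t)) ` {a..b}"
      then obtain t where "t \<in> {a..b}" "p = orbit (\<eta> t)" by blast
      then show "p \<in> fst c" using orb(1)[of t] \<xi>(1)[of t] chart_domain[OF W] by blast
    qed
    show "continuous_on {a..b} D" by (rule cD)
    show "((snd c \<circ> (\<lambda>t. orbit (\<eta> t))) has_vector_derivative D t) (at t within {a..b})" if "t \<in> {a..b}" for t
      by (rule has_vector_derivative_transform[OF that _ dD[OF that]]) (simp add: orb(2))
    show "conformal_factor (snd c (orbit (\<eta> t))) * norm (D t) = norm (\<eta>' t)" if t: "t \<in> {a<..<b}" for t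
      using sp[OF t] t by (simp add: orb(2))
  qed
qed

text \<open>By a Lebesgue number argument, the pieces of a fine subdivision of the curve lie in single patches.\<close>

lemma projected_curve_length:
  assumes \<eta>: "\<And>t. (\<eta> has_vector_derivative \<eta>' t) (at t)" "continuous_on UNIV \<eta>'"
    and unit: "\<And>t. norm (\<eta> t) = 1" and speed: "\<And>t. norm (\<eta>' t) = \<theta>"
  shows "piecewise_C1_curve quotient_topology atlas (\<lambda>t. orbit (\<eta> t))"
    and "curve_length atlas spherical_metric (\<lambda>t. orbit (\<eta> t)) = \<theta>"
proof -
  let ?\<gamma> = "\<lambda>t. orbit (\<eta> t)"
  have c\<eta>: "continuous_on S \<eta>" for S
    using has_vector_derivative_at_within[OF \<eta>(1)] by (rule continuous_on_vector_derivative)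
  have path: "pathin quotient_topology ?\<gamma>"
    using continuous_map_compose[OF _ continuous_map_orbit, of "top_of_set {0..1}" \<eta>] c\<eta> unit
    by (simp add: pathin_def o_def continuous_map_in_subtopology image_subset_iff)
  define \<C> where "\<C> = {{t. \<eta> t \<in> (\<lambda>x. W (stereo x)) ` ball 0 r} | W r. chart_data W r}"
  have "\<exists>\<delta>>0. \<forall>J. J \<subseteq> {0..1} \<and> diameter J < \<delta> \<longrightarrow> (\<exists>B\<in>\<C>. J \<subseteq> B)"
  proof -
    have open_C: "open B" if "B \<in> \<C>" for B
    proof -
      obtain W r where W: "chart_data W r" "B = {t. \<eta> t \<in> (\<lambda>x. W (stereo x)) ` ball 0 r}"
        using \<open>B \<in> \<C>\<close> unfolding \<C>_def by blast
      have "openin (top_of_set (sphere 0 1)) ((\<lambda>x. W (stereo x)) ` ball 0 r)"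
        using W(1) by (intro open_placed_stereo) (auto simp: chart_data_def)
      moreover have "continuous_map (top_of_set UNIV) (top_of_set (sphere 0 1)) \<eta>"
        using c\<eta> unit by (simp add: continuous_map_in_subtopology image_subset_iff)
      ultimately have "openin (top_of_set UNIV) {t \<in> topspace (top_of_set UNIV). \<eta> t \<in> (\<lambda>x. W (stereo x)) ` ball 0 r}"
        by (intro openin_continuous_map_preimage)
      then show ?thesis using W(2) by simp
    qed
    have cov: "{0..1} \<subseteq> \<Union>\<C>"
    proof
      fix t :: real
      obtain W r where W: "chart_data W r" "W (stereo 0) = \<eta> t" using chart_around[OF unit] by blast
      have "t \<in> {t. \<eta> t \<in> (\<lambda>x. W (stereo x)) ` ball 0 r}"
        using W by (auto simp: chart_data_def intro!: image_eqI[of _ _ 0])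
      then show "t \<in> \<Union>\<C>" using W(1) unfolding \<C>_def by blast
    qed
    then have "\<C> \<noteq> {}" by auto
    then obtain \<delta> where "0 < \<delta>" "\<And>J. J \<subseteq> {0..1} \<Longrightarrow> diameter J < \<delta> \<Longrightarrow> \<exists>B\<in>\<C>. J \<subseteq> B"
      using Lebesgue_number_lemma[OF compact_Icc _ cov open_C] by metis
    then show ?thesis by blast
  qed
  then obtain \<delta> where \<delta>: "\<delta> > 0" "\<And>J. J \<subseteq> {0..1} \<Longrightarrow> diameter J < \<delta> \<Longrightarrow> \<exists>B\<in>\<C>. J \<subseteq> B" by blast
  obtain n0 :: nat where n0: "1 / \<delta> < real n0" using reals_Archimedean2 by blast
  define n where "n = Suc n0"
  have n: "n > 0" "1 / real n < \<delta>"
    using n0 \<delta>(1) by (auto simp: n_def divide_less_eq mult.commute intro: less_trans)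
  define s where "s i = real i / real n" for i
  have s: "s 0 = 0" "s n = 1" "s i < s (Suc i)" "s (Suc i) - s i = 1 / real n" for i
    using n(1) by (auto simp: s_def field_simps)
  have s01: "0 \<le> s i" "s (Suc i) \<le> 1" if "i < n" for i
    using that n(1) by (auto simp: s_def field_simps)
  have piece: "\<exists>c\<in>atlas. ?\<gamma> ` {s i..s (Suc i)} \<subseteq> fst c \<and> (\<exists>D. continuous_on {s i..s (Suc i)} D \<and>
    (\<forall>t\<in>{s i..s (Suc i)}. ((snd c \<circ> ?\<gamma>) has_vector_derivative D t) (at t within {s i..s (Suc i)})) \<and>
    (\<forall>t\<in>{s i<..<s (Suc i)}. conformal_factor (snd c (?\<gamma> t)) * norm (D t) = norm (\<eta>' t)))" if i: "i < n" for i
  proof -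
    have "{s i..s (Suc i)} \<subseteq> {0..1}" using s01[OF i] by auto
    moreover have "diameter {s i..s (Suc i)} < \<delta>" using n s(3,4)[of i] by simp
    ultimately obtain B where "B \<in> \<C>" "{s i..s (Suc i)} \<subseteq> B" using \<delta>(2) by blast
    then obtain W r where W: "chart_data W r" "\<eta> ` {s i..s (Suc i)} \<subseteq> (\<lambda>x. W (stereo x)) ` ball 0 r"
      unfolding \<C>_def by blast
    have rep: "represents W r (patch W ` ball 0 r, inv_into (ball 0 r) (patch W))"
      using W(1) by (simp add: represents_def)
    from projected_piece[OF rep \<eta> W(2)] represents_atlas[OF rep] show ?thesis by blast
  qed
  show "piecewise_C1_curve quotient_topology atlas ?\<gamma>"
    unfolding piecewise_C1_curve_def
  proof (intro conjI path exI[of _ n] exI[of _ s] allI impI)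
    fix i assume i: "i < n"
    show "\<exists>c\<in>atlas. ?\<gamma> ` {s i..s (Suc i)} \<subseteq> fst c \<and> (\<exists>D. continuous_on {s i..s (Suc i)} D \<and>
      (\<forall>t\<in>{s i..s (Suc i)}. ((snd c \<circ> ?\<gamma>) has_vector_derivative D t) (at t within {s i..s (Suc i)})))"
      using piece[OF i] by blast
  qed (use s in auto)
  let ?f = "\<lambda>t. sqrt (spherical_metric (?\<gamma> t) (velocity atlas ?\<gamma> t) (velocity atlas ?\<gamma> t))"
  have "(?f has_integral (\<theta> * (1 / real n))) {s i..s (Suc i)}" if i: "i < n" for i
  proof -
    obtain c D where c: "c \<in> atlas" "?\<gamma> ` {s i..s (Suc i)} \<subseteq> fst c"
      and D: "\<And>t. t\<in>{s i..s (Suc i)} \<Longrightarrow> ((snd c \<circ> ?\<gamma>) has_vector_derivative D t) (at t within {s i..s (Suc i)})"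
        "\<And>t. t\<in>{s i<..<s (Suc i)} \<Longrightarrow> conformal_factor (snd c (?\<gamma> t)) * norm (D t) = norm (\<eta>' t)"
      using piece[OF i] by blast
    have "((\<lambda>_. \<theta>) has_integral (\<theta> * (1 / real n))) (cbox (s i) (s (Suc i)))"
      using has_integral_const_real[of \<theta> "s i" "s (Suc i)"] s(3,4)[of i] by (simp add: mult.commute)
    then have "(?f has_integral (\<theta> * (1 / real n))) (cbox (s i) (s (Suc i)))"
    proof (rule has_integral_spike_interior)
      fix t assume "t \<in> box (s i) (s (Suc i))"
      then have t: "t \<in> {s i<..<s (Suc i)}" "t \<in> {s i..s (Suc i)}" by (auto simp: box_real)
      show "?f t = \<theta>"
        using speed_in_chart[OF path s01(1)[OF i] s01(2)[OF i] t(1) c D(1)[OF t(2)]] D(2)[OF t(1)] speed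
        by simp
    qed
    then show ?thesis by simp
  qed
  then have "(?f has_integral (\<Sum>i<n. \<theta> * (1 / real n))) {s 0..s n}"
    using has_integral_subdivision[of n s ?f "\<lambda>_. \<theta> * (1 / real n)"] s(3) by blast
  then have "(?f has_integral \<theta>) {0..1}" using n(1) s(1,2) by simp
  then show "curve_length atlas spherical_metric ?\<gamma> = \<theta>"
    unfolding curve_length_def by (rule integral_unique)
qed

lemma great_circle_curve:
  assumes x: "norm x = 1" and y: "norm y = 1"
  shows "\<exists>\<gamma>. piecewise_C1_curve quotient_topology atlas \<gamma> \<and> \<gamma> 0 = orbit x \<and> \<gamma> 1 = orbit y \<and>
    curve_length atlas spherical_metric \<gamma> = angle x y"
proof -
  obtain W :: "'h \<Rightarrow> 'h" where W: "linear_isometry W" "W N = x"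
    using linear_isometry_transitive[OF N_unit x] by blast
  have "norm (W (T N)) = 1" "inner x (W (T N)) = 0"
    using linear_isometry_inner[OF W(1), of N "T N"] W(2) T_N N_unit
    by (simp_all add: linear_isometry_norm[OF W(1)] linear_isometry_norm[OF T_isometry])
  from great_circle_direction[OF x y this]
  obtain u where u: "norm u = 1" "inner x u = 0" "y = cos (angle x y) *\<^sub>R x + sin (angle x y) *\<^sub>R u" by blast
  define \<theta> where "\<theta> = angle x y"
  define \<eta> where "\<eta> t = cos (\<theta> * t) *\<^sub>R x + sin (\<theta> * t) *\<^sub>R u" for t
  define \<eta>' where "\<eta>' t = \<theta> *\<^sub>R (- sin (\<theta> * t) *\<^sub>R x + cos (\<theta> * t) *\<^sub>R u)" for t
  have \<theta>: "\<theta> \<ge> 0" using angle_nonneg[OF x y] by (simp add: \<theta>_def)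
  have d: "(\<eta> has_vector_derivative \<eta>' t) (at t)" for t
    unfolding \<eta>_def \<eta>'_def
    by (auto intro!: derivative_eq_intros simp: has_real_derivative_iff_has_vector_derivative[symmetric] algebra_simps)
  have c: "continuous_on UNIV \<eta>'" unfolding \<eta>'_def by (intro continuous_intros)
  have n: "norm (\<eta> t) = 1" "norm (\<eta>' t) = \<theta>" for t
    using great_circle_norm[OF x u(1,2), of "\<theta> * t"] \<theta> unfolding \<eta>_def \<eta>'_def by (simp_all only: norm_scaleR)
  have "\<eta> 0 = x" "\<eta> 1 = y" using u(3) by (simp_all add: \<eta>_def \<theta>_def)
  then show ?thesis
    using projected_curve_length[OF d c n] by (intro exI[of _ "\<lambda>t. orbit (\<eta> t)"]) (simp add: \<theta>_def)
qed

text \<open>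
  Every curve is at least as long as the angle between the orbits of its ends, and projected great
  circle arcs have exactly the angles between representatives as their lengths.
\<close>

lemma riemannian_dist_eq_orbit_angle:
  "riemannian_dist quotient_topology atlas spherical_metric p q =
    (if p \<in> orbits \<and> q \<in> orbits then orbit_angle p q else 0)"
proof (cases "p \<in> orbits \<and> q \<in> orbits")
  case True
  then have p: "p \<in> orbits" and q: "q \<in> orbits" by auto
  let ?L = "{curve_length atlas spherical_metric \<gamma> | \<gamma>.
      piecewise_C1_curve quotient_topology atlas \<gamma> \<and> \<gamma> 0 = p \<and> \<gamma> 1 = q}"
  have lower: "orbit_angle p q \<le> l" if "l \<in> ?L" for l
    using that orbit_angle_le_curve_length by auto
  have upper: "angle x y \<in> ?L" if "x \<in> p" "y \<in> q" for x y
  proof -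
    have "norm x = 1" "orbit x = p" "norm y = 1" "orbit y = q" using that p q by (simp_all add: orbits_member)
    then obtain \<gamma> where "piecewise_C1_curve quotient_topology atlas \<gamma>" "\<gamma> 0 = p" "\<gamma> 1 = q"
        "curve_length atlas spherical_metric \<gamma> = angle x y"
      using great_circle_curve[of x y] by blast
    then show ?thesis by (intro CollectI exI[of _ \<gamma>]) simp
  qed
  obtain x y where xy: "x \<in> p" "y \<in> q" using orbits_nonempty p q by blast
  have "Inf ?L = orbit_angle p q"
  proof (rule antisym)
    show "orbit_angle p q \<le> Inf ?L" using upper[OF xy] lower by (intro cInf_greatest) auto
    show "Inf ?L \<le> orbit_angle p q"
    proof (rule field_le_epsilon)
      fix e :: real assume "e > 0"
      then obtain y' where y': "y' \<in> q" "angle x y' < orbit_angle p q + e"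
        using orbit_angle_attained_nearly[OF p q xy(1), of "orbit_angle p q + e"] by auto
      have "Inf ?L \<le> angle x y'"
        using upper[OF xy(1) y'(1)] lower by (intro cInf_lower bdd_belowI[of _ "orbit_angle p q"]) auto
      then show "Inf ?L \<le> orbit_angle p q + e" using y'(2) by simp
    qed
  qed
  then show ?thesis using True by (simp add: riemannian_dist_def)
qed (auto simp: riemannian_dist_def)

theorem complete_riemannian_quotient: "complete_riemannian quotient_topology atlas spherical_metric"
proof -
  have "riemannian_dist quotient_topology atlas spherical_metric =
      (\<lambda>p q. if p \<in> orbits \<and> q \<in> orbits then orbit_angle p q else 0)"
    by (intro ext) (rule riemannian_dist_eq_orbit_angle)
  then show ?thesis
    using Metric_space_orbit_angle mcomplete_orbit_angle by (simp add: complete_riemannian_def)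
qed

end

section \<open>The fundamental group of the quotient\<close>

context sphere_quotient
begin

definition embedded_quotient :: "('h \<Rightarrow>\<^sub>C real) set" where
  "embedded_quotient = orbit_distance ` orbits"

lemma embedding_continuous: "continuous_map quotient_topology (top_of_set embedded_quotient) orbit_distance"
proof -
  have "continuous_map quotient_topology euclidean (id \<circ> orbit_distance)"
    unfolding quotient_topology_def by (rule continuous_map_pullback) (simp add: id_def)
  then show ?thesis by (simp add: continuous_map_in_subtopology embedded_quotient_def)
qed

lemma embedding_inverse:
  assumes "p \<in> orbits"
  shows "inv_into orbits orbit_distance (orbit_distance p) = p"
  by (rule inv_into_f_f[OF inj_orbit_distance assms])

lemma embedding_inverse_continuous:
  "continuous_map (top_of_set embedded_quotient) quotient_topology (inv_into orbits orbit_distance)"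
  unfolding quotient_topology_def
proof (rule continuous_map_pullback')
  have "continuous_on embedded_quotient (orbit_distance \<circ> inv_into orbits orbit_distance)"
    by (rule continuous_on_eq[OF continuous_on_id]) (simp add: embedded_quotient_def f_inv_into_f)
  then show "continuous_map (top_of_set embedded_quotient) euclidean (orbit_distance \<circ> inv_into orbits orbit_distance)"
    by simp
qed (auto simp: embedded_quotient_def inv_into_into)

definition projection :: "'h \<Rightarrow> ('h \<Rightarrow>\<^sub>C real)" where
  "projection x = orbit_distance (orbit x)"

lemma projection_image: "projection ` sphere 0 1 = embedded_quotient"
  by (auto simp: projection_def[abs_def] embedded_quotient_def orbits_def image_image)

lemma continuous_projection: "continuous_on S projection"
  unfolding continuous_on_iff projection_def
  using orbit_distance_lipschitz by (auto simp: dist_norm intro: le_less_trans)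

lemma projection_eq_iff:
  "norm x = 1 \<Longrightarrow> norm y = 1 \<Longrightarrow> projection x = projection y \<longleftrightarrow> (\<exists>g\<in>carrier G. x = \<rho> g y)"
  using inj_on_eq_iff[OF inj_orbit_distance orbit_in_orbits orbit_in_orbits]
  by (simp add: projection_def orbit_eq_iff)

lemma open_map_projection:
  assumes "openin (top_of_set (sphere 0 1)) V"
  shows "openin (top_of_set embedded_quotient) (projection ` V)"
proof -
  have "openin quotient_topology (orbit ` V)" using open_map_orbit assms by (simp add: open_map_def)
  then obtain U where U: "open U" "orbit ` V = orbit_distance -` U \<inter> orbits"
    unfolding quotient_topology_def openin_pullback_topology by auto
  have "projection ` V = orbit_distance ` (orbit ` V)" by (simp add: projection_def[abs_def] image_image)
  also have "\<dots> = embedded_quotient \<inter> U" unfolding U(2) embedded_quotient_def by auto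
  finally show ?thesis using U(1) by (auto simp: openin_open)
qed

text \<open>The sheets over the image of a wandering ball are the disjoint translates of this ball.\<close>

lemma covering_sphere: "covering_space (sphere 0 1) projection embedded_quotient"
proof
  show "continuous_on (sphere 0 1) projection" by (rule continuous_projection)
  show "projection ` sphere 0 1 = embedded_quotient" by (rule projection_image)
  fix p assume "p \<in> embedded_quotient"
  then obtain x where x: "norm x = 1" "p = projection x" unfolding projection_image[symmetric] by auto
  obtain e where e: "e > 0" "\<And>y z g. g \<in> carrier G \<Longrightarrow> norm (y - x) < e \<Longrightarrow> norm (z - x) < e \<Longrightarrow> z = \<rho> g y \<Longrightarrow> g = \<one>"
    using wandering_neighbourhood[OF x(1)] by blast
  define U where "U = sphere 0 1 \<inter> ball x e"
  have U: "y \<in> U \<longleftrightarrow> norm y = 1 \<and> norm (y - x) < e" for y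
    by (auto simp: U_def dist_norm norm_minus_commute)
  have oU: "openin (top_of_set (sphere 0 1)) U" by (auto simp: U_def openin_open)
  define T where "T = projection ` U"
  define v where "v = (\<lambda>g. \<rho> g ` U) ` carrier G"
  have tr: "\<rho> g ` U = sphere 0 1 \<inter> ball (\<rho> g x) e" if g: "g \<in> carrier G" for g
  proof
    show "\<rho> g ` U \<subseteq> sphere 0 1 \<inter> ball (\<rho> g x) e"
      using g by (auto simp: U_def \<rho>_norm dist_norm \<rho>_dist)
    show "sphere 0 1 \<inter> ball (\<rho> g x) e \<subseteq> \<rho> g ` U"
    proof
      fix z assume z: "z \<in> sphere 0 1 \<inter> ball (\<rho> g x) e"
      have "norm (\<rho> (m_inv G g) z - x) = norm (\<rho> g (\<rho> (m_inv G g) z) - \<rho> g x)" using g by (simp add: \<rho>_dist)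
      then have "\<rho> (m_inv G g) z \<in> U"
        using z g by (simp add: U \<rho>_inverse \<rho>_norm dist_norm norm_minus_commute)
      then show "z \<in> \<rho> g ` U" using \<rho>_inverse(2)[OF g, of z] by (metis image_eqI)
    qed
  qed
  have same: "g = h" if gh: "g \<in> carrier G" "h \<in> carrier G" and yz: "y \<in> U" "z \<in> U" "\<rho> g y = \<rho> h z" for g h y z
  proof -
    have "z = \<rho> (m_inv G h \<otimes> g) y" using gh yz(3) by (simp add: \<rho>_mult \<rho>_inverse)
    then have "m_inv G h \<otimes> g = \<one>" using e(2)[of "m_inv G h \<otimes> g" y z] gh yz(1,2) by (simp add: U)
    then show ?thesis using gh by (metis inv_closed inv_equality inv_inv)
  qed
  have "\<Union>v = sphere 0 1 \<inter> projection -` T"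
  proof (intro equalityI subsetI)
    fix z assume "z \<in> \<Union>v"
    then obtain g y where g: "g \<in> carrier G" "y \<in> U" "z = \<rho> g y" by (auto simp: v_def)
    then show "z \<in> sphere 0 1 \<inter> projection -` T"
      by (auto simp: T_def U projection_def orbit_\<rho> \<rho>_norm)
  next
    fix z assume "z \<in> sphere 0 1 \<inter> projection -` T"
    then obtain y where y: "norm z = 1" "y \<in> U" "projection z = projection y" by (auto simp: T_def)
    then obtain g where "g \<in> carrier G" "z = \<rho> g y" using projection_eq_iff[of z y] by (auto simp: U)
    then show "z \<in> \<Union>v" using y(2) by (auto simp: v_def)
  qed
  moreover have "openin (top_of_set (sphere 0 1)) u" if "u \<in> v" for u
    using that by (auto simp: v_def tr openin_open)
  moreover have "pairwise disjnt v"
    unfolding pairwise_def disjnt_iff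
  proof (intro ballI impI allI notI)
    fix u w z assume uw: "u \<in> v" "w \<in> v" "u \<noteq> w" and z: "z \<in> u \<and> z \<in> w"
    then obtain g h where gh: "g \<in> carrier G" "h \<in> carrier G" "u = \<rho> g ` U" "w = \<rho> h ` U" by (auto simp: v_def)
    then have "g = h" using z same[OF gh(1,2)] by auto
    then show False using uw(3) gh by simp
  qed
  moreover have "\<exists>q. homeomorphism u T projection q" if u: "u \<in> v" for u
  proof -
    obtain g where g: "g \<in> carrier G" "u = \<rho> g ` U" using u by (auto simp: v_def)
    have ou: "openin (top_of_set (sphere 0 1)) u" using g by (auto simp: tr openin_open)
    have im: "projection ` u = T" using g by (auto simp: T_def image_image projection_def orbit_\<rho>)
    have "inj_on projection u"
    proof (rule inj_onI)
      fix a b assume ab: "a \<in> u" "b \<in> u" "projection a = projection b"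
      then obtain y z where yz: "y \<in> U" "z \<in> U" "a = \<rho> g y" "b = \<rho> g z" using g by auto
      then have "norm a = 1" "norm b = 1" using g by (auto simp: U \<rho>_norm)
      then obtain h where h: "h \<in> carrier G" "a = \<rho> h b" using ab(3) projection_eq_iff by blast
      then have "g = h \<otimes> g" using yz g(1) by (intro same[of g "h \<otimes> g" y z]) (auto simp: \<rho>_mult)
      then have "h = \<one>" using h(1) g(1) by (metis r_cancel_one')
      then show "a = b" using h(2) by (simp add: \<rho>_one)
    qed
    moreover have "openin (top_of_set T) (projection ` V)" if "openin (top_of_set u) V" for V
    proof -
      have "openin (top_of_set (sphere 0 1)) V" using that ou by (rule openin_trans)
      then have "openin (top_of_set embedded_quotient) (projection ` V)" by (rule open_map_projection)
      moreover have "projection ` V \<subseteq> T" "T \<subseteq> embedded_quotient"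
        using openin_imp_subset[OF that] im openin_imp_subset[OF oU] projection_image unfolding T_def by blast+
      ultimately show ?thesis by (rule openin_subset_trans)
    qed
    ultimately show ?thesis
      using homeomorphism_injective_open_map[OF continuous_projection im] by metis
  qed
  ultimately show "\<exists>T. p \<in> T \<and> openin (top_of_set embedded_quotient) T \<and>
      (\<exists>v. \<Union>v = sphere 0 1 \<inter> projection -` T \<and> (\<forall>u\<in>v. openin (top_of_set (sphere 0 1)) u) \<and>
        pairwise disjnt v \<and> (\<forall>u\<in>v. \<exists>q. homeomorphism u T projection q))"
    using open_map_projection[OF oU] x e(1)
    by (intro exI[of _ T] conjI exI[of _ v]) (auto simp: T_def U)
qed

subsection \<open>Loops and their classes\<close>

abbreviation loop_homotopic :: "'h set \<Rightarrow> (real \<Rightarrow> 'h set) \<Rightarrow> (real \<Rightarrow> 'h set) \<Rightarrow> bool" where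
  "loop_homotopic a \<equiv> homotopic_with (\<lambda>h. h 0 = a \<and> h 1 = a) (top_of_set {0..1}) quotient_topology"

lemma loop_homotopic_refl: "\<gamma> \<in> loops_at quotient_topology a \<Longrightarrow> loop_homotopic a \<gamma> \<gamma>"
  by (simp add: loops_at_def pathin_def)

lemma loop_homotopic_loops:
  assumes "loop_homotopic a \<gamma> \<delta>"
  shows "\<gamma> \<in> loops_at quotient_topology a" "\<delta> \<in> loops_at quotient_topology a"
  using homotopic_with_imp_continuous_maps[OF assms] homotopic_with_imp_property[OF assms]
  by (simp_all add: loops_at_def pathin_def)

lemma loop_class_eq_iff:
  assumes "\<gamma> \<in> loops_at quotient_topology a"
  shows "loop_class quotient_topology a \<gamma> = loop_class quotient_topology a \<delta> \<longleftrightarrow> loop_homotopic a \<gamma> \<delta>"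
proof
  assume "loop_class quotient_topology a \<gamma> = loop_class quotient_topology a \<delta>"
  then have "\<gamma> \<in> loop_class quotient_topology a \<delta>"
    using loop_homotopic_refl[OF assms] unfolding loop_class_def by blast
  then show "loop_homotopic a \<gamma> \<delta>" unfolding loop_class_def by (simp add: homotopic_with_symD)
next
  assume h: "loop_homotopic a \<gamma> \<delta>"
  show "loop_class quotient_topology a \<gamma> = loop_class quotient_topology a \<delta>"
    unfolding loop_class_def
    using homotopic_with_trans[OF h] homotopic_with_trans[OF homotopic_with_symD[OF h]] by blast
qed

lemma loop_homotopic_if_equal:
  assumes "\<gamma> \<in> loops_at quotient_topology a" "\<And>t. t \<in> {0..1} \<Longrightarrow> \<gamma> t = \<delta> t"
  shows "loop_homotopic a \<gamma> \<delta>"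
  using assms by (intro homotopic_with_equal) (auto simp: loops_at_def pathin_def)

lemma loop_path:
  assumes "\<gamma> \<in> loops_at quotient_topology a"
  shows "path (orbit_distance \<circ> \<gamma>)" "path_image (orbit_distance \<circ> \<gamma>) \<subseteq> embedded_quotient"
    "pathstart (orbit_distance \<circ> \<gamma>) = orbit_distance a" "pathfinish (orbit_distance \<circ> \<gamma>) = orbit_distance a"
    "\<And>t. t \<in> {0..1} \<Longrightarrow> \<gamma> t \<in> orbits"
proof -
  have g: "continuous_map (top_of_set {0..1}) quotient_topology \<gamma>" "\<gamma> 0 = a" "\<gamma> 1 = a"
    using assms by (simp_all add: loops_at_def pathin_def)
  from continuous_map_compose[OF g(1) embedding_continuous]
  show "path (orbit_distance \<circ> \<gamma>)" "path_image (orbit_distance \<circ> \<gamma>) \<subseteq> embedded_quotient"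
    by (auto simp: continuous_map_in_subtopology path_def path_image_def)
  show "pathstart (orbit_distance \<circ> \<gamma>) = orbit_distance a" "pathfinish (orbit_distance \<circ> \<gamma>) = orbit_distance a"
    using g by (simp_all add: pathstart_def pathfinish_def)
  show "\<gamma> t \<in> orbits" if "t \<in> {0..1}" for t
    using continuous_map_image_subset_topspace[OF g(1)] that by auto
qed

text \<open>
  The embedding by distance functions is a homeomorphism onto its image, which transports homotopies of
  loops in both directions.
\<close>

lemma loop_homotopic_iff:
  assumes \<gamma>: "\<gamma> \<in> loops_at quotient_topology a" and \<delta>: "\<delta> \<in> loops_at quotient_topology a"
  shows "loop_homotopic a \<gamma> \<delta> \<longleftrightarrow> homotopic_paths embedded_quotient (orbit_distance \<circ> \<gamma>) (orbit_distance \<circ> \<delta>)"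
proof
  assume "loop_homotopic a \<gamma> \<delta>"
  then show "homotopic_paths embedded_quotient (orbit_distance \<circ> \<gamma>) (orbit_distance \<circ> \<delta>)"
    unfolding homotopic_paths_def
    by (rule homotopic_with_compose_continuous_map_left[OF _ embedding_continuous])
       (use \<gamma> in \<open>simp add: loops_at_def pathstart_def pathfinish_def\<close>)
next
  let ?k = "inv_into orbits orbit_distance"
  have a: "a \<in> orbits" using loop_path(5)[OF \<gamma>, of 0] \<gamma> by (simp add: loops_at_def)
  assume "homotopic_paths embedded_quotient (orbit_distance \<circ> \<gamma>) (orbit_distance \<circ> \<delta>)"
  then have "loop_homotopic a (?k \<circ> (orbit_distance \<circ> \<gamma>)) (?k \<circ> (orbit_distance \<circ> \<delta>))"
    unfolding homotopic_paths_def loop_path(3,4)[OF \<gamma>]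
    by (rule homotopic_with_compose_continuous_map_left[OF _ embedding_inverse_continuous])
       (simp add: pathstart_def pathfinish_def embedding_inverse[OF a])
  moreover have "loop_homotopic a \<gamma> (?k \<circ> (orbit_distance \<circ> \<gamma>))"
    by (rule loop_homotopic_if_equal[OF \<gamma>]) (simp add: embedding_inverse[OF loop_path(5)[OF \<gamma>]])
  moreover have "loop_homotopic a (?k \<circ> (orbit_distance \<circ> \<delta>)) \<delta>"
    by (rule homotopic_with_symD, rule loop_homotopic_if_equal[OF \<delta>])
       (simp add: embedding_inverse[OF loop_path(5)[OF \<delta>]])
  ultimately show "loop_homotopic a \<gamma> \<delta>" using homotopic_with_trans by blast
qed

lemma embed_loop_join: "orbit_distance \<circ> loop_join \<gamma> \<delta> = (orbit_distance \<circ> \<gamma>) +++ (orbit_distance \<circ> \<delta>)"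
  by (auto simp: loop_join_def joinpaths_def)

lemma loopI:
  assumes "path (orbit_distance \<circ> \<gamma>)" "\<And>t. t \<in> {0..1} \<Longrightarrow> \<gamma> t \<in> orbits" "\<gamma> 0 = a" "\<gamma> 1 = a"
  shows "\<gamma> \<in> loops_at quotient_topology a"
  using assms unfolding loops_at_def pathin_def quotient_topology_def path_def
  by (auto intro!: continuous_map_pullback')

lemma loop_join_loop:
  assumes "\<gamma> \<in> loops_at quotient_topology a" "\<delta> \<in> loops_at quotient_topology a"
  shows "loop_join \<gamma> \<delta> \<in> loops_at quotient_topology a"
proof (rule loopI)
  show "path (orbit_distance \<circ> loop_join \<gamma> \<delta>)"
    unfolding embed_loop_join using loop_path[OF assms(1)] loop_path[OF assms(2)] by (intro path_join_imp) auto
  show "loop_join \<gamma> \<delta> t \<in> orbits" if "t \<in> {0..1}" for t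
    using that loop_path(5)[OF assms(1), of "2 * t"] loop_path(5)[OF assms(2), of "2 * t - 1"]
    by (auto simp: loop_join_def)
qed (use assms in \<open>auto simp: loop_join_def loops_at_def\<close>)

lemma loop_join_homotopic:
  assumes "loop_homotopic a \<gamma> \<gamma>'" "loop_homotopic a \<delta> \<delta>'"
  shows "loop_homotopic a (loop_join \<gamma> \<delta>) (loop_join \<gamma>' \<delta>')"
proof -
  note l = loop_homotopic_loops[OF assms(1)] loop_homotopic_loops[OF assms(2)]
  have "homotopic_paths embedded_quotient ((orbit_distance \<circ> \<gamma>) +++ (orbit_distance \<circ> \<delta>))
      ((orbit_distance \<circ> \<gamma>') +++ (orbit_distance \<circ> \<delta>'))"
    using assms l by (intro homotopic_paths_join) (simp_all add: loop_homotopic_iff loop_path)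
  then show ?thesis using l by (subst loop_homotopic_iff) (simp_all add: loop_join_loop embed_loop_join)
qed

lemma mult_loop_class:
  assumes "\<gamma> \<in> loops_at quotient_topology a" "\<delta> \<in> loops_at quotient_topology a"
  shows "loop_class quotient_topology a \<gamma> \<otimes>\<^bsub>fundamental_group quotient_topology a\<^esub> loop_class quotient_topology a \<delta>
    = loop_class quotient_topology a (loop_join \<gamma> \<delta>)"
proof -
  let ?C = "loop_class quotient_topology a"
  have "?C (loop_join \<gamma>' \<delta>') = ?C (loop_join \<gamma> \<delta>)" if "\<gamma>' \<in> ?C \<gamma>" "\<delta>' \<in> ?C \<delta>" for \<gamma>' \<delta>'
  proof -
    have "loop_homotopic a (loop_join \<gamma> \<delta>) (loop_join \<gamma>' \<delta>')"
      using that by (intro loop_join_homotopic) (simp_all add: loop_class_def)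
    then show ?thesis using loop_class_eq_iff[OF loop_join_loop[OF assms], of "loop_join \<gamma>' \<delta>'"] by simp
  qed
  moreover have "\<gamma> \<in> ?C \<gamma>" "\<delta> \<in> ?C \<delta>"
    using assms loop_homotopic_refl by (simp_all add: loop_class_def)
  ultimately have "(\<Union>\<gamma>'\<in>?C \<gamma>. \<Union>\<delta>'\<in>?C \<delta>. ?C (loop_join \<gamma>' \<delta>')) = ?C (loop_join \<gamma> \<delta>)" by blast
  then show ?thesis by (simp add: fundamental_group_def)
qed

subsection \<open>The isomorphism\<close>

text \<open>
  The loop of \<open>g\<close> is the projection of a path on the sphere from the base point \<open>x\<close> to \<open>\<rho> g x\<close>.
  Its class does not depend on the path since the sphere is simply connected; conversely the
  class determines the end of the lift, hence \<open>g\<close>, by the monodromy theorem.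
\<close>

definition sphere_path :: "'h \<Rightarrow> 'g \<Rightarrow> (real \<Rightarrow> 'h) \<Rightarrow> bool" where
  "sphere_path x g c \<longleftrightarrow> path c \<and> path_image c \<subseteq> sphere 0 1 \<and> pathstart c = x \<and> pathfinish c = \<rho> g x"

definition deck_class :: "'h \<Rightarrow> 'g \<Rightarrow> (real \<Rightarrow> 'h set) set" where
  "deck_class x g = loop_class quotient_topology (orbit x) (orbit \<circ> (SOME c. sphere_path x g c))"

lemma sphere_simply_connected: "simply_connected (sphere 0 1 :: 'h set)"
  by (rule contractible_imp_simply_connected[OF contractible_sphere])

lemma sphere_path_exists:
  assumes "norm x = 1" "g \<in> carrier G"
  shows "\<exists>c. sphere_path x g c"
proof -
  have "path_connected (sphere 0 1 :: 'h set)"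
    using sphere_simply_connected by (simp add: simply_connected_eq_homotopic_paths)
  then show ?thesis using assms by (force simp: path_connected_def sphere_path_def \<rho>_norm)
qed

lemma projected_loop:
  assumes x: "norm x = 1" and g: "g \<in> carrier G" and c: "sphere_path x g c"
  shows "orbit \<circ> c \<in> loops_at quotient_topology (orbit x)"
proof (rule loopI)
  have "path (projection \<circ> c)" using c by (auto simp: sphere_path_def intro: path_continuous_image continuous_projection)
  then show "path (orbit_distance \<circ> (orbit \<circ> c))" by (simp add: projection_def[abs_def] o_def)
  show "(orbit \<circ> c) t \<in> orbits" if "t \<in> {0..1}" for t
  proof -
    have "c t \<in> sphere 0 1" using c that unfolding sphere_path_def path_image_def by blast
    then show ?thesis by (simp add: orbit_in_orbits)
  qed
  show "(orbit \<circ> c) 0 = orbit x" "(orbit \<circ> c) 1 = orbit x"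
    using c g by (simp_all add: sphere_path_def pathstart_def pathfinish_def orbit_\<rho>)
qed

lemma deck_class_eq:
  assumes x: "norm x = 1" and g: "g \<in> carrier G" and c: "sphere_path x g c"
  shows "deck_class x g = loop_class quotient_topology (orbit x) (orbit \<circ> c)"
proof -
  define c' where "c' = (SOME c. sphere_path x g c)"
  have c': "sphere_path x g c'" unfolding c'_def by (rule someI_ex[OF sphere_path_exists[OF x g]])
  have "homotopic_paths (sphere 0 1) c' c"
    using conjunct2[OF sphere_simply_connected[unfolded simply_connected_eq_homotopic_paths], rule_format, of c' c]
      c c' by (simp add: sphere_path_def)
  then have "homotopic_paths embedded_quotient (projection \<circ> c') (projection \<circ> c)"
    by (rule homotopic_paths_continuous_image[OF _ continuous_projection])
       (use projection_image in blast)
  then have "loop_homotopic (orbit x) (orbit \<circ> c') (orbit \<circ> c)"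
    by (subst loop_homotopic_iff[OF projected_loop[OF x g c'] projected_loop[OF x g c]])
       (simp add: projection_def[abs_def] o_def)
  then show ?thesis
    unfolding deck_class_def c'_def[symmetric] using loop_class_eq_iff[OF projected_loop[OF x g c']] by simp
qed

lemma deck_class_carrier:
  assumes "norm x = 1" "g \<in> carrier G"
  shows "deck_class x g \<in> carrier (fundamental_group quotient_topology (orbit x))"
  using sphere_path_exists[OF assms] deck_class_eq[OF assms] projected_loop[OF assms]
  by (auto simp: fundamental_group_def)

text \<open>
  A path from \<open>x\<close> to \<open>\<rho> g x\<close>, followed by the \<open>g\<close>-translate of a path from \<open>x\<close> to \<open>\<rho> h x\<close>, leads to
  \<open>\<rho> (g \<otimes> h) x\<close>, and its projection is the join of the two projected loops.
\<close>

lemma deck_class_mult: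
  assumes x: "norm x = 1" and g: "g \<in> carrier G" and h: "h \<in> carrier G"
  shows "deck_class x (g \<otimes> h) =
    deck_class x g \<otimes>\<^bsub>fundamental_group quotient_topology (orbit x)\<^esub> deck_class x h"
proof -
  obtain c where c: "sphere_path x g c" using sphere_path_exists[OF x g] by blast
  obtain d where d: "sphere_path x h d" using sphere_path_exists[OF x h] by blast
  have gd: "path (\<rho> g \<circ> d)" "path_image (\<rho> g \<circ> d) \<subseteq> sphere 0 1"
  proof -
    have "continuous_on S (\<rho> g)" for S
      by (rule linear_continuous_on[OF linear_isometry_bounded_linear[OF \<rho>_isometry[OF g]]])
    then show "path (\<rho> g \<circ> d)" using d by (auto simp: sphere_path_def intro: path_continuous_image)
    have "\<rho> g ` sphere 0 1 \<subseteq> sphere 0 1" using g by (auto simp: \<rho>_norm)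
    then show "path_image (\<rho> g \<circ> d) \<subseteq> sphere 0 1"
      using d unfolding sphere_path_def path_image_compose by blast
  qed
  have sp: "sphere_path x (g \<otimes> h) (c +++ (\<rho> g \<circ> d))"
    unfolding sphere_path_def
  proof (intro conjI)
    show "path (c +++ (\<rho> g \<circ> d))"
      using c d gd(1) by (intro path_join_imp) (simp_all add: sphere_path_def pathstart_compose)
    show "path_image (c +++ (\<rho> g \<circ> d)) \<subseteq> sphere 0 1"
      using path_image_join_subset[of c "\<rho> g \<circ> d"] gd(2) c unfolding sphere_path_def by blast
    show "pathstart (c +++ (\<rho> g \<circ> d)) = x" "pathfinish (c +++ (\<rho> g \<circ> d)) = \<rho> (g \<otimes> h) x"
      using c d g h by (simp_all add: sphere_path_def pathfinish_compose \<rho>_mult)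
  qed
  have "orbit \<circ> (c +++ (\<rho> g \<circ> d)) = loop_join (orbit \<circ> c) (orbit \<circ> d)"
    using g by (auto simp: joinpaths_def loop_join_def orbit_\<rho> fun_eq_iff)
  then show ?thesis
    using mult_loop_class[OF projected_loop[OF x g c] projected_loop[OF x h d]] g h
    by (simp add: deck_class_eq[OF x _ sp] deck_class_eq[OF x g c] deck_class_eq[OF x h d])
qed

lemma deck_class_inj:
  assumes x: "norm x = 1" and g: "g \<in> carrier G" and h: "h \<in> carrier G"
    and eq: "deck_class x g = deck_class x h"
  shows "g = h"
proof -
  obtain c where c: "sphere_path x g c" using sphere_path_exists[OF x g] by blast
  obtain d where d: "sphere_path x h d" using sphere_path_exists[OF x h] by blast
  note lc = projected_loop[OF x g c] and ld = projected_loop[OF x h d]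
  have "loop_homotopic (orbit x) (orbit \<circ> c) (orbit \<circ> d)"
    using eq loop_class_eq_iff[OF lc] by (simp add: deck_class_eq[OF x g c] deck_class_eq[OF x h d])
  then have hom: "homotopic_paths embedded_quotient (orbit_distance \<circ> (orbit \<circ> c)) (orbit_distance \<circ> (orbit \<circ> d))"
    by (simp add: loop_homotopic_iff[OF lc ld])
  have "pathfinish c = pathfinish d"
    using c d
    by (intro covering_space_monodromy[OF covering_sphere loop_path(1,2)[OF lc] loop_path(1,2)[OF ld] hom])
       (auto simp: sphere_path_def projection_def)
  then have "\<rho> g x = \<rho> h x" using c d by (simp add: sphere_path_def)
  then show ?thesis by (rule free_action[OF x g h])
qed

lemma deck_class_surj:
  assumes x: "norm x = 1" and \<gamma>: "\<gamma> \<in> loops_at quotient_topology (orbit x)"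
  shows "\<exists>g\<in>carrier G. deck_class x g = loop_class quotient_topology (orbit x) \<gamma>"
proof -
  note lp = loop_path[OF \<gamma>]
  obtain c where c: "path c" "path_image c \<subseteq> sphere 0 1" "pathstart c = x"
      "\<And>t. t \<in> {0..1} \<Longrightarrow> projection (c t) = (orbit_distance \<circ> \<gamma>) t"
    using covering_space_lift_path_strong[OF covering_sphere _ lp(1,2), of x] x lp(3)
    by (auto simp: projection_def)
  have lift: "orbit (c t) = \<gamma> t" if t: "t \<in> {0..1}" for t
  proof -
    have "c t \<in> sphere 0 1" using c(2) t unfolding path_image_def by blast
    then have "orbit (c t) \<in> orbits" by (simp add: orbit_in_orbits)
    then show ?thesis
      using c(4)[OF t] inj_on_eq_iff[OF inj_orbit_distance _ lp(5)[OF t]] by (simp add: projection_def)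
  qed
  have "orbit (c 1) = orbit x" using lift[of 1] \<gamma> by (simp add: loops_at_def)
  then obtain g where g: "g \<in> carrier G" "c 1 = \<rho> g x" by (auto simp: orbit_eq_iff)
  have sp: "sphere_path x g c" using c g by (simp add: sphere_path_def pathfinish_def)
  have "loop_homotopic (orbit x) (orbit \<circ> c) \<gamma>"
    by (rule loop_homotopic_if_equal[OF projected_loop[OF x g(1) sp]]) (simp add: lift)
  then show ?thesis
    using loop_class_eq_iff[OF projected_loop[OF x g(1) sp]] deck_class_eq[OF x g(1) sp] g(1) by auto
qed

theorem fundamental_group_quotient:
  assumes "p \<in> topspace quotient_topology"
  shows "fundamental_group quotient_topology p \<cong> G"
proof -
  obtain x where x: "norm x = 1" "p = orbit x" using assms orbits_E by auto
  let ?\<pi> = "fundamental_group quotient_topology p"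
  have "deck_class x \<in> iso G ?\<pi>"
  proof (rule isoI)
    show "deck_class x \<in> hom G ?\<pi>"
      unfolding hom_def using deck_class_carrier[OF x(1)] deck_class_mult[OF x(1)] x(2) by auto
    show "bij_betw (deck_class x) (carrier G) (carrier ?\<pi>)"
    proof (rule bij_betw_imageI)
      show "inj_on (deck_class x) (carrier G)" using deck_class_inj[OF x(1)] by (auto intro: inj_onI)
      show "deck_class x ` carrier G = carrier ?\<pi>"
        using deck_class_carrier[OF x(1)] deck_class_surj[OF x(1)] x(2)
        by (fastforce simp: fundamental_group_def)
    qed
  qed
  then show ?thesis using is_isoI iso_sym by blast
qed

end

section \<open>Torsion-free groups act uniformly freely on a sphere\<close>

instance ell2 :: (type) banach ..

subsection \<open>Isometries of \<open>\<ell>\<^sup>2\<close> induced by injections of the index set\<close>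

text \<open>For an injection \<open>\<tau>\<close>, the isometry that takes the basis vector of index \<open>i\<close> to that of index \<open>\<tau> i\<close>.\<close>

definition push :: "('i \<Rightarrow> 'i) \<Rightarrow> 'i ell2 \<Rightarrow> 'i ell2" where
  "push \<tau> f = Abs_ell2 (\<lambda>j. if j \<in> range \<tau> then ell2_coord f (inv_into UNIV \<tau> j) else 0)"

context
  fixes \<tau> :: "'i \<Rightarrow> 'i"
  assumes \<tau>: "inj \<tau>"
begin

lemma coord_push: "ell2_coord (push \<tau> f) j = (if j \<in> range \<tau> then ell2_coord f (inv_into UNIV \<tau> j) else 0)"
proof -
  let ?h = "\<lambda>j. if j \<in> range \<tau> then ell2_coord f (inv_into UNIV \<tau> j) else 0"
  have "(\<lambda>j. (?h j)\<^sup>2) summable_on range \<tau> \<longleftrightarrow> ((\<lambda>j. (?h j)\<^sup>2) \<circ> \<tau>) summable_on UNIV"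
    by (rule summable_on_reindex[OF \<tau>])
  moreover have "(\<lambda>j. (?h j)\<^sup>2) \<circ> \<tau> = (\<lambda>i. (ell2_coord f i)\<^sup>2)" using \<tau> by (auto simp: inv_f_f)
  ultimately have "(\<lambda>j. (?h j)\<^sup>2) summable_on range \<tau>" using ell2_coord_summable[of f] by simp
  moreover have "(\<lambda>j. (?h j)\<^sup>2) summable_on range \<tau> \<longleftrightarrow> (\<lambda>j. (?h j)\<^sup>2) summable_on UNIV"
    by (rule summable_on_cong_neutral) auto
  ultimately show ?thesis by (simp add: push_def Abs_ell2_inverse)
qed

lemma coord_push_image: "ell2_coord (push \<tau> f) (\<tau> i) = ell2_coord f i"
  using \<tau> by (simp add: coord_push inv_f_f)

lemma coord_push_off_range: "j \<notin> range \<tau> \<Longrightarrow> ell2_coord (push \<tau> f) j = 0"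
  by (simp add: coord_push)

lemma push_isometry: "linear_isometry (push \<tau>)"
  unfolding linear_isometry_def
proof (intro conjI allI linearI)
  show "push \<tau> (f + g) = push \<tau> f + push \<tau> g" for f g
    by (rule ell2_eqI) (simp add: coord_push coord_simps)
  show "push \<tau> (r *\<^sub>R f) = r *\<^sub>R push \<tau> f" for r f
    by (rule ell2_eqI) (simp add: coord_push coord_simps)
  fix f
  have "(norm (push \<tau> f))\<^sup>2 = (\<Sum>\<^sub>\<infinity>j\<in>range \<tau>. (ell2_coord (push \<tau> f) j)\<^sup>2)"
    unfolding norm_ell2_sq by (rule infsum_cong_neutral) (auto simp: coord_push_off_range)
  also have "\<dots> = (\<Sum>\<^sub>\<infinity>i. ((\<lambda>j. (ell2_coord (push \<tau> f) j)\<^sup>2) \<circ> \<tau>) i)"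
    by (rule infsum_reindex[OF \<tau>])
  also have "\<dots> = (norm f)\<^sup>2" by (simp add: o_def coord_push_image norm_ell2_sq)
  finally show "norm (push \<tau> f) = norm f" by simp
qed

lemma push_surj_on_supported:
  assumes "\<And>j. j \<notin> range \<tau> \<Longrightarrow> ell2_coord y j = 0"
  shows "y \<in> range (push \<tau>)"
proof -
  have "(\<lambda>j. (ell2_coord y j)\<^sup>2) summable_on range \<tau>"
    by (rule summable_on_subset_banach[OF ell2_coord_summable]) simp
  then have "(\<lambda>i. (ell2_coord y (\<tau> i))\<^sup>2) summable_on UNIV"
    by (simp add: summable_on_reindex[OF \<tau>] o_def)
  then have x: "ell2_coord (Abs_ell2 (\<lambda>i. ell2_coord y (\<tau> i))) = (\<lambda>i. ell2_coord y (\<tau> i))"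
    by (simp add: Abs_ell2_inverse)
  have "y = push \<tau> (Abs_ell2 (\<lambda>i. ell2_coord y (\<tau> i)))"
  proof (rule ell2_eqI)
    fix j
    show "ell2_coord y j = ell2_coord (push \<tau> (Abs_ell2 (\<lambda>i. ell2_coord y (\<tau> i)))) j"
    proof (cases "j \<in> range \<tau>")
      case True
      then show ?thesis by (auto simp: coord_push_image x)
    qed (simp add: coord_push_off_range assms)
  qed
  then show ?thesis by blast
qed

end

definition basis_vector :: "'i \<Rightarrow> 'i ell2" where
  "basis_vector k = Abs_ell2 (\<lambda>j. if j = k then 1 else 0)"

lemma coord_basis_vector: "ell2_coord (basis_vector k) j = (if j = k then 1 else 0)"
proof -
  have "(\<lambda>j. (if j = k then 1 else 0 :: real)\<^sup>2) summable_on UNIV \<longleftrightarrow>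
      (\<lambda>j. (if j = k then 1 else 0 :: real)\<^sup>2) summable_on {k}"
    by (rule summable_on_cong_neutral) auto
  then show ?thesis by (simp add: basis_vector_def Abs_ell2_inverse)
qed

lemma inner_basis_vector: "inner y (basis_vector k) = ell2_coord y k"
proof -
  have "inner y (basis_vector k) = (\<Sum>\<^sub>\<infinity>j\<in>{k}. ell2_coord y j * ell2_coord (basis_vector k) j)"
    unfolding inner_ell2_def by (rule infsum_cong_neutral) (auto simp: coord_basis_vector)
  then show ?thesis by (simp add: coord_basis_vector)
qed

text \<open>
  A unilateral shift along one copy of \<open>\<nat>\<close> in the index set maps the whole space onto a
  hyperplane, and reverses no vector.
\<close>

definition shift_index :: "'a \<Rightarrow> 'a \<times> nat \<Rightarrow> 'a \<times> nat" where
  "shift_index a j = (if fst j = a then (a, Suc (snd j)) else j)"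

lemma sphere_projection_shift:
  "sphere_projection (push (shift_index a)) (basis_vector (a, 0) :: ('a \<times> nat) ell2)"
proof
  have inj: "inj (shift_index a)"
    by (auto simp: inj_def shift_index_def split: if_splits)
  have ran: "range (shift_index a) = - {(a, 0)}"
  proof (intro equalityI subsetI)
    fix j :: "'a \<times> nat" assume j: "j \<in> - {(a, 0)}"
    show "j \<in> range (shift_index a)"
    proof (cases "fst j = a")
      case True
      then obtain n where "j = (a, Suc n)" using j by (cases j; cases "snd j") auto
      then show ?thesis by (intro image_eqI[of _ _ "(a, n)"]) (auto simp: shift_index_def)
    next
      case False
      then show ?thesis by (intro image_eqI[of _ _ j]) (auto simp: shift_index_def)
    qed
  qed (auto simp: shift_index_def split: if_splits)
  show "linear_isometry (push (shift_index a))" by (rule push_isometry[OF inj])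
  show "range (push (shift_index a)) = {y. inner y (basis_vector (a, 0)) = 0}"
  proof (intro equalityI subsetI)
    fix y :: "('a \<times> nat) ell2" assume "y \<in> {y. inner y (basis_vector (a, 0)) = 0}"
    then show "y \<in> range (push (shift_index a))"
      by (intro push_surj_on_supported[OF inj]) (auto simp: ran inner_basis_vector)
  qed (auto simp: inner_basis_vector coord_push_off_range[OF inj] ran)
  have "inner (basis_vector (a, 0)) (basis_vector (a, 0)) = (1 :: real)"
    unfolding inner_basis_vector by (simp add: coord_basis_vector)
  then show "norm (basis_vector (a, 0)) = 1" by (simp add: norm_eq_sqrt_inner)
  fix x assume x: "push (shift_index a) x = - x"
  have neg: "ell2_coord (push (shift_index a) x) j = - ell2_coord x j" for j
    unfolding x by (rule coord_uminus)
  have "ell2_coord x (b, n) = 0" for b n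
  proof (cases "b = a")
    case True
    show ?thesis unfolding True
    proof (induction n)
      case 0
      then show ?case using neg[of "(a, 0)"] coord_push_off_range[OF inj, of "(a, 0)" x] by (simp add: ran)
    next
      case (Suc n)
      then show ?case
        using neg[of "(a, Suc n)"] coord_push_image[OF inj, of x "(a, n)"] by (simp add: shift_index_def)
    qed
  next
    case False
    then show ?thesis
      using neg[of "(b, n)"] coord_push_image[OF inj, of x "(b, n)"] by (simp add: shift_index_def)
  qed
  then show "x = 0" by (intro ell2_eqI) (auto simp: coord_zero)
qed

subsection \<open>A free action on the index set\<close>

text \<open>
  An infinite set \<open>J\<close> satisfies \<open>\<bar>J \<times> J\<bar> = \<bar>J\<bar>\<close>. The factor \<open>nat\<close> makes the index set infinite also for a
  finite type \<open>'g\<close>.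
\<close>

lemma ex_bij_times_index:
  fixes C :: "'g set"
  assumes "c \<in> C"
  shows "\<exists>\<beta>. bij_betw \<beta> (C \<times> (UNIV :: ('g \<times> nat) set)) (UNIV :: ('g \<times> nat) set)"
proof -
  have "infinite (UNIV :: ('g \<times> nat) set)"
    by (simp add: finite_prod)
  then obtain f :: "('g \<times> nat) \<times> ('g \<times> nat) \<Rightarrow> 'g \<times> nat" where f: "bij_betw f (UNIV \<times> UNIV) UNIV"
    using card_of_Times_same_infinite card_of_ordIso by metis
  have "inj_on (\<lambda>(g, j). f ((g, 0), j)) (C \<times> UNIV)"
    using f by (auto simp: inj_on_def bij_betw_def)
  moreover have "inj_on (\<lambda>j :: 'g \<times> nat. (c, j)) UNIV" by (auto simp: inj_on_def)
  ultimately show ?thesis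
    using assms by (intro Schroeder_Bernstein[where g = "\<lambda>j. (c, j)"]) auto
qed

context group
begin

text \<open>Transport the left multiplication on \<open>carrier G \<times> J\<close>, which is free, to the index set \<open>J\<close>.\<close>

lemma ex_free_action_on_index:
  "\<exists>act :: 'a \<Rightarrow> 'a \<times> nat \<Rightarrow> 'a \<times> nat. (\<forall>j. act \<one> j = j) \<and>
    (\<forall>g\<in>carrier G. \<forall>h\<in>carrier G. \<forall>j. act (g \<otimes> h) j = act g (act h j)) \<and>
    (\<forall>g\<in>carrier G. \<forall>h\<in>carrier G. \<forall>j. act g j = act h j \<longrightarrow> g = h)"
proof -
  obtain \<beta> where \<beta>: "bij_betw \<beta> (carrier G \<times> (UNIV :: ('a \<times> nat) set)) (UNIV :: ('a \<times> nat) set)"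
    using ex_bij_times_index[OF one_closed] by blast
  define \<alpha> where "\<alpha> = inv_into (carrier G \<times> (UNIV :: ('a \<times> nat) set)) \<beta>"
  define act where "act g j = \<beta> (g \<otimes> fst (\<alpha> j), snd (\<alpha> j))" for g j
  have \<alpha>\<beta>: "\<alpha> (\<beta> (h, i)) = (h, i)" if "h \<in> carrier G" for h i
    using \<beta> that unfolding \<alpha>_def by (intro inv_into_f_f) (auto simp: bij_betw_def)
  have \<beta>\<alpha>: "\<beta> (\<alpha> j) = j" for j
    using \<beta> unfolding \<alpha>_def by (intro f_inv_into_f) (auto simp: bij_betw_def)
  have \<alpha>: "fst (\<alpha> j) \<in> carrier G" for j
  proof -
    have "\<alpha> j \<in> carrier G \<times> UNIV"
      using \<beta> unfolding \<alpha>_def by (intro inv_into_into) (auto simp: bij_betw_def)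
    then show ?thesis by auto
  qed
  have "act \<one> j = j" for j using \<alpha>[of j] \<beta>\<alpha>[of j] by (simp add: act_def)
  moreover have "act (g \<otimes> h) j = act g (act h j)" if "g \<in> carrier G" "h \<in> carrier G" for g h j
    using that \<alpha>[of j] by (simp add: act_def \<alpha>\<beta> m_assoc)
  moreover have "g = h" if gh: "g \<in> carrier G" "h \<in> carrier G" and e: "act g j = act h j" for g h j
  proof -
    have "\<alpha> (act g j) = \<alpha> (act h j)" using e by simp
    then have "g \<otimes> fst (\<alpha> j) = h \<otimes> fst (\<alpha> j)" using gh \<alpha>[of j] by (simp add: act_def \<alpha>\<beta>)
    then show ?thesis using gh \<alpha>[of j] by simp
  qed
  ultimately show ?thesis by blast
qed

text \<open>
  Let \<open>F\<close> be a finite set of indices that carries more than three quarters of the mass of the unit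
  vector \<open>x\<close>. If \<open>g\<close> moves \<open>F\<close> off itself, then \<open>\<rho> g x\<close> has less than a quarter of its mass on
  \<open>F\<close>, so it is far from \<open>x\<close>. As the action on indices is free, only finitely many \<open>g\<close> do not move \<open>F\<close>
  off itself. These do not fix \<open>x\<close>: since \<open>g\<close> has infinite order, a fixed square-summable
  family would be constant along infinite orbits.
\<close>

lemma uniform_displacement:
  fixes act :: "'a \<Rightarrow> 'a \<times> nat \<Rightarrow> 'a \<times> nat"
  assumes torsion_free: "\<And>x (n::nat). x \<in> carrier G \<Longrightarrow> n > 0 \<Longrightarrow> x [^] n = \<one> \<Longrightarrow> x = \<one>"
    and one: "\<And>j. act \<one> j = j"
    and mult: "\<And>g h j. g \<in> carrier G \<Longrightarrow> h \<in> carrier G \<Longrightarrow> act (g \<otimes> h) j = act g (act h j)"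
    and free: "\<And>g h j. g \<in> carrier G \<Longrightarrow> h \<in> carrier G \<Longrightarrow> act g j = act h j \<Longrightarrow> g = h"
    and x: "norm (x :: ('a \<times> nat) ell2) = 1"
  shows "\<exists>e>0. \<forall>g\<in>carrier G. g \<noteq> \<one> \<longrightarrow> e \<le> norm (push (act g) x - x)"
proof -
  have inv1: "act (m_inv G g) (act g j) = j" and inv2: "act g (act (m_inv G g) j) = j" if "g \<in> carrier G" for g j
    using that one by (simp_all add: mult[symmetric])
  have inj: "inj (act g)" if "g \<in> carrier G" for g
    by (rule inj_on_inverseI[of _ "act (m_inv G g)"]) (rule inv1[OF that])
  have coord: "ell2_coord (push (act g) x) (act g j) = ell2_coord x j" if "g \<in> carrier G" for g j
    by (rule coord_push_image[OF inj[OF that]])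
  have nofix: "push (act g) x \<noteq> x" if g: "g \<in> carrier G" "g \<noteq> \<one>" for g
  proof
    assume "push (act g) x = x"
    then have inva: "ell2_coord x (act g j) = ell2_coord x j" for j using coord[OF g(1), of j] by simp
    have const: "ell2_coord x (act (g [^] n) j) = ell2_coord x j" for n :: nat and j
    proof (induction n)
      case (Suc n)
      have "act (g [^] Suc n) j = act g (act (g [^] n) j)"
        using g(1) mult[of g "g [^] n" j] nat_pow_Suc2[OF g(1), of n] by simp
      then show ?case using Suc inva by simp
    qed (simp add: one)
    have pow_inj: "m = n" if e: "g [^] m = g [^] n" for m n :: nat
    proof -
      have "m = n" if "m \<le> n" "g [^] m = g [^] n" for m n :: nat
      proof (rule ccontr)
        assume ne: "m \<noteq> n"
        have "g [^] m \<otimes> g [^] (n - m) = g [^] n" using g(1) that(1) by (simp add: nat_pow_mult)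
        also have "\<dots> = g [^] m \<otimes> \<one>" using g(1) that(2) by simp
        finally have "g [^] (n - m) = \<one>" using g(1) by simp
        then show False using torsion_free[OF g(1), of "n - m"] ne that(1) g(2) by simp
      qed
      then show ?thesis using e by (metis nat_le_linear)
    qed
    have "ell2_coord x j = 0" for j
    proof (rule ccontr)
      let ?c = "(ell2_coord x j)\<^sup>2"
      assume "ell2_coord x j \<noteq> 0"
      then have c: "?c > 0" by simp
      obtain m :: nat where m: "1 / ?c < real m" using reals_Archimedean2 by blast
      have injn: "inj_on (\<lambda>n. act (g [^] n) j) {..<m}"
        using g(1) free pow_inj by (intro inj_onI) (meson nat_pow_closed)
      have "real m * ?c = (\<Sum>n<m. (ell2_coord x (act (g [^] n) j))\<^sup>2)" by (simp add: const)
      also have "\<dots> = (\<Sum>i\<in>(\<lambda>n. act (g [^] n) j) ` {..<m}. (ell2_coord x i)\<^sup>2)"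
        by (simp add: sum.reindex[OF injn])
      also have "\<dots> \<le> (norm x)\<^sup>2" by (rule sum_coord_le_norm) simp
      finally show False using m c x by (simp add: field_simps)
    qed
    then have "x = 0" by (intro ell2_eqI) (simp add: coord_zero)
    then show False using x by simp
  qed
  obtain F where F: "finite F" "dist (\<Sum>i\<in>F. (ell2_coord x i)\<^sup>2) (\<Sum>\<^sub>\<infinity>i. (ell2_coord x i)\<^sup>2) \<le> 1 / 8"
    using infsum_finite_approximation[OF ell2_coord_summable[of x], of "1 / 8"] by auto
  have mass: "(\<Sum>i\<in>F. (ell2_coord x i)\<^sup>2) > 3 / 4"
  proof -
    have "(\<Sum>\<^sub>\<infinity>i. (ell2_coord x i)\<^sup>2) = 1" using norm_ell2_sq[of x] x by simp
    then have "- ((\<Sum>i\<in>F. (ell2_coord x i)\<^sup>2) - 1) \<le> 1 / 8"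
      using F(2) unfolding dist_real_def abs_le_iff by simp
    then show ?thesis by simp
  qed
  define near where "near = {g \<in> carrier G. \<exists>i\<in>F. \<exists>j\<in>F. act g i = j}"
  have "finite near"
  proof -
    have "finite {g \<in> carrier G. act g i = j}" for i j
    proof (cases "\<exists>g\<in>carrier G. act g i = j")
      case True
      then obtain g where "g \<in> carrier G" "act g i = j" by blast
      then have "{g \<in> carrier G. act g i = j} \<subseteq> {g}" using free by blast
      then show ?thesis by (rule finite_subset) simp
    next
      case False
      then have "{g \<in> carrier G. act g i = j} = {}" by blast
      then show ?thesis by (metis finite.emptyI)
    qed
    then have "finite (\<Union>i\<in>F. \<Union>j\<in>F. {g \<in> carrier G. act g i = j})" using F(1) by blast
    moreover have "near \<subseteq> (\<Union>i\<in>F. \<Union>j\<in>F. {g \<in> carrier G. act g i = j})" by (auto simp: near_def)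
    ultimately show ?thesis by (rule finite_subset[rotated])
  qed
  have far: "1 / 4 \<le> norm (push (act g) x - x)" if g: "g \<in> carrier G" "g \<notin> near" for g
  proof -
    let ?b = "act (m_inv G g)"
    let ?y = "push (act g) x"
    have y: "ell2_coord ?y j = ell2_coord x (?b j)" for j
      using coord[OF g(1), of "?b j"] by (simp add: inv2[OF g(1)])
    have b: "inj_on ?b F" using inj[of "m_inv G g"] g(1) by (auto intro: inj_on_subset)
    have disj: "?b ` F \<inter> F = {}"
    proof (rule ccontr)
      assume "?b ` F \<inter> F \<noteq> {}"
      then obtain i where i: "i \<in> F" "?b i \<in> F" by blast
      have "act g (?b i) = i" by (rule inv2[OF g(1)])
      then show False using g i unfolding near_def by blast
    qed
    have "(\<Sum>i\<in>?b ` F \<union> F. (ell2_coord x i)\<^sup>2) \<le> (norm x)\<^sup>2"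
      using F(1) by (intro sum_coord_le_norm) auto
    then have "(\<Sum>i\<in>?b ` F. (ell2_coord x i)\<^sup>2) + (\<Sum>i\<in>F. (ell2_coord x i)\<^sup>2) \<le> 1"
      using F(1) disj x by (simp add: sum.union_disjoint)
    then have my: "(\<Sum>i\<in>F. (ell2_coord ?y i)\<^sup>2) \<le> 1 / 4"
      using mass by (simp add: y sum.reindex[OF b])
    \<comment> \<open>this follows from \<open>(a + b)\<^sup>2 \<le> 2 a\<^sup>2 + 2 b\<^sup>2\<close>; summed over \<open>F\<close> it gives \<open>3/4 < 2 m + 2 \<cdot> 1/4\<close> for the mass \<open>m\<close> of \<open>?y - x\<close>\<close>
    have "(ell2_coord x i)\<^sup>2 \<le> 2 * (ell2_coord (?y - x) i)\<^sup>2 + 2 * (ell2_coord ?y i)\<^sup>2" for i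
    proof -
      have "0 \<le> (2 * ell2_coord ?y i - ell2_coord x i)\<^sup>2" by simp
      then show ?thesis by (simp add: coord_minus power2_eq_square algebra_simps)
    qed
    then have "(\<Sum>i\<in>F. (ell2_coord x i)\<^sup>2) \<le> (\<Sum>i\<in>F. 2 * (ell2_coord (?y - x) i)\<^sup>2 + 2 * (ell2_coord ?y i)\<^sup>2)"
      by (intro sum_mono)
    also have "\<dots> = 2 * (\<Sum>i\<in>F. (ell2_coord (?y - x) i)\<^sup>2) + 2 * (\<Sum>i\<in>F. (ell2_coord ?y i)\<^sup>2)"
      by (simp add: sum.distrib sum_distrib_left)
    finally have "1 / 8 \<le> (\<Sum>i\<in>F. (ell2_coord (?y - x) i)\<^sup>2)" using mass my by simp
    also have "\<dots> \<le> (norm (?y - x))\<^sup>2" by (rule sum_coord_le_norm[OF F(1)])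
    finally have "(1 / 4)\<^sup>2 \<le> (norm (?y - x))\<^sup>2" by (simp add: power2_eq_square)
    then show ?thesis by (rule power2_le_imp_le) simp
  qed
  define e where "e = Min (insert (1 / 4) ((\<lambda>g. norm (push (act g) x - x)) ` (near - {\<one>})))"
  have fin: "finite (insert (1 / 4) ((\<lambda>g. norm (push (act g) x - x)) ` (near - {\<one>})))"
    using \<open>finite near\<close> by simp
  have "e > 0" unfolding e_def using fin nofix by (subst Min_gr_iff) (auto simp: near_def)
  moreover have "e \<le> norm (push (act g) x - x)" if g: "g \<in> carrier G" "g \<noteq> \<one>" for g
  proof (cases "g \<in> near")
    case True
    then show ?thesis unfolding e_def using g fin by (intro Min_le) auto
  next
    case False
    have "e \<le> 1 / 4" unfolding e_def using fin by (intro Min_le) auto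
    then show ?thesis using far[OF g(1) False] by simp
  qed
  ultimately show ?thesis by blast
qed

lemma ex_sphere_quotient:
  assumes "\<And>x (n::nat). x \<in> carrier G \<Longrightarrow> n > 0 \<Longrightarrow> x [^] n = \<one> \<Longrightarrow> x = \<one>"
  shows "\<exists>(T :: ('a \<times> nat) ell2 \<Rightarrow> ('a \<times> nat) ell2) N \<rho>. sphere_quotient T N G \<rho>"
proof -
  obtain act :: "'a \<Rightarrow> 'a \<times> nat \<Rightarrow> 'a \<times> nat" where act: "\<And>j. act \<one> j = j"
    "\<And>g h j. g \<in> carrier G \<Longrightarrow> h \<in> carrier G \<Longrightarrow> act (g \<otimes> h) j = act g (act h j)"
    "\<And>g h j. g \<in> carrier G \<Longrightarrow> h \<in> carrier G \<Longrightarrow> act g j = act h j \<Longrightarrow> g = h"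
    using ex_free_action_on_index by blast
  have inv2: "act g (act (m_inv G g) j) = j" and inv1: "act (m_inv G g) (act g j) = j" if "g \<in> carrier G" for g j
    using that act(1) by (simp_all add: act(2)[symmetric])
  have inj: "inj (act g)" if "g \<in> carrier G" for g
    by (rule inj_on_inverseI[of _ "act (m_inv G g)"]) (rule inv1[OF that])
  have push1: "push (act \<one>) f = f" for f
  proof (rule ell2_eqI)
    show "ell2_coord (push (act \<one>) f) j = ell2_coord f j" for j
      using coord_push_image[OF inj[OF one_closed], of f j] by (simp add: act(1))
  qed
  have push2: "push (act (g \<otimes> h)) f = push (act g) (push (act h) f)"
    if gh: "g \<in> carrier G" "h \<in> carrier G" for g h f
  proof (rule ell2_eqI)
    fix k
    define j where "j = act (m_inv G (g \<otimes> h)) k"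
    have k: "k = act (g \<otimes> h) j" unfolding j_def using gh by (simp add: inv2)
    have "ell2_coord (push (act (g \<otimes> h)) f) k = ell2_coord f j"
      unfolding k using gh by (intro coord_push_image inj) simp
    moreover have "ell2_coord (push (act g) (push (act h) f)) k = ell2_coord f j"
      unfolding k act(2)[OF gh] using gh by (simp add: coord_push_image inj)
    ultimately show "ell2_coord (push (act (g \<otimes> h)) f) k = ell2_coord (push (act g) (push (act h) f)) k" by simp
  qed
  interpret S: sphere_projection "push (shift_index undefined)" "basis_vector (undefined :: 'a, 0 :: nat)"
    by (rule sphere_projection_shift)
  have "sphere_quotient (push (shift_index undefined)) (basis_vector (undefined :: 'a, 0 :: nat)) G (\<lambda>g. push (act g))"
  proof
    show "linear_isometry (push (act g))" if "g \<in> carrier G" for g by (rule push_isometry[OF inj[OF that]])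
    show "push (act \<one>) x = x" for x by (rule push1)
    show "push (act (g \<otimes> h)) x = push (act g) (push (act h) x)" if "g \<in> carrier G" "h \<in> carrier G" for g h x
      by (rule push2[OF that])
    show "\<exists>e>0. \<forall>g\<in>carrier G. g \<noteq> \<one> \<longrightarrow> e \<le> norm (push (act g) x - x)" if "norm x = 1" for x
      using uniform_displacement[OF assms act that] .
  qed
  then show ?thesis by blast
qed

end

theorem corollary3:
  fixes G :: "('g, 'm) monoid_scheme"
  assumes "group G"
    and "\<And>x (n::nat). x \<in> carrier G \<Longrightarrow> n > 0 \<Longrightarrow> x [^]\<^bsub>G\<^esub> n = \<one>\<^bsub>G\<^esub> \<Longrightarrow> x = \<one>\<^bsub>G\<^esub>"
  shows "\<exists>(X :: ('g \<times> nat) ell2 set topology)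
      (A :: (('g \<times> nat) ell2 set, ('g \<times> nat) ell2) chart set)
      (g :: (('g \<times> nat) ell2 set, ('g \<times> nat) ell2) metric_tensor) (\<kappa> :: real).
    hilbert_manifold X A \<and> topspace X \<noteq> {} \<and> connected_space X \<and>
    riemannian_metric X A g \<and> complete_riemannian X A g \<and>
    \<kappa> > 0 \<and> constant_sectional_curvature A g \<kappa> \<and>
    (\<forall>p\<in>topspace X. fundamental_group X p \<cong> G)"
proof -
  have "\<exists>(T :: ('g \<times> nat) ell2 \<Rightarrow> ('g \<times> nat) ell2) N \<rho>. sphere_quotient T N G \<rho>"
    by (rule group.ex_sphere_quotient[OF assms(1)]) (rule assms(2))
  then obtain T :: "('g \<times> nat) ell2 \<Rightarrow> ('g \<times> nat) ell2" and N \<rho> where "sphere_quotient T N G \<rho>"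
    by blast
  then interpret sphere_quotient T N G \<rho> .
  have "orbit N \<in> topspace quotient_topology" using N_unit by (simp add: orbit_in_orbits)
  then have "topspace quotient_topology \<noteq> {}" by blast
  then show ?thesis
    using hilbert_manifold_quotient connected_quotient riemannian_metric_spherical
      complete_riemannian_quotient constant_curvature_spherical fundamental_group_quotient zero_less_one
    by blast
qed

end
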